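(* There exist universal constants $c' \ge 0$ and $C' \ge 0$ such that the following holds. Let $k, q \ge 1$ be integers and $\varepsilon > 0$. Let $X(\le k)$ be a pure simplicial complex with $X(1) = [n]$, equipped with a probability measure $\Pi_k$ on $X(k)$ and the induced measures $\Pi_1,\dots,\Pi_{k-1}$, and let $\mathbf Y = \{\mathbf Y_1, \ldots, \mathbf Y_n\}$ be an $L$-local PSD ensemble with $|\mathrm{supp}(\mathbf Y_j)| \le q$ for all $j \in [n]$. Suppose $L \ge c' \cdot q^{k} k^5/\varepsilon^4$ and $X$ is a $\gamma$-HDX with $\gamma \le C' \cdot \varepsilon^4/(k^{8+k} \cdot 2^{6k} \cdot q^{2k})$. Let $\mathbf Y'$ be the conditioned ensemble produced by the Propagation Rounding procedure (described in the context) on input $\mathbf Y$ with $\ell = k$ and $\Pi = \Pi_k$. Then \[ \mathbb{E}_{\mathfrak a \sim \Pi_k}\left[ \left\| \{\mathbf Y'_{\mathfrak a}\} - \{\mathbf Y'_{a_1}\}\cdots\{\mathbf Y'_{a_k}\} \right\|_1 \right] \le \varepsilon, \] where the expectation is also over the random choices of the procedure (of $m$, the faces $\mathfrak s_1,\dots,\mathfrak s_m$, and $\eta_S$), and $\mathfrak a = \{a_1,\dots,a_k\}$.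
   Context: A simplicial complex $X$ on ground set $[n]$ is a downward-closed family of subsets of $[n]$; $X(i)$ denotes its faces of size $i$ and $X(0)=\{\emptyset\}$. $X(\le d)$ is pure if every face is contained in a face of size $d$. Given a probability measure $\Pi_d$ on $X(d)$, the measures $\Pi_i$ ($i<d$) are defined by sampling $\mathfrak s^{(d)} \sim \Pi_d$ and recursively letting $\mathfrak s^{(i-1)}$ be a uniformly random $(i-1)$-subset of $\mathfrak s^{(i)}$; $\Pi_i$ is the law of $\mathfrak s^{(i)}$. For a face $\mathfrak s \in X(i)$, $0 \le i \le d-2$, the link graph $G(X_{\mathfrak s})$ has vertex set $\{x : \mathfrak s \cup \{x\} \in X\}$, edges $\{x,y\}$ with $\mathfrak s \cup\{x,y\} \in X$, and edge weights proportional to $\Pi_{i+2}(\mathfrak s \cup \{x,y\})$. $X(\le d)$ is a $\gamma$-HDX if for every $0 \le i \le d-2$ and every $\mathfrak s \in X(i)$, the second largest singular value of the normalized (random-walk) adjacency matrix of $G(X_{\mathfrak s})$ is at most $\gamma$. A $t$-local ensemble $\mathbf Y_1,\dots,\mathbf Y_n$ of $[q]$-valued variables consists of distributions $\mu_S$ on $[q]^S$ for each $S\subseteq[n]$ with $|S|\le t$, consistent under restriction ($\mu_{S}$ restricted to $T\subseteq S$ equals $\mu_T$); $\{\mathbf Y_S\}$ denotes $\mu_S$. For $|T|\le t-2$ and $\beta\in[q]^T$ of positive probability, conditioning on $\mathbf Y_T=\beta$ gives the $(t-|T|)$-local ensemble $\mathbf Y'$ with $\{\mathbf Y'_S\} =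 \mu_{S\cup T}$ conditioned on $\mathbf Y_T=\beta$. The ensemble is a $t$-local PSD ensemble if for every such conditioning the matrix indexed by pairs $(S,\alpha)$ with $|S|\le (t-|T|)/2$, $\alpha\in[q]^S$, with entries $\mathrm{Cov}(\mathbf 1[\mathbf Y'_{S_1}=\alpha_1],\mathbf 1[\mathbf Y'_{S_2}=\alpha_2])$ (computed under $\{\mathbf Y'_{S_1\cup S_2}\}$), is positive semidefinite. (Such ensembles arise from $t$ levels of the Sum-of-Squares SDP hierarchy.) $\{\mathbf Y_{a_1}\}\cdots\{\mathbf Y_{a_k}\}$ denotes the product of the marginals, and $\|\cdot\|_1$ is the $\ell_1$ distance between distributions on $[q]^{\mathfrak a}$. Propagation Rounding procedure (input: $L$-local PSD ensemble $\mathbf Y$, integer $\ell$, distribution $\Pi$ on $X(\ell)$): (1) choose $m\in\{1,\dots,L/\ell\}$ uniformly at random; (2) independently sample $\mathfrak s_1,\dots,\mathfrak s_m\sim\Pi$; (3) let $S=\bigcup_j \mathfrak s_j$; (4) sample $\eta_S\sim\{\mathbf Y_S\}$; (5) let $\mathbf Y'$ be $\mathbf Y$ conditioned on $\mathbf Y_S=\eta_S$; (6) independently sample $\eta_j\sim\{\mathbf Y'_j\}$ for each $j\in[n]$ and output $\eta$. *)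

theory Defs
  imports "HOL-Probability.Product_PMF" "Jordan_Normal_Form.Char_Poly"
begin

section \<open>Singular values\<close>

text \<open>
  Singular values in decreasing order, with multiplicity. For real \<open>A\<close> the matrix \<open>A\<^sup>T A\<close> is
  symmetric positive semidefinite, so its characteristic polynomial splits over the reals
  and the list has \<open>dim_col A\<close> entries.
\<close>
definition singular_values :: "real mat \<Rightarrow> real list" where
  "singular_values A =
     rev (sorted_list_of_multiset
       (image_mset sqrt (proots (char_poly (transpose_mat A * A)))))"

definition second_singular_value :: "real mat \<Rightarrow> real" where
  "second_singular_value A = singular_values A ! 1"

section \<open>Weighted simplicial complexes and high-dimensional expansion\<close>

definition simplicial_complex :: "nat \<Rightarrow> nat set set \<Rightarrow> bool" where
  "simplicial_complex n X \<longleftrightarrow>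
     X \<subseteq> Pow {1..n} \<and> {} \<in> X \<and> (\<forall>s\<in>X. \<forall>t. t \<subseteq> s \<longrightarrow> t \<in> X)"

definition faces :: "nat set set \<Rightarrow> nat \<Rightarrow> nat set set" where
  "faces X i = {s \<in> X. card s = i}"

definition pure_upto :: "nat set set \<Rightarrow> nat \<Rightarrow> bool" where
  "pure_upto X d \<longleftrightarrow> (\<forall>s\<in>X. card s \<le> d \<longrightarrow> (\<exists>t\<in>faces X d. s \<subseteq> t))"

definition random_facet :: "nat set pmf \<Rightarrow> nat set pmf" where
  "random_facet P = bind_pmf P (\<lambda>s. pmf_of_set {t. t \<subseteq> s \<and> card t = card s - 1})"

definition induced_measure :: "nat \<Rightarrow> nat set pmf \<Rightarrow> nat \<Rightarrow> nat set pmf" where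
  "induced_measure d P i = (random_facet ^^ (d - i)) P"

definition link_vertices :: "nat set set \<Rightarrow> nat set \<Rightarrow> nat set" where
  "link_vertices X s = {x. x \<notin> s \<and> insert x s \<in> X}"

definition link_weight ::
    "nat set set \<Rightarrow> nat \<Rightarrow> nat set pmf \<Rightarrow> nat set \<Rightarrow> nat \<Rightarrow> nat \<Rightarrow> real" where
  "link_weight X d P s x y =
     (if x \<in> link_vertices X s \<and> y \<in> link_vertices X s \<and> x \<noteq> y \<and> s \<union> {x, y} \<in> X
      then pmf (induced_measure d P (card s + 2)) (s \<union> {x, y}) else 0)"

definition weighted_degree :: "nat set \<Rightarrow> (nat \<Rightarrow> nat \<Rightarrow> real) \<Rightarrow> nat \<Rightarrow> real" where
  "weighted_degree V w x = (\<Sum>y\<in>V. w x y)"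

text \<open>
  With \<open>W\<close> the weight matrix and \<open>D\<close> the diagonal degree matrix, this is
  \<open>D\<^sup>-\<^sup>1\<^sup>/\<^sup>2 W D\<^sup>-\<^sup>1\<^sup>/\<^sup>2\<close>, i.e. the random-walk matrix \<open>D\<^sup>-\<^sup>1 W\<close> written in
  an orthonormal basis of functions on \<open>V\<close> for the inner product weighted by the stationary
  distribution. Its (Euclidean) singular values are therefore the singular values of the random
  walk operator with respect to that inner product. Scaling the weights by a positive constant
  does not change it. Vertices of degree zero get zero rows and columns (as \<open>x / 0 = 0\<close>).
\<close>
definition normalized_adjacency :: "nat set \<Rightarrow> (nat \<Rightarrow> nat \<Rightarrow> real) \<Rightarrow> real mat" where
  "normalized_adjacency V w =
     (let vs = sorted_list_of_set V; d = weighted_degree V w in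
      Matrix.mat (card V) (card V)
        (\<lambda>(i, j). w (vs ! i) (vs ! j) / (sqrt (d (vs ! i)) * sqrt (d (vs ! j)))))"

definition hdx :: "nat set set \<Rightarrow> nat \<Rightarrow> nat set pmf \<Rightarrow> real \<Rightarrow> bool" where
  "hdx X d P \<gamma> \<longleftrightarrow>
     (\<forall>i s. i + 2 \<le> d \<longrightarrow> s \<in> faces X i \<longrightarrow>
        second_singular_value
          (normalized_adjacency (link_vertices X s) (link_weight X d P s)) \<le> \<gamma>)"

section \<open>Local PSD ensembles\<close>

text \<open>
  An assignment in \<open>[r]\<^sup>S\<close> is an element of \<open>S \<rightarrow>\<^sub>E {1..r}\<close>. An ensemble is a total function of
  the index set; the predicates below constrain it only on sets of size at most \<open>t\<close>, and its
  values on larger sets are arbitrary probability distributions.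
\<close>
type_synonym ensemble = "nat set \<Rightarrow> (nat \<Rightarrow> nat) pmf"

definition local_ensemble :: "nat \<Rightarrow> nat \<Rightarrow> nat \<Rightarrow> ensemble \<Rightarrow> bool" where
  "local_ensemble n r t Y \<longleftrightarrow>
     (\<forall>S. S \<subseteq> {1..n} \<and> card S \<le> t \<longrightarrow>
        set_pmf (Y S) \<subseteq> (S \<rightarrow>\<^sub>E {1..r}) \<and>
        (\<forall>T\<subseteq>S. map_pmf (\<lambda>f. restrict f T) (Y S) = Y T))"

definition marginal :: "ensemble \<Rightarrow> nat \<Rightarrow> nat pmf" where
  "marginal Y j = map_pmf (\<lambda>f. f j) (Y {j})"

definition condition_ensemble :: "ensemble \<Rightarrow> nat set \<Rightarrow> (nat \<Rightarrow> nat) \<Rightarrow> ensemble" where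
  "condition_ensemble Y T \<beta> =
     (\<lambda>S. map_pmf (\<lambda>f. restrict f S) (cond_pmf (Y (S \<union> T)) {f. restrict f T = \<beta>}))"

definition covariance :: "'a pmf \<Rightarrow> ('a \<Rightarrow> real) \<Rightarrow> ('a \<Rightarrow> real) \<Rightarrow> real" where
  "covariance p f g = measure_pmf.expectation p
     (\<lambda>x. (f x - measure_pmf.expectation p f) * (g x - measure_pmf.expectation p g))"

definition ensemble_cov ::
    "ensemble \<Rightarrow> nat set \<times> (nat \<Rightarrow> nat) \<Rightarrow> nat set \<times> (nat \<Rightarrow> nat) \<Rightarrow> real" where
  "ensemble_cov Y = (\<lambda>(S1, \<alpha>1) (S2, \<alpha>2).
     covariance (Y (S1 \<union> S2))
       (\<lambda>f. of_bool (restrict f S1 = \<alpha>1)) (\<lambda>f. of_bool (restrict f S2 = \<alpha>2)))"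

definition psd_on :: "'i set \<Rightarrow> ('i \<Rightarrow> 'i \<Rightarrow> real) \<Rightarrow> bool" where
  "psd_on I M \<longleftrightarrow>
     (\<forall>i\<in>I. \<forall>j\<in>I. M i j = M j i) \<and>
     (\<forall>v :: 'i \<Rightarrow> real. 0 \<le> (\<Sum>i\<in>I. \<Sum>j\<in>I. v i * M i j * v j))"

definition local_psd_ensemble :: "nat \<Rightarrow> nat \<Rightarrow> nat \<Rightarrow> ensemble \<Rightarrow> bool" where
  "local_psd_ensemble n r t Y \<longleftrightarrow>
     local_ensemble n r t Y \<and>
     (\<forall>T \<beta>. T \<subseteq> {1..n} \<and> card T + 2 \<le> t \<and> \<beta> \<in> set_pmf (Y T) \<longrightarrow>
        psd_on {(S, \<alpha>). S \<subseteq> {1..n} \<and> 2 * card S \<le> t - card T \<and> \<alpha> \<in> S \<rightarrow>\<^sub>E {1..r}}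
          (ensemble_cov (condition_ensemble Y T \<beta>)))"

definition product_of_marginals :: "ensemble \<Rightarrow> nat set \<Rightarrow> (nat \<Rightarrow> nat) pmf" where
  "product_of_marginals Y A = Pi_pmf A undefined (marginal Y)"

definition l1_dist ::
    "nat \<Rightarrow> nat set \<Rightarrow> (nat \<Rightarrow> nat) pmf \<Rightarrow> (nat \<Rightarrow> nat) pmf \<Rightarrow> real" where
  "l1_dist r A P Q = (\<Sum>f\<in>A \<rightarrow>\<^sub>E {1..r}. \<bar>pmf P f - pmf Q f\<bar>)"

section \<open>Propagation Rounding\<close>

text \<open>
  The result is the conditioned ensemble together with the rounded assignment. The range
  \<open>{1..L/l}\<close> for \<open>m\<close> consists of the integers in it, so its upper end is the floor of \<open>L/l\<close>.
\<close>
definition propagation_rounding ::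
    "nat \<Rightarrow> ensemble \<Rightarrow> nat \<Rightarrow> nat \<Rightarrow> nat set pmf \<Rightarrow> (ensemble \<times> (nat \<Rightarrow> nat)) pmf" where
  "propagation_rounding n Y L l P = do {
     m \<leftarrow> pmf_of_set {1..L div l};
     ss \<leftarrow> replicate_pmf m P;
     let S = \<Union>(set ss);
     \<eta>S \<leftarrow> Y S;
     let Y' = condition_ensemble Y S \<eta>S;
     \<eta> \<leftarrow> Pi_pmf {1..n} undefined (marginal Y');
     return_pmf (Y', \<eta>)
   }"

end

theory Submission
  imports Defs
begin

text \<open>
  Order the elements of a random face as \<open>a\<^sub>1, \<dots>, a\<^sub>k\<close>. Replacing the joint law by the product
  of the marginals one coordinate at a time, the \<open>\<ell>\<^sub>1\<close> distance is at most the sum over \<open>j\<close> of the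
  absolute covariances between the values on \<open>s = {a\<^sub>1, \<dots>, a\<^sub>j}\<close> and on \<open>x = a\<^sub>j\<^sub>+\<^sub>1\<close>; by Cauchy--Schwarz
  these are controlled by the squared covariances, at the cost of the factor \<open>q\<^sup>k\<close>.

  For a function \<open>g\<close> on vertices, the averages \<open>E[g(a\<^sub>j\<^sub>+\<^sub>1) | a\<^sub>1, \<dots>, a\<^sub>j]\<close> form a martingale whose
  increments are random walk steps in links, so each adds variance at most \<open>\<gamma>\<^sup>2 E[g\<^sup>2]\<close>. Hence the
  walk between \<open>j\<close>-faces and vertices has second singular value at most \<open>\<surd>j \<gamma>\<close>. Since
  squared covariances are a Gram kernel, their average over pairs \<open>(s, x)\<close> inside a random face
  exceeds the average over independent \<open>s\<close> and \<open>x\<close> by at most \<open>\<surd>j \<gamma>\<close>.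

  The latter average is at most the gain in \<open>E \<Sum>\<^sub>b P(Y\<^sub>x = b | Y\<^sub>S)\<^sup>2\<close> when one more random face
  is added to \<open>S\<close>. This quantity stays below \<open>1\<close>, so over the choices of \<open>m\<close> the gain is \<open>O(k / L)\<close>
  on average. The two largest values of \<open>m\<close>, for which the locality of the ensemble may be
  exhausted, are estimated trivially.
\<close>

section \<open>The second singular value\<close>

text \<open>Expansion is given through a sorted list of roots of a characteristic polynomial, while
  mixing needs an operator bound on the complement of the stationary vector. No full spectral
  decomposition is built: one further eigenvector, found by maximising a quadratic form over a
  compact set, suffices. With the stationary vector it yields two roots counted with multiplicity,
  and \<gamma> < 1 forces the second one to be at most \<gamma>. All later estimates are kept affine
  in squared quantities (AM-GM with a free parameter \<theta> instead of square roots), so that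
  averaging over faces, conditionings and m is plain linearity. Conditioning costs locality: m faces
  use up to m k indices, and the PSD index set contains the k-sets only while at least 2k of the
  locality remains. The factor q^k, rather than a power of the alphabet size, arises because
  covariances vanish off the supports of the marginals. The choice \<theta> = \<epsilon> / (2k)
  balances the error terms and leads to the constants 256 and 1/32.\<close>

text \<open>A submultiset is assumed, not membership, because \<open>a\<close> and \<open>b\<close>
  may coincide: the Rayleigh maximum can itself be 1.\<close>

lemma second_largest_ge:
  fixes M :: "real multiset"
  assumes M: "{#a, b#} \<subseteq># M" and c: "c \<le> a" "c \<le> b"
  shows "c \<le> rev (sorted_list_of_multiset M) ! 1"
proof -
  define xs where "xs = sorted_list_of_multiset M"
  have mset_xs: "mset xs = M" and sorted: "sorted xs"
    by (simp_all add: xs_def)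
  have two: "2 \<le> length (filter (\<lambda>x. c \<le> x) xs)"
  proof -
    have "filter_mset (\<lambda>x. c \<le> x) {#a, b#} \<subseteq># filter_mset (\<lambda>x. c \<le> x) M"
      using M by (rule multiset_filter_mono)
    then have "size {#a, b#} \<le> size (filter_mset (\<lambda>x. c \<le> x) M)"
      using c by (intro size_mset_mono) simp
    also have "filter_mset (\<lambda>x. c \<le> x) M = mset (filter (\<lambda>x. c \<le> x) xs)"
      by (simp add: mset_xs)
    finally show ?thesis
      by (metis size_mset size_add_mset size_empty numeral_2_eq_2)
  qed
  define n where "n = length xs"
  have n: "2 \<le> n"
    using two length_filter_le[of _ xs] unfolding n_def by (meson le_trans)
  have "c \<le> xs ! (n - 2)"
  proof (rule ccontr)
    assume less: "\<not> c \<le> xs ! (n - 2)"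
    have none: "\<not> c \<le> x" if x: "x \<in> set (take (n - 1) xs)" for x
    proof -
      obtain i where i: "i < n - 1" "x = xs ! i"
        using x by (auto simp: in_set_conv_nth n_def)
      have "xs ! i \<le> xs ! (n - 2)"
        using sorted i n by (intro sorted_nth_mono) (auto simp: n_def)
      then show ?thesis using i less by simp
    qed
    have "xs = take (n - 1) xs @ drop (n - 1) xs" by simp
    then have "filter (\<lambda>x. c \<le> x) xs = filter (\<lambda>x. c \<le> x) (take (n - 1) xs) @ filter (\<lambda>x. c \<le> x) (drop (n - 1) xs)"
      by (metis filter_append)
    also have "filter (\<lambda>x. c \<le> x) (take (n - 1) xs) = []"
      using none by (simp add: filter_empty_conv)
    finally have "length (filter (\<lambda>x. c \<le> x) xs) \<le> length (drop (n - 1) xs)"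
      by (metis append_Nil length_filter_le)
    then show False using two n by (simp add: n_def)
  qed
  then show ?thesis
    using n by (simp add: rev_nth xs_def[symmetric] n_def numeral_2_eq_2)
qed

section \<open>Two eigenvalues of a symmetric matrix and the contraction they give\<close>

text \<open>The unit sphere in the complement of \<open>v\<close> is compact, so the form attains
  its maximum there, at \<open>w\<close>. The residual x = \<mu> w - M w is again orthogonal to
  \<open>v\<close>, because \<open>v\<close> is an eigenvector of the symmetric \<open>M\<close>; it
  is therefore an admissible direction, and the first variation along it, 2 |x|^2, must vanish. The
  vector \<open>z\<close> witnesses that the complement is nonzero.\<close>

lemma rayleigh_maximizer:
  fixes M :: "nat \<Rightarrow> nat \<Rightarrow> real" and v :: "nat \<Rightarrow> real"
  assumes fin: "finite I"
    and sym: "\<And>i j. i \<in> I \<Longrightarrow> j \<in> I \<Longrightarrow> M i j = M j i"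
    and v: "\<And>i. i \<in> I \<Longrightarrow> (\<Sum>j\<in>I. M i j * v j) = \<kappa> * v i"
    and z: "(\<Sum>i\<in>I. z i * v i) = 0" "i0 \<in> I" "z i0 \<noteq> 0"
  obtains w \<mu> where
    "(\<Sum>i\<in>I. w i * v i) = 0" "(\<Sum>i\<in>I. (w i)\<^sup>2) = 1"
    "\<And>i. i \<in> I \<Longrightarrow> (\<Sum>j\<in>I. M i j * w j) = \<mu> * w i"
    "\<And>u. (\<Sum>i\<in>I. u i * v i) = 0 \<Longrightarrow>
       (\<Sum>i\<in>I. \<Sum>j\<in>I. u i * M i j * u j) \<le> \<mu> * (\<Sum>i\<in>I. (u i)\<^sup>2)"
proof -
  \<comment> \<open>Coordinates outside \<open>I\<close> are pinned to 0, so compactness in the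
    function space follows from Tychonoff's theorem.\<close>
  define B :: "(nat \<Rightarrow> real) set" where
    "B = PiE UNIV (\<lambda>i. if i \<in> I then {-1..1} else {0})"
  define K where "K = B \<inter> ({u. (\<Sum>i\<in>I. (u i)\<^sup>2) = 1} \<inter> {u. (\<Sum>i\<in>I. u i * v i) = 0})"
  define Q where "Q u = (\<Sum>i\<in>I. \<Sum>j\<in>I. u i * M i j * u j)" for u :: "nat \<Rightarrow> real"
  define R where "R u = (\<Sum>i\<in>I. (u i)\<^sup>2)" for u :: "nat \<Rightarrow> real"
  have "compactin (product_topology (\<lambda>_. euclidean) UNIV) B"
    unfolding B_def by (subst compactin_PiE) (auto simp: compactin_euclidean_iff)
  then have "compact B"
    by (simp add: euclidean_product_topology compactin_euclidean_iff)
  moreover have "closed {u :: nat \<Rightarrow> real. (\<Sum>i\<in>I. (u i)\<^sup>2) = 1}"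
    by (intro closed_Collect_eq continuous_intros continuous_on_product_coordinates)
  moreover have "closed {u :: nat \<Rightarrow> real. (\<Sum>i\<in>I. u i * v i) = 0}"
    by (intro closed_Collect_eq continuous_intros continuous_on_product_coordinates)
  ultimately have compact: "compact K"
    unfolding K_def by (intro compact_Int_closed closed_Int)
  have normalise: "(\<lambda>i. if i \<in> I then u i / sqrt (R u) else 0) \<in> K"
    if u: "(\<Sum>i\<in>I. u i * v i) = 0" and R: "R u > 0" for u
  proof -
    have le: "(u i)\<^sup>2 \<le> R u" if "i \<in> I" for i
      unfolding R_def using that fin by (intro member_le_sum) auto
    have "u i / sqrt (R u) \<in> {-1..1}" if i: "i \<in> I" for i
    proof -
      have "\<bar>u i\<bar> \<le> sqrt (R u)"
        using real_sqrt_le_mono[OF le[OF i]] by simp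
      then have "\<bar>u i / sqrt (R u)\<bar> \<le> 1"
        using R by (simp add: abs_divide)
      then show ?thesis unfolding abs_le_iff atLeastAtMost_iff by linarith
    qed
    then have "(\<lambda>i. if i \<in> I then u i / sqrt (R u) else 0) \<in> B"
      unfolding B_def PiE_UNIV_domain by (auto simp: Pi_iff)
    moreover have "(\<Sum>i\<in>I. (u i / sqrt (R u))\<^sup>2) = 1"
      using R by (simp add: power_divide sum_divide_distrib[symmetric] R_def)
    moreover have "(\<Sum>i\<in>I. u i / sqrt (R u) * v i) = 0"
      using u by (simp add: sum_divide_distrib[symmetric])
    ultimately show ?thesis by (simp add: K_def)
  qed
  have "R z > 0"
    unfolding R_def using fin z by (intro sum_pos2[of _ i0]) auto
  then have nonempty: "K \<noteq> {}" using normalise z by blast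
  have "continuous_on K Q"
    unfolding Q_def by (intro continuous_intros) (auto intro: continuous_on_subset[OF continuous_on_product_coordinates])
  then obtain w where w: "w \<in> K" and max: "\<And>u. u \<in> K \<Longrightarrow> Q u \<le> Q w"
    using continuous_attains_sup[OF compact nonempty] by blast
  define \<mu> where "\<mu> = Q w"
  have wv: "(\<Sum>i\<in>I. w i * v i) = 0" and wR: "R w = 1"
    using w by (auto simp: K_def R_def)
  have le: "Q u \<le> \<mu> * R u" if u: "(\<Sum>i\<in>I. u i * v i) = 0" for u
  proof (cases "R u > 0")
    case True
    have "Q (\<lambda>i. if i \<in> I then u i / sqrt (R u) else 0) = (\<Sum>i\<in>I. \<Sum>j\<in>I. (u i * M i j * u j) / R u)"
      unfolding Q_def using True by (intro sum.cong refl) (simp add: field_simps)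
    also have "\<dots> = Q u / R u"
      by (simp add: Q_def sum_divide_distrib)
    finally have "Q u / R u \<le> \<mu>"
      using max[OF normalise[OF u True]] by (simp add: \<mu>_def)
    then show ?thesis using True by (simp add: field_simps)
  next
    case False
    have "R u \<ge> 0" unfolding R_def by (simp add: sum_nonneg)
    with False have "R u = 0" by simp
    then have "u i = 0" if "i \<in> I" for i
      using that fin unfolding R_def by (subst (asm) sum_nonneg_eq_0_iff) auto
    then show ?thesis using \<open>R u = 0\<close> by (simp add: Q_def)
  qed
  define x where "x i = \<mu> * w i - (\<Sum>j\<in>I. M i j * w j)" for i
  define ip where "ip f g = (\<Sum>i\<in>I. f i * g i :: real)" for f g :: "nat \<Rightarrow> real"
  have ipQ: "Q u = ip u (\<lambda>i. \<Sum>j\<in>I. M i j * u j)" for u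
    by (simp add: Q_def ip_def sum_distrib_left mult.assoc)
  have ip_sym: "ip f (\<lambda>i. \<Sum>j\<in>I. M i j * g j) = ip g (\<lambda>i. \<Sum>j\<in>I. M i j * f j)" for f g
  proof -
    have "ip f (\<lambda>i. \<Sum>j\<in>I. M i j * g j) = (\<Sum>j\<in>I. \<Sum>i\<in>I. f i * (M i j * g j))"
      unfolding ip_def sum_distrib_left by (rule sum.swap)
    also have "\<dots> = ip g (\<lambda>i. \<Sum>j\<in>I. M i j * f j)"
      unfolding ip_def sum_distrib_left by (intro sum.cong refl) (simp add: sym algebra_simps)
    finally show ?thesis .
  qed
  have xv: "ip x v = 0"
  proof -
    have "ip x v = \<mu> * ip w v - ip v (\<lambda>i. \<Sum>j\<in>I. M i j * w j)"
    proof -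
      have "ip x v = (\<Sum>i\<in>I. \<mu> * (w i * v i) - v i * (\<Sum>j\<in>I. M i j * w j))"
        unfolding ip_def by (intro sum.cong refl) (simp add: x_def algebra_simps)
      then show ?thesis by (simp add: ip_def sum_subtractf sum_distrib_left)
    qed
    also have "ip v (\<lambda>i. \<Sum>j\<in>I. M i j * w j) = ip w (\<lambda>i. \<kappa> * v i)"
      unfolding ip_sym[of v w] by (simp add: ip_def v)
    also have "\<dots> = \<kappa> * ip w v" by (simp add: ip_def sum_distrib_left algebra_simps)
    finally show ?thesis using wv by (simp add: ip_def)
  qed
  have xx: "ip x x = \<mu> * ip w x - ip x (\<lambda>i. \<Sum>j\<in>I. M i j * w j)"
  proof -
    have "ip x x = (\<Sum>i\<in>I. \<mu> * (w i * x i) - x i * (\<Sum>j\<in>I. M i j * w j))"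
      unfolding ip_def by (intro sum.cong refl) (simp add: x_def algebra_simps)
    then show ?thesis by (simp add: ip_def sum_subtractf sum_distrib_left)
  qed
  \<comment> \<open>Maximality of \<open>w\<close>, tested on w + t x; by \<open>xx\<close> the
    linear coefficient is 2 |x|^2.\<close>
  have quad: "0 \<le> 2 * t * ip x x + t\<^sup>2 * (\<mu> * R x - Q x)" for t
  proof -
    define u where "u i = w i + t * x i" for i
    have "ip u v = 0"
      using wv xv by (simp add: ip_def u_def distrib_right sum.distrib sum_distrib_left[symmetric] mult.assoc)
    then have "Q u \<le> \<mu> * R u" by (intro le) (simp add: ip_def)
    moreover have "R u = 1 + 2 * t * ip w x + t\<^sup>2 * R x"
    proof -
      have "R u = (\<Sum>i\<in>I. (w i)\<^sup>2 + 2 * t * (w i * x i) + t\<^sup>2 * (x i)\<^sup>2)"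
        unfolding R_def u_def by (intro sum.cong refl) (simp add: power2_eq_square algebra_simps)
      also have "\<dots> = R w + 2 * t * ip w x + t\<^sup>2 * R x"
        by (simp add: R_def ip_def sum.distrib sum_distrib_left)
      finally show ?thesis by (simp add: wR)
    qed
    moreover have "Q u = \<mu> + 2 * t * ip x (\<lambda>i. \<Sum>j\<in>I. M i j * w j) + t\<^sup>2 * Q x"
    proof -
      have "Q u = (\<Sum>i\<in>I. \<Sum>j\<in>I. w i * M i j * w j + t * (w i * M i j * x j) + t * (x i * M i j * w j) + t\<^sup>2 * (x i * M i j * x j))"
        unfolding Q_def u_def by (intro sum.cong refl) (simp add: power2_eq_square algebra_simps)
      also have "\<dots> = Q w + t * ip w (\<lambda>i. \<Sum>j\<in>I. M i j * x j) + t * ip x (\<lambda>i. \<Sum>j\<in>I. M i j * w j) + t\<^sup>2 * Q x"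
        by (simp add: Q_def ip_def sum.distrib sum_distrib_left mult.assoc)
      also have "ip w (\<lambda>i. \<Sum>j\<in>I. M i j * x j) = ip x (\<lambda>i. \<Sum>j\<in>I. M i j * w j)" by (rule ip_sym)
      finally show ?thesis by (simp add: \<mu>_def)
    qed
    ultimately show ?thesis unfolding xx by (simp add: algebra_simps)
  qed
  have "ip x x = 0"
  proof (rule ccontr)
    assume "ip x x \<noteq> 0"
    moreover have "ip x x \<ge> 0" unfolding ip_def by (simp add: sum_nonneg)
    ultimately have pos: "ip x x > 0" by simp
    \<comment> \<open>A positive bound for the quadratic coefficient: at t = - |x|^2 / c the right
      side of \<open>quad\<close> is at most - |x|^4 / c < 0.\<close>
    define c where "c = \<bar>\<mu> * R x - Q x\<bar> + 1"
    have c: "c > 0" "\<mu> * R x - Q x \<le> c" by (auto simp: c_def)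
    have "0 \<le> 2 * (- ip x x / c) * ip x x + (- ip x x / c)\<^sup>2 * (\<mu> * R x - Q x)"
      by (rule quad)
    also have "\<dots> \<le> 2 * (- ip x x / c) * ip x x + (- ip x x / c)\<^sup>2 * c"
      using c by (intro add_left_mono mult_left_mono) auto
    also have "\<dots> = - (ip x x)\<^sup>2 / c"
      using c by (simp add: field_simps power2_eq_square)
    finally show False using pos c by (simp add: field_simps)
  qed
  then have "x i = 0" if "i \<in> I" for i
    using that fin unfolding ip_def by (subst (asm) sum_nonneg_eq_0_iff) auto
  then have "(\<Sum>j\<in>I. M i j * w j) = \<mu> * w i" if "i \<in> I" for i
    using that by (simp add: x_def)
  then show ?thesis
    using that[of w \<mu>] wv wR le by (simp add: R_def Q_def)
qed


text \<open>Let P be the identity with columns \<open>i0\<close>, \<open>i1\<close> replaced by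
  \<open>v\<close>, \<open>w\<close>. The eigenvector equations say that (X I - B) P = N D, with D
  diagonal and carrying X - \<kappa> and X - \<mu> in those two places. Determinants give the
  divisibility, as det P is a nonzero constant. Multiplicity is captured even when \<kappa> =
  \<mu>.\<close>

lemma char_poly_dvd_two_eigenvalues:
  fixes B :: "real mat" and v w :: "nat \<Rightarrow> real"
  assumes B: "B \<in> carrier_mat n n"
    and v: "\<And>i. i < n \<Longrightarrow> (\<Sum>j<n. B $$ (i, j) * v j) = \<kappa> * v i"
    and w: "\<And>i. i < n \<Longrightarrow> (\<Sum>j<n. B $$ (i, j) * w j) = \<mu> * w i"
    and i0: "i0 < n" and i1: "i1 < n" and minor: "v i0 * w i1 - v i1 * w i0 \<noteq> 0"
  shows "[:-\<kappa>, 1:] * [:-\<mu>, 1:] dvd char_poly B"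
proof -
  have ne: "i0 \<noteq> i1" using minor by (auto simp: mult.commute)
  define P :: "real mat" where
    "P = Matrix.mat n n (\<lambda>(i, j). if j = i0 then v i else if j = i1 then w i else of_bool (i = j))"
  define M where "M = char_poly_matrix B"
  define N :: "real poly mat" where
    "N = Matrix.mat n n (\<lambda>(i, j). if j = i0 then [:v i:] else if j = i1 then [:w i:] else M $$ (i, j))"
  define D :: "real poly mat" where
    "D = Matrix.mat n n (\<lambda>(i, j). if i = j then (if j = i0 then [:-\<kappa>, 1:] else if j = i1 then [:-\<mu>, 1:] else 1) else 0)"
  have carr: "P \<in> carrier_mat n n" "M \<in> carrier_mat n n" "N \<in> carrier_mat n n" "D \<in> carrier_mat n n"
    using B by (auto simp: P_def M_def N_def D_def char_poly_matrix_def)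
  have dims: "dim_row B = n" "dim_col B = n" using B by auto
  have M: "M $$ (i, j) = (if i = j then [:0, 1:] else 0) - [:B $$ (i, j):]" if "i < n" "j < n" for i j
    using that dims by (simp add: M_def char_poly_matrix_def)
  have eigen: "(\<Sum>j<n. M $$ (i, j) * [:f j:]) = [:f i:] * [:-\<nu>, 1:]"
    if f: "\<And>i. i < n \<Longrightarrow> (\<Sum>j<n. B $$ (i, j) * f j) = \<nu> * f i" and i: "i < n" for f \<nu> i
  proof -
    have "(\<Sum>j<n. M $$ (i, j) * [:f j:]) = (\<Sum>j<n. (if i = j then [:0, 1:] * [:f j:] else 0) - [:B $$ (i, j) * f j:])"
      using i by (intro sum.cong refl) (simp add: M)
    also have "\<dots> = [:0, 1:] * [:f i:] - (\<Sum>j<n. [:B $$ (i, j) * f j:])"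
      using i by (simp add: sum_subtractf)
    also have "(\<Sum>j<n. [:B $$ (i, j) * f j:]) = [:\<Sum>j<n. B $$ (i, j) * f j:]"
      by (induction n) auto
    finally show ?thesis using f[OF i] by simp
  qed
  have prod: "M * map_mat (\<lambda>a. [:a:]) P = N * D"
  proof (rule eq_matI)
    fix i j assume "i < dim_row (N * D)" "j < dim_col (N * D)"
    then have ij: "i < n" "j < n" using carr by auto
    have L: "(M * map_mat (\<lambda>a. [:a:]) P) $$ (i, j) = (\<Sum>l<n. M $$ (i, l) * [:P $$ (l, j):])"
      using ij carr by (auto simp: times_mat_def scalar_prod_def lessThan_atLeast0 intro!: sum.cong)
    have "(N * D) $$ (i, j) = (\<Sum>l<n. N $$ (i, l) * D $$ (l, j))"
      using ij carr by (auto simp: times_mat_def scalar_prod_def lessThan_atLeast0 intro!: sum.cong)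
    also have "\<dots> = (\<Sum>l<n. if l = j then N $$ (i, j) * D $$ (j, j) else 0)"
      using ij by (intro sum.cong refl) (simp add: D_def)
    also have "\<dots> = N $$ (i, j) * D $$ (j, j)" using ij by simp
    finally have R: "(N * D) $$ (i, j) = N $$ (i, j) * D $$ (j, j)" .
    consider "j = i0" | "j = i1" | "j \<noteq> i0" "j \<noteq> i1" by blast
    then show "(M * map_mat (\<lambda>a. [:a:]) P) $$ (i, j) = (N * D) $$ (i, j)"
    proof cases
      case 1
      have "(\<Sum>l<n. M $$ (i, l) * [:P $$ (l, j):]) = (\<Sum>l<n. M $$ (i, l) * [:v l:])"
        using 1 i0 by (intro sum.cong refl) (simp add: P_def)
      then show ?thesis unfolding L R using 1 ij eigen[of v \<kappa> i, OF v ij(1)] by (simp add: N_def D_def)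
    next
      case 2
      have "(\<Sum>l<n. M $$ (i, l) * [:P $$ (l, j):]) = (\<Sum>l<n. M $$ (i, l) * [:w l:])"
        using 2 i1 ne by (intro sum.cong refl) (simp add: P_def)
      then show ?thesis unfolding L R using 2 ij ne eigen[of w \<mu> i, OF w ij(1)] by (simp add: N_def D_def)
    next
      case 3
      have "(\<Sum>l<n. M $$ (i, l) * [:P $$ (l, j):]) = (\<Sum>l<n. if l = j then M $$ (i, j) else 0)"
        using 3 ij by (intro sum.cong refl) (simp add: P_def flip: one_pCons)
      then show ?thesis unfolding L R using 3 ij by (simp add: N_def D_def)
    qed
  qed (use carr in auto)
  \<comment> \<open>Rows \<open>i0\<close> and \<open>i1\<close> of P x = 0 form a 2x2 system whose
    determinant is the given minor. Once these two entries of x vanish, every other row says that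
    its own entry is 0.\<close>
  have "Determinant.det P \<noteq> 0"
  proof
    assume "Determinant.det P = 0"
    then obtain x where x: "x \<in> carrier_vec n" "x \<noteq> 0\<^sub>v n" "P *\<^sub>v x = 0\<^sub>v n"
      using det_0_iff_vec_prod_zero[OF carr(1)] by auto
    have row: "(\<Sum>j<n. P $$ (i, j) * x $ j) = 0" if i: "i < n" for i
    proof -
      have "(P *\<^sub>v x) $ i = (\<Sum>j<n. P $$ (i, j) * x $ j)"
        using i x(1) carr(1) by (auto simp: mult_mat_vec_def scalar_prod_def lessThan_atLeast0 intro!: sum.cong)
      then show ?thesis using x(3) i by simp
    qed
    have row': "v i * x $ i0 + w i * x $ i1 + (if i = i0 \<or> i = i1 then 0 else x $ i) = 0" if i: "i < n" for i
    proof -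
      have "(\<Sum>j<n. P $$ (i, j) * x $ j) =
          (\<Sum>j<n. (if j = i0 then v i * x $ i0 else 0) + (if j = i1 then w i * x $ i1 else 0) +
             (if j = i then if i = i0 \<or> i = i1 then 0 else x $ i else 0))"
        using i ne by (intro sum.cong refl) (auto simp: P_def)
      then show ?thesis
        using row[OF i] i i0 i1 by (simp add: sum.distrib)
    qed
    have e0: "v i0 * x $ i0 + w i0 * x $ i1 = 0" and e1: "v i1 * x $ i0 + w i1 * x $ i1 = 0"
      using row'[OF i0] row'[OF i1] by auto
    have "(v i0 * w i1 - v i1 * w i0) * x $ i0 = w i1 * (v i0 * x $ i0 + w i0 * x $ i1) - w i0 * (v i1 * x $ i0 + w i1 * x $ i1)"
      by (simp add: algebra_simps)
    then have x0: "x $ i0 = 0" using minor e0 e1 by simp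
    have "(v i0 * w i1 - v i1 * w i0) * x $ i1 = v i0 * (v i1 * x $ i0 + w i1 * x $ i1) - v i1 * (v i0 * x $ i0 + w i0 * x $ i1)"
      by (simp add: algebra_simps)
    then have x1: "x $ i1 = 0" using minor e0 e1 by simp
    have "x $ i = 0" if "i < n" for i
      using row'[OF that] x0 x1 by (auto split: if_splits)
    then have "x = 0\<^sub>v n" using x(1) by (intro eq_vecI) auto
    then show False using x(2) by simp
  qed
  moreover have "Determinant.det (map_mat (\<lambda>a. [:a:]) P) = [:Determinant.det P:]"
  proof -
    interpret comm_ring_hom "\<lambda>a :: real. [:a:]"
      by unfold_locales (auto simp: one_pCons)
    show ?thesis by (rule hom_det)
  qed
  moreover have "Determinant.det M * Determinant.det (map_mat (\<lambda>a. [:a:]) P) = Determinant.det N * Determinant.det D"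
    using carr prod by (metis det_mult map_carrier_mat)
  moreover have "[:-\<kappa>, 1:] * [:-\<mu>, 1:] dvd Determinant.det D"
  proof -
    have "upper_triangular D" using carr by (auto simp: D_def upper_triangular_def)
    then have "Determinant.det D = prod_list (diag_mat D)"
      using carr by (intro det_upper_triangular)
    also have "\<dots> = (\<Prod>i<n. D $$ (i, i))"
      using carr by (simp add: prod_list_diag_prod lessThan_atLeast0)
    also have "{..<n} = insert i0 (insert i1 ({..<n} - {i0, i1}))" using i0 i1 by auto
    also have "(\<Prod>i\<in>\<dots>. D $$ (i, i)) = D $$ (i0, i0) * (D $$ (i1, i1) * (\<Prod>i\<in>{..<n} - {i0, i1}. D $$ (i, i)))"
      using ne by simp
    also have "D $$ (i0, i0) = [:-\<kappa>, 1:]" using i0 by (simp add: D_def)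
    also have "D $$ (i1, i1) = [:-\<mu>, 1:]" using i1 ne by (simp add: D_def)
    finally show ?thesis unfolding mult.assoc[symmetric] by (metis dvd_triv_left)
  qed
  ultimately have "[:-\<kappa>, 1:] * [:-\<mu>, 1:] dvd Determinant.det M * [:Determinant.det P:]"
    by simp
  then have "[:-\<kappa>, 1:] * [:-\<mu>, 1:] dvd Polynomial.smult (Determinant.det P) (Determinant.det M)"
    by (simp add: mult.commute)
  then show ?thesis
    using \<open>Determinant.det P \<noteq> 0\<close> by (simp add: dvd_smult_iff char_poly_def M_def del: mult_pCons_left mult_pCons_right)
qed

text \<open>The matrix A^T A fixes \<open>v\<close>, and the maximum \<mu> of its form on the
  complement of \<open>v\<close> is a further root of its characteristic polynomial. Hence min(1,
  sqrt \<mu>) is at most the second singular value, and \<gamma> < 1 excludes that this minimum is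
  1, which leaves \<mu> \<le> \<gamma>^2.\<close>

lemma second_singular_value_bound:
  fixes A :: "real mat" and v u :: "nat \<Rightarrow> real"
  assumes A: "A \<in> carrier_mat n n"
    and sym: "\<And>i j. i < n \<Longrightarrow> j < n \<Longrightarrow> A $$ (i, j) = A $$ (j, i)"
    and v: "\<And>i. i < n \<Longrightarrow> (\<Sum>j<n. A $$ (i, j) * v j) = v i"
    and i0: "i0 < n" "v i0 \<noteq> 0"
    and sv: "second_singular_value A \<le> \<gamma>" and \<gamma>: "\<gamma> < 1"
    and u: "(\<Sum>i<n. u i * v i) = 0"
  shows "(\<Sum>i<n. (\<Sum>j<n. A $$ (i, j) * u j)\<^sup>2) \<le> \<gamma>\<^sup>2 * (\<Sum>i<n. (u i)\<^sup>2)"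
proof (cases "\<exists>i<n. u i \<noteq> 0")
  case False
  then show ?thesis by simp
next
  case True
  then obtain k where k: "k \<in> {..<n}" "u k \<noteq> 0" by auto
  define B where "B = transpose_mat A * A"
  define M where "M i j = (\<Sum>l<n. A $$ (l, i) * A $$ (l, j))" for i j
  have B: "B \<in> carrier_mat n n" using A by (simp add: B_def)
  have BM: "B $$ (i, j) = M i j" if "i < n" "j < n" for i j
    using that A by (auto simp: B_def M_def scalar_prod_def lessThan_atLeast0 intro!: sum.cong)
  have B_app: "(\<Sum>j<n. M i j * x j) = (\<Sum>l<n. A $$ (i, l) * (\<Sum>j<n. A $$ (l, j) * x j))" if "i < n" for x i
  proof -
    have "(\<Sum>j<n. M i j * x j) = (\<Sum>j<n. \<Sum>l<n. A $$ (i, l) * (A $$ (l, j) * x j))"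
      unfolding M_def sum_distrib_right using that by (intro sum.cong refl) (simp add: sym)
    also have "\<dots> = (\<Sum>l<n. A $$ (i, l) * (\<Sum>j<n. A $$ (l, j) * x j))"
      unfolding sum_distrib_left by (rule sum.swap)
    finally show ?thesis .
  qed
  have Mv: "(\<Sum>j<n. M i j * v j) = 1 * v i" if "i < n" for i
    unfolding B_app[OF that] using v that by simp
  have quad: "(\<Sum>i<n. \<Sum>j<n. x i * M i j * x j) = (\<Sum>i<n. (\<Sum>j<n. A $$ (i, j) * x j)\<^sup>2)" for x
  proof -
    have "(\<Sum>i<n. \<Sum>j<n. x i * M i j * x j) = (\<Sum>i<n. \<Sum>j<n. \<Sum>l<n. (A $$ (l, i) * x i) * (A $$ (l, j) * x j))"
      unfolding M_def sum_distrib_left sum_distrib_right by (simp add: mult_ac)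
    also have "\<dots> = (\<Sum>i<n. \<Sum>l<n. \<Sum>j<n. (A $$ (l, i) * x i) * (A $$ (l, j) * x j))"
      by (intro sum.cong refl sum.swap)
    also have "\<dots> = (\<Sum>l<n. \<Sum>i<n. \<Sum>j<n. (A $$ (l, i) * x i) * (A $$ (l, j) * x j))"
      by (rule sum.swap)
    finally show ?thesis by (simp add: power2_eq_square sum_product)
  qed
  obtain w \<mu> where w: "(\<Sum>i<n. w i * v i) = 0" "(\<Sum>i<n. (w i)\<^sup>2) = 1"
      "\<And>i. i < n \<Longrightarrow> (\<Sum>j<n. M i j * w j) = \<mu> * w i"
    and max: "\<And>u. (\<Sum>i<n. u i * v i) = 0 \<Longrightarrow>
       (\<Sum>i<n. \<Sum>j<n. u i * M i j * u j) \<le> \<mu> * (\<Sum>i<n. (u i)\<^sup>2)"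
    using rayleigh_maximizer[of "{..<n}" M v 1 u k] Mv u k
    by (auto simp: M_def mult.commute)
  have "\<mu> = \<mu> * (\<Sum>i<n. (w i)\<^sup>2)" by (simp add: w)
  also have "\<dots> = (\<Sum>i<n. w i * (\<mu> * w i))"
    by (simp add: sum_distrib_left power2_eq_square mult_ac)
  also have "\<dots> = (\<Sum>i<n. \<Sum>j<n. w i * M i j * w j)"
    by (simp add: w(3)[symmetric] sum_distrib_left mult.assoc)
  finally have \<mu>_nonneg: "0 \<le> \<mu>" unfolding quad by (simp add: sum_nonneg)
  \<comment> \<open>Nonzero orthogonal vectors are independent: if all minors vanished,
    \<open>(v i0)\<^sup>2\<close> |w|^2 would be a multiple of the inner product of \<open>w\<close>
    and \<open>v\<close>, which is 0.\<close>
  have "\<exists>i<n. \<exists>j<n. v i * w j - v j * w i \<noteq> 0"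
  proof (rule ccontr)
    assume *: "\<not> ?thesis"
    then have eq: "v i * w j = v j * w i" if "i < n" "j < n" for i j using that by auto
    have "(v i0)\<^sup>2 * (\<Sum>j<n. (w j)\<^sup>2) = (\<Sum>j<n. v i0 * w j * (v i0 * w j))"
      by (simp add: sum_distrib_left power2_eq_square mult_ac)
    also have "\<dots> = (\<Sum>j<n. v j * w i0 * (v i0 * w j))"
      using i0 by (intro sum.cong refl) (simp add: eq[of i0])
    also have "\<dots> = v i0 * w i0 * (\<Sum>j<n. w j * v j)"
      by (simp add: sum_distrib_left mult_ac)
    finally show False using w(1,2) i0 by simp
  qed
  then obtain i j where "i < n" "j < n" "v i * w j - v j * w i \<noteq> 0" by auto
  then have dvd: "[:-1, 1:] * [:-\<mu>, 1:] dvd char_poly B"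
  proof (intro char_poly_dvd_two_eigenvalues[OF B])
    show "(\<Sum>j<n. B $$ (i, j) * v j) = 1 * v i" if "i < n" for i
      unfolding Mv[OF that, symmetric] using that by (intro sum.cong refl) (simp add: BM)
    show "(\<Sum>j<n. B $$ (i, j) * w j) = \<mu> * w i" if "i < n" for i
      unfolding w(3)[OF that, symmetric] using that by (intro sum.cong refl) (simp add: BM)
  qed
  have "char_poly B \<noteq> 0" using degree_monic_char_poly[OF B] by auto
  then have "proots ([:-1, 1:] * [:-\<mu>, 1:]) \<subseteq># proots (char_poly B)"
    using dvd by (metis dvdE proots_mult mset_subset_eq_add_left mult_eq_0_iff)
  then have "{#1, \<mu>#} \<subseteq># proots (char_poly B)"
    by (subst (asm) proots_mult) (auto simp: proots_linear_factor add_mset_commute simp del: mult_pCons_left mult_pCons_right)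
  then have "{#1, sqrt \<mu>#} \<subseteq># image_mset sqrt (proots (char_poly B))"
    by (auto dest: image_mset_subseteq_mono[of _ _ sqrt])
  then have "min 1 (sqrt \<mu>) \<le> second_singular_value A"
    unfolding second_singular_value_def singular_values_def B_def
    by (rule second_largest_ge) auto
  then have "sqrt \<mu> \<le> \<gamma>" using sv \<gamma> by linarith
  then have "\<mu> \<le> \<gamma>\<^sup>2" using \<mu>_nonneg by (meson real_sqrt_le_iff sqrt_le_D)
  then show ?thesis
    using max[OF u] unfolding quad by (meson mult_right_mono order_trans sum_nonneg zero_le_power2)
qed

section \<open>Faces and weighted links\<close>

text \<open>All j-subsets of the ground set, faces or not: non-faces get weight zero later, so sums
  can be reindexed without membership conditions.\<close>

definition level :: "nat \<Rightarrow> nat \<Rightarrow> nat set set" where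
  "level n j = {s. s \<subseteq> {1..n} \<and> card s = j}"

lemma finite_level [simp]: "finite (level n j)"
  by (rule finite_subset[of _ "Pow {1..n}"]) (auto simp: level_def)

lemma level_finite: "s \<in> level n j \<Longrightarrow> finite s"
  by (auto simp: level_def intro: finite_subset)

lemma level_0 [simp]: "level n 0 = {{}}"
  by (auto simp: level_def dest: finite_subset[OF _ finite_atLeastAtMost])

lemma level_1: "level n (Suc 0) = (\<lambda>x. {x}) ` {1..n}"
  by (auto simp: level_def card_1_singleton_iff)

lemma insert_in_level: "s \<in> level n j \<Longrightarrow> x \<in> {1..n} - s \<Longrightarrow> insert x s \<in> level n (Suc j)"
  using level_finite[of s n j] by (auto simp: level_def)

text \<open>Double counting: a (j+1)-set with a marked element is the same as a j-set with an
  element outside it.\<close>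

lemma level_swap:
  fixes \<phi> :: "nat set \<Rightarrow> nat \<Rightarrow> 'a :: comm_monoid_add"
  shows "(\<Sum>t\<in>level n (Suc j). \<Sum>x\<in>t. \<phi> (t - {x}) x) = (\<Sum>s\<in>level n j. \<Sum>x\<in>{1..n} - s. \<phi> s x)"
proof -
  have fin: "\<forall>t\<in>level n (Suc j). finite t" by (auto dest: level_finite)
  have "(\<Sum>t\<in>level n (Suc j). \<Sum>x\<in>t. \<phi> (t - {x}) x) = (\<Sum>(t, x)\<in>Sigma (level n (Suc j)) (\<lambda>t. t). \<phi> (t - {x}) x)"
    by (rule sum.Sigma) (use fin in auto)
  also have "\<dots> = (\<Sum>(s, x)\<in>Sigma (level n j) (\<lambda>s. {1..n} - s). \<phi> s x)"
    by (rule sum.reindex_bij_witness[where i = "\<lambda>(s, x). (insert x s, x)" and j = "\<lambda>(t, x). (t - {x}, x)"])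
      (auto simp: level_def insert_absorb card_insert_if finite_subset[OF _ finite_atLeastAtMost])
  also have "\<dots> = (\<Sum>s\<in>level n j. \<Sum>x\<in>{1..n} - s. \<phi> s x)"
    by (rule sum.Sigma[symmetric]) auto
  finally show ?thesis .
qed

lemma pmf_bind_finite:
  assumes "finite A" "set_pmf Q \<subseteq> A"
  shows "pmf (bind_pmf Q f) y = (\<Sum>x\<in>A. pmf Q x * pmf (f x) y)"
  unfolding pmf_bind using assms by (subst integral_measure_pmf[of A]) (auto simp: set_pmf_iff mult.commute)

lemma facets_eq:
  assumes "finite t" "card t = Suc j"
  shows "{s. s \<subseteq> t \<and> card s = card t - 1} = (\<lambda>x. t - {x}) ` t"
proof (intro equalityI subsetI)
  fix s assume "s \<in> {s. s \<subseteq> t \<and> card s = card t - 1}"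
  then have s: "s \<subseteq> t" "card s = j" using assms by auto
  then have "card (t - s) = 1" using assms by (subst card_Diff_subset) (auto intro: finite_subset)
  then obtain x where "t - s = {x}" by (auto simp: card_1_singleton_iff)
  then have "x \<in> t" "s = t - {x}" using s by auto
  then show "s \<in> (\<lambda>x. t - {x}) ` t" by auto
qed (use assms in auto)

lemma set_pmf_random_facet:
  assumes "set_pmf Q \<subseteq> level n (Suc j)"
  shows "set_pmf (random_facet Q) \<subseteq> {s \<in> level n j. \<exists>t\<in>set_pmf Q. s \<subseteq> t}"
proof
  fix s assume "s \<in> set_pmf (random_facet Q)"
  then obtain t where t: "t \<in> set_pmf Q" "s \<in> set_pmf (pmf_of_set {s. s \<subseteq> t \<and> card s = card t - 1})"
    by (auto simp: random_facet_def)
  have tl: "t \<in> level n (Suc j)" using t assms by auto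
  then have fin: "finite t" "card t = Suc j" using level_finite[OF tl] by (auto simp: level_def)
  have ne: "t \<noteq> {}" using fin by auto
  from t(2) have "s \<in> (\<lambda>x. t - {x}) ` t"
    unfolding facets_eq[OF fin] using fin ne by (subst (asm) set_pmf_of_set) auto
  then show "s \<in> {s \<in> level n j. \<exists>t\<in>set_pmf Q. s \<subseteq> t}"
    using tl t(1) fin by (auto simp: level_def)
qed

text \<open>Each (j+1)-set hands the fraction 1/(j+1) of its mass to each of its facets.\<close>

lemma random_facet_pmf:
  assumes Q: "set_pmf Q \<subseteq> level n (Suc j)" and s: "s \<in> level n j"
  shows "real (Suc j) * pmf (random_facet Q) s = (\<Sum>x\<in>{1..n} - s. pmf Q (insert x s))"
proof -
  have facet: "pmf (pmf_of_set {s. s \<subseteq> t \<and> card s = card t - 1}) s = (\<Sum>x\<in>t. of_bool (t - {x} = s)) / real (Suc j)"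
    if t: "t \<in> level n (Suc j)" for t
  proof -
    have fin: "finite t" "card t = Suc j" using t level_finite[OF t] by (auto simp: level_def)
    have ne: "t \<noteq> {}" using fin by auto
    have inj: "inj_on (\<lambda>x. t - {x}) t" by (auto simp: inj_on_def)
    have "pmf (pmf_of_set ((\<lambda>x. t - {x}) ` t)) s = indicator ((\<lambda>x. t - {x}) ` t) s / real (card t)"
      using fin ne by (subst pmf_of_set) (auto simp: card_image[OF inj])
    also have "indicator ((\<lambda>x. t - {x}) ` t) s = (\<Sum>r\<in>(\<lambda>x. t - {x}) ` t. of_bool (r = s) :: real)"
      using fin by (simp add: of_bool_def indicator_def)
    also have "\<dots> = (\<Sum>x\<in>t. of_bool (t - {x} = s))"
      by (subst sum.reindex[OF inj]) simp
    finally show ?thesis unfolding facets_eq[OF fin] by (simp add: fin)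
  qed
  have "real (Suc j) * pmf (random_facet Q) s = real (Suc j) * (\<Sum>t\<in>level n (Suc j). pmf Q t * pmf (pmf_of_set {s. s \<subseteq> t \<and> card s = card t - 1}) s)"
    unfolding random_facet_def using Q by (subst pmf_bind_finite[of "level n (Suc j)"]) auto
  also have "\<dots> = (\<Sum>t\<in>level n (Suc j). \<Sum>x\<in>t. pmf Q t * of_bool (t - {x} = s))"
    unfolding sum_distrib_left
  proof (intro sum.cong refl)
    fix t assume t: "t \<in> level n (Suc j)"
    show "real (Suc j) * (pmf Q t * pmf (pmf_of_set {s. s \<subseteq> t \<and> card s = card t - 1}) s) = (\<Sum>x\<in>t. pmf Q t * of_bool (t - {x} = s))"
      unfolding facet[OF t] sum_distrib_left[symmetric] by simp
  qed
  also have "\<dots> = (\<Sum>t\<in>level n (Suc j). \<Sum>x\<in>t. pmf Q (insert x (t - {x})) * of_bool (t - {x} = s))"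
    by (intro sum.cong refl) (simp add: insert_absorb)
  also have "\<dots> = (\<Sum>r\<in>level n j. \<Sum>x\<in>{1..n} - r. pmf Q (insert x r) * of_bool (r = s))"
    by (rule level_swap)
  also have "\<dots> = (\<Sum>r\<in>level n j. if r = s then \<Sum>x\<in>{1..n} - s. pmf Q (insert x s) else 0)"
    by (intro sum.cong refl) auto
  also have "\<dots> = (\<Sum>x\<in>{1..n} - s. pmf Q (insert x s))"
    using s by simp
  finally show ?thesis .
qed

lemma induced_measure_top [simp]: "induced_measure k P k = P"
  by (simp add: induced_measure_def)

lemma induced_measure_Suc: "j < k \<Longrightarrow> induced_measure k P j = random_facet (induced_measure k P (Suc j))"
proof -
  assume "j < k"
  then have "k - j = Suc (k - Suc j)" by simp
  then show ?thesis by (simp add: induced_measure_def)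
qed

lemma set_pmf_induced_measure:
  assumes X: "simplicial_complex n X" and P: "set_pmf P \<subseteq> faces X k" and j: "j \<le> k"
  shows "set_pmf (induced_measure k P j) \<subseteq> level n j \<inter> X"
  using j
proof (induction j rule: inc_induct)
  case base
  show ?case using X P by (auto simp: faces_def level_def simplicial_complex_def)
next
  case (step j)
  have "set_pmf (induced_measure k P j) \<subseteq> {s \<in> level n j. \<exists>t\<in>set_pmf (induced_measure k P (Suc j)). s \<subseteq> t}"
    unfolding induced_measure_Suc[OF step(2)] using step.IH by (intro set_pmf_random_facet) auto
  also have "\<dots> \<subseteq> level n j \<inter> X"
    using step.IH X unfolding simplicial_complex_def by blast
  finally show ?case .
qed

lemma induced_measure_step:
  assumes "simplicial_complex n X" "set_pmf P \<subseteq> faces X k" "j < k" "s \<in> level n j"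
  shows "real (Suc j) * pmf (induced_measure k P j) s = (\<Sum>x\<in>{1..n} - s. pmf (induced_measure k P (Suc j)) (insert x s))"
  unfolding induced_measure_Suc[OF assms(3)]
  using set_pmf_induced_measure[OF assms(1,2), of "Suc j"] assms(3,4) by (intro random_facet_pmf) auto

section \<open>From the normalised adjacency matrix to a variance inequality\<close>

text \<open>The substitution u = sqrt(d) g turns the degree-weighted inner product into the
  Euclidean one. The vector sqrt(d) is fixed by the normalised matrix, and the centering hypothesis
  on \<open>g\<close> is orthogonality to it.\<close>

lemma weighted_graph_expansion_centered:
  fixes W :: "nat \<Rightarrow> nat \<Rightarrow> real" and V
  defines "d \<equiv> weighted_degree V W"
  assumes fin: "finite V"
    and sym: "\<And>x y. x \<in> V \<Longrightarrow> y \<in> V \<Longrightarrow> W x y = W y x"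
    and nonneg: "\<And>x y. x \<in> V \<Longrightarrow> y \<in> V \<Longrightarrow> 0 \<le> W x y"
    and sv: "second_singular_value (normalized_adjacency V W) \<le> \<gamma>" and \<gamma>: "\<gamma> < 1"
    and g: "(\<Sum>x\<in>V. d x * g x) = 0"
  shows "(\<Sum>x\<in>V. (\<Sum>y\<in>V. W x y * g y)\<^sup>2 / d x) \<le> \<gamma>\<^sup>2 * (\<Sum>x\<in>V. d x * (g x)\<^sup>2)"
proof -
  have d_nonneg: "0 \<le> d x" if "x \<in> V" for x
    unfolding d_def weighted_degree_def using that nonneg by (intro sum_nonneg) auto
  \<comment> \<open>Vertices of degree zero have zero rows; this keeps the convention x / 0 = 0
    harmless in the rescaling.\<close>
  have zero: "W x y = 0" if "d x = 0" "x \<in> V" "y \<in> V" for x y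
    using that fin nonneg unfolding d_def weighted_degree_def
    by (subst (asm) sum_nonneg_eq_0_iff) auto
  show ?thesis
  proof (cases "\<exists>x\<in>V. d x \<noteq> 0")
    case False
    then show ?thesis by (simp add: zero)
  next
    case True
    then obtain x0 where x0: "x0 \<in> V" "d x0 \<noteq> 0" by auto
    define N where "N = card V"
    define vs where "vs = sorted_list_of_set V"
    define A where "A = normalized_adjacency V W"
    have bij: "bij_betw (\<lambda>i. vs ! i) {..<N} V"
      unfolding vs_def N_def using fin by (intro bij_betw_nth) auto
    have sum_V: "(\<Sum>x\<in>V. f x) = (\<Sum>i<N. f (vs ! i))" for f :: "nat \<Rightarrow> real"
      using sum.reindex_bij_betw[OF bij, of f] by simp
    have vsV: "vs ! i \<in> V" if "i < N" for i
      using bij that by (auto simp: bij_betw_def)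
    have A: "A \<in> carrier_mat N N" by (simp add: A_def normalized_adjacency_def N_def Let_def)
    have A_ij: "A $$ (i, j) = W (vs ! i) (vs ! j) / (sqrt (d (vs ! i)) * sqrt (d (vs ! j)))"
      if "i < N" "j < N" for i j
      using that by (simp add: A_def normalized_adjacency_def N_def vs_def d_def Let_def)
    define v where "v i = sqrt (d (vs ! i))" for i
    define u where "u i = sqrt (d (vs ! i)) * g (vs ! i)" for i
    have cancel: "W x y / (sqrt (d x) * sqrt (d y)) * (sqrt (d y) * c) = W x y * c / sqrt (d x)"
      if "x \<in> V" "y \<in> V" for x y c
    proof (cases "d y = 0")
      case True
      then show ?thesis using zero[of y x] that sym by simp
    next
      case False
      then have "sqrt (d y) > 0" using d_nonneg[OF that(2)] by simp
      then show ?thesis by (simp add: field_simps)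
    qed
    have row: "(\<Sum>j<N. A $$ (i, j) * (sqrt (d (vs ! j)) * f (vs ! j))) = (\<Sum>y\<in>V. W (vs ! i) y * f y) / sqrt (d (vs ! i))"
      if "i < N" for i f
      unfolding sum_V sum_divide_distrib using that
      by (intro sum.cong refl) (simp add: A_ij cancel vsV del: times_divide_eq_left)
    obtain i0 where i0: "i0 < N" "vs ! i0 = x0"
      using bij x0 unfolding bij_betw_def by (metis imageE lessThan_iff)
    have "(\<Sum>i<N. (\<Sum>j<N. A $$ (i, j) * u j)\<^sup>2) \<le> \<gamma>\<^sup>2 * (\<Sum>i<N. (u i)\<^sup>2)"
    proof (rule second_singular_value_bound[OF A])
      show "A $$ (i, j) = A $$ (j, i)" if "i < N" "j < N" for i j
        using that by (simp add: A_ij sym[of "vs ! i"] vsV mult.commute)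
      show "(\<Sum>j<N. A $$ (i, j) * v j) = v i" if i: "i < N" for i
      proof -
        have "(\<Sum>j<N. A $$ (i, j) * v j) = d (vs ! i) / sqrt (d (vs ! i))"
          using row[OF i, of "\<lambda>_. 1"] by (simp add: v_def d_def weighted_degree_def)
        then show ?thesis using d_nonneg[OF vsV[OF i]] by (simp add: v_def real_div_sqrt)
      qed
      show "v i0 \<noteq> 0" using i0 x0 by (simp add: v_def)
      have "(\<Sum>i<N. u i * v i) = (\<Sum>i<N. d (vs ! i) * g (vs ! i))"
      proof (intro sum.cong refl)
        fix i assume "i \<in> {..<N}"
        then have nn: "0 \<le> d (vs ! i)" using d_nonneg vsV by auto
        have "u i * v i = (sqrt (d (vs ! i)))\<^sup>2 * g (vs ! i)"
          by (simp add: u_def v_def power2_eq_square)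
        then show "u i * v i = d (vs ! i) * g (vs ! i)" using nn by simp
      qed
      then show "(\<Sum>i<N. u i * v i) = 0" using g by (simp add: sum_V)
    qed (use i0 sv \<gamma> in \<open>simp_all add: A_def\<close>)
    also have "(\<Sum>i<N. (u i)\<^sup>2) = (\<Sum>x\<in>V. d x * (g x)\<^sup>2)"
      unfolding sum_V using d_nonneg vsV by (intro sum.cong refl) (simp add: u_def power_mult_distrib)
    also have "(\<Sum>i<N. (\<Sum>j<N. A $$ (i, j) * u j)\<^sup>2) = (\<Sum>x\<in>V. (\<Sum>y\<in>V. W x y * g y)\<^sup>2 / d x)"
      unfolding sum_V[of "\<lambda>x. _ x / _ x"] using d_nonneg vsV
      by (intro sum.cong refl) (simp add: u_def row power_divide)
    finally show ?thesis .
  qed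
qed

text \<open>Up to normalisation, the left side is the stationary second moment of the one-step mean
  of \<open>g\<close>, and the first term on the right is its squared mean. Centering at the
  stationary mean reduces to the previous case; the cross terms cancel because the walk preserves
  the stationary measure.\<close>

lemma weighted_graph_expansion:
  fixes W :: "nat \<Rightarrow> nat \<Rightarrow> real" and V
  defines "d \<equiv> weighted_degree V W"
  assumes fin: "finite V"
    and sym: "\<And>x y. x \<in> V \<Longrightarrow> y \<in> V \<Longrightarrow> W x y = W y x"
    and nonneg: "\<And>x y. x \<in> V \<Longrightarrow> y \<in> V \<Longrightarrow> 0 \<le> W x y"
    and sv: "second_singular_value (normalized_adjacency V W) \<le> \<gamma>" and \<gamma>: "\<gamma> < 1"
  shows "(\<Sum>x\<in>V. (\<Sum>y\<in>V. W x y * g y)\<^sup>2 / d x)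
    \<le> (\<Sum>x\<in>V. d x * g x)\<^sup>2 / (\<Sum>x\<in>V. d x) + \<gamma>\<^sup>2 * (\<Sum>x\<in>V. d x * (g x)\<^sup>2)"
proof -
  have d_nonneg: "0 \<le> d x" if "x \<in> V" for x
    unfolding d_def weighted_degree_def using that nonneg by (intro sum_nonneg) auto
  have zero: "W x y = 0" if "d x = 0" "x \<in> V" "y \<in> V" for x y
    using that fin nonneg unfolding d_def weighted_degree_def
    by (subst (asm) sum_nonneg_eq_0_iff) auto
  define D where "D = (\<Sum>x\<in>V. d x)"
  define c where "c = (\<Sum>x\<in>V. d x * g x) / D"
  define h where "h x = g x - c" for x
  define a where "a x = (\<Sum>y\<in>V. W x y * h y)" for x
  show ?thesis
  proof (cases "D = 0")
    case True
    then have "\<forall>x\<in>V. d x = 0"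
      unfolding D_def using fin d_nonneg by (subst (asm) sum_nonneg_eq_0_iff) auto
    then show ?thesis by simp
  next
    case False
    have "D \<ge> 0" unfolding D_def using d_nonneg by (rule sum_nonneg)
    with False have D: "D > 0" by simp
    have dg: "(\<Sum>x\<in>V. d x * g x) = c * D" using D by (simp add: c_def)
    have dh: "(\<Sum>x\<in>V. d x * h x) = 0"
      using dg by (simp add: h_def right_diff_distrib sum_subtractf D_def sum_distrib_left mult.commute)
    have "(\<Sum>x\<in>V. a x) = (\<Sum>y\<in>V. \<Sum>x\<in>V. W x y * h y)"
      unfolding a_def by (rule sum.swap)
    also have "\<dots> = (\<Sum>y\<in>V. d y * h y)"
      unfolding d_def weighted_degree_def sum_distrib_right by (intro sum.cong refl) (simp add: sym)
    finally have a0: "(\<Sum>x\<in>V. a x) = 0" using dh by simp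
    have "(\<Sum>x\<in>V. (\<Sum>y\<in>V. W x y * g y)\<^sup>2 / d x) = (\<Sum>x\<in>V. (a x)\<^sup>2 / d x + 2 * c * a x + c\<^sup>2 * d x)"
    proof (intro sum.cong refl)
      fix x assume x: "x \<in> V"
      have eq: "(\<Sum>y\<in>V. W x y * g y) = a x + c * d x"
        by (simp add: a_def h_def d_def weighted_degree_def right_diff_distrib sum_subtractf sum_distrib_left mult.commute)
      show "(\<Sum>y\<in>V. W x y * g y)\<^sup>2 / d x = (a x)\<^sup>2 / d x + 2 * c * a x + c\<^sup>2 * d x"
      proof (cases "d x = 0")
        case True
        then have "a x = 0" unfolding a_def using zero[OF True x] by simp
        then show ?thesis using True by simp
      next
        case False
        then show ?thesis unfolding eq by (simp add: field_simps power2_eq_square)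
      qed
    qed
    also have "\<dots> = (\<Sum>x\<in>V. (a x)\<^sup>2 / d x) + c\<^sup>2 * D"
      by (simp add: sum.distrib sum_distrib_left[symmetric] a0 D_def)
    also have "(\<Sum>x\<in>V. (a x)\<^sup>2 / d x) \<le> \<gamma>\<^sup>2 * (\<Sum>x\<in>V. d x * (h x)\<^sup>2)"
      unfolding a_def d_def using fin sym nonneg sv \<gamma> dh
      by (intro weighted_graph_expansion_centered) (auto simp: d_def)
    also have "(\<Sum>x\<in>V. d x * (h x)\<^sup>2) = (\<Sum>x\<in>V. d x * (g x)\<^sup>2 - 2 * c * (d x * g x) + c\<^sup>2 * d x)"
      by (intro sum.cong refl) (simp add: h_def power2_eq_square algebra_simps)
    also have "\<dots> = (\<Sum>x\<in>V. d x * (g x)\<^sup>2) - c\<^sup>2 * D"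
      by (simp add: sum.distrib sum_subtractf sum_distrib_left[symmetric] dg D_def[symmetric] power2_eq_square)
    also have "\<gamma>\<^sup>2 * ((\<Sum>x\<in>V. d x * (g x)\<^sup>2) - c\<^sup>2 * D) \<le> \<gamma>\<^sup>2 * (\<Sum>x\<in>V. d x * (g x)\<^sup>2)"
      using D by (intro mult_left_mono) auto
    also have "c\<^sup>2 * D = (\<Sum>x\<in>V. d x * g x)\<^sup>2 / D"
      using D by (simp add: c_def field_simps power2_eq_square)
    finally show ?thesis by (simp add: D_def)
  qed
qed

section \<open>Expander mixing between faces and vertices\<close>

text \<open>Nonnegativity of \<gamma> is arranged by passing to \<open>max 0 \<gamma>\<close> in the
  theorem; \<gamma> < 1 is what the singular value bound asks for.\<close>

locale expanding_complex =
  fixes n k :: nat and X :: "nat set set" and P :: "nat set pmf" and \<gamma> :: real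
  assumes X: "simplicial_complex n X"
    and P: "set_pmf P \<subseteq> faces X k"
    and hdx: "hdx X k P \<gamma>"
    and \<gamma>: "0 \<le> \<gamma>" "\<gamma> < 1"
begin

abbreviation V :: "nat set" where "V \<equiv> {1..n}"

lemma face_subset: "s \<in> X \<Longrightarrow> t \<subseteq> s \<Longrightarrow> t \<in> X"
  using X by (simp add: simplicial_complex_def)

definition w :: "nat \<Rightarrow> nat set \<Rightarrow> real" where
  "w j s = pmf (induced_measure k P j) s"

lemma w_nonneg [simp]: "0 \<le> w j s"
  by (simp add: w_def)

lemma w_zero: "j \<le> k \<Longrightarrow> s \<notin> X \<Longrightarrow> w j s = 0"
  using set_pmf_induced_measure[OF X P] by (auto simp: w_def pmf_eq_0_set_pmf)

lemma w_step: "j < k \<Longrightarrow> s \<in> level n j \<Longrightarrow> real (Suc j) * w j s = (\<Sum>x\<in>V - s. w (Suc j) (insert x s))"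
  unfolding w_def by (rule induced_measure_step[OF X P])

lemma w_sum: "j \<le> k \<Longrightarrow> (\<Sum>s\<in>level n j. w j s) = 1"
  unfolding w_def by (rule sum_pmf_eq_1) (use set_pmf_induced_measure[OF X P, of j] in auto)

lemma w_insert_zero:
  assumes "j < k" "s \<in> level n j" "w j s = 0" "x \<in> V - s"
  shows "w (Suc j) (insert x s) = 0"
proof -
  have "(\<Sum>x\<in>V - s. w (Suc j) (insert x s)) = 0"
    using w_step[OF assms(1,2)] assms(3) by simp
  then show ?thesis
    using assms(4) by (subst (asm) sum_nonneg_eq_0_iff) auto
qed

text \<open>By \<open>w_step\<close> this is (j+1) \<open>w j s\<close> times the conditional mean
  of \<open>g\<close> at the next vertex given \<open>s\<close>; it is left unnormalised to avoid
  dividing by the weight of \<open>s\<close>.\<close>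

definition nbr_sum :: "nat \<Rightarrow> (nat \<Rightarrow> real) \<Rightarrow> nat set \<Rightarrow> real" where
  "nbr_sum j g s = (\<Sum>x\<in>V - s. w (Suc j) (insert x s) * g x)"

text \<open>Expectation when a face of size j+1 is drawn and a uniformly random vertex
  \<open>x\<close> of it is split off, leaving \<open>s\<close>.\<close>

definition edge_avg :: "nat \<Rightarrow> (nat set \<Rightarrow> nat \<Rightarrow> real) \<Rightarrow> real" where
  "edge_avg j \<phi> = (\<Sum>s\<in>level n j. \<Sum>x\<in>V - s. w (Suc j) (insert x s) * \<phi> s x) / real (Suc j)"

text \<open>Here \<open>s\<close> and \<open>x\<close> are independent, so \<open>x\<close> may fall
  into \<open>s\<close>.\<close>

definition indep_avg :: "nat \<Rightarrow> (nat set \<Rightarrow> nat \<Rightarrow> real) \<Rightarrow> real" where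
  "indep_avg j \<phi> = (\<Sum>s\<in>level n j. \<Sum>x\<in>V. w j s * w 1 {x} * \<phi> s x)"

lemma edge_avg_faces:
  "edge_avg j \<phi> = (\<Sum>t\<in>level n (Suc j). w (Suc j) t * (\<Sum>x\<in>t. \<phi> (t - {x}) x)) / real (Suc j)"
proof -
  have "(\<Sum>t\<in>level n (Suc j). w (Suc j) t * (\<Sum>x\<in>t. \<phi> (t - {x}) x))
      = (\<Sum>t\<in>level n (Suc j). \<Sum>x\<in>t. w (Suc j) (insert x (t - {x})) * \<phi> (t - {x}) x)"
    unfolding sum_distrib_left by (intro sum.cong refl) (simp add: insert_absorb)
  then show ?thesis unfolding edge_avg_def level_swap[symmetric] by simp
qed

lemma edge_avg_fst:
  assumes "j < k"
  shows "edge_avg j (\<lambda>s x. f s) = (\<Sum>s\<in>level n j. w j s * f s)"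
proof -
  have "(\<Sum>s\<in>level n j. \<Sum>x\<in>V - s. w (Suc j) (insert x s) * f s) = (\<Sum>s\<in>level n j. real (Suc j) * (w j s * f s))"
    unfolding sum_distrib_right[symmetric] mult.assoc[symmetric]
    by (intro sum.cong refl) (simp only: w_step[OF assms])
  then show ?thesis by (simp add: edge_avg_def sum_distrib_left[symmetric] del: of_nat_Suc)
qed

lemma edge_avg_mono:
  assumes "\<And>s x. s \<in> level n j \<Longrightarrow> x \<in> V - s \<Longrightarrow> \<phi> s x \<le> \<psi> s x"
  shows "edge_avg j \<phi> \<le> edge_avg j \<psi>"
  unfolding edge_avg_def using assms by (intro divide_right_mono sum_mono mult_left_mono) auto

text \<open>A uniform vertex of a uniform facet is a uniform vertex of the face, so the marked
  vertex has law \<open>w 1\<close> at every level. In the induction: the sums of \<open>g\<close>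
  over the facets of a face of size j+2 add up to j+1 times its sum over the face.\<close>

lemma edge_avg_snd:
  assumes "j < k"
  shows "edge_avg j (\<lambda>s x. g x) = (\<Sum>x\<in>V. w 1 {x} * g x)"
  using assms
proof (induction j)
  case 0
  then show ?case by (simp add: edge_avg_def)
next
  case (Suc j)
  define G where "G s = (\<Sum>x\<in>s. g x)" for s :: "nat set"
  have "edge_avg j (\<lambda>s x. g x) = (\<Sum>t\<in>level n (Suc j). w (Suc j) t * G t) / real (Suc j)"
    by (simp add: edge_avg_faces G_def)
  also have "(\<Sum>t\<in>level n (Suc j). w (Suc j) t * G t) = edge_avg (Suc j) (\<lambda>s x. G s)"
    using Suc.prems by (rule edge_avg_fst[symmetric])
  also have "\<dots> = (\<Sum>t\<in>level n (Suc (Suc j)). w (Suc (Suc j)) t * (real (Suc j) * G t)) / real (Suc (Suc j))"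
    unfolding edge_avg_faces
  proof (intro arg_cong2[where f = divide] sum.cong refl arg_cong2[where f = "(*)"])
    fix t assume t: "t \<in> level n (Suc (Suc j))"
    then have fin: "finite t" "card t = Suc (Suc j)"
      using level_finite[OF t] by (auto simp: level_def)
    have "(\<Sum>x\<in>t. G (t - {x})) = (\<Sum>x\<in>t. G t - g x)"
      using fin by (intro sum.cong refl) (simp add: G_def sum_diff1)
    also have "\<dots> = real (Suc j) * G t"
      using fin by (simp add: sum_subtractf G_def algebra_simps)
    finally show "(\<Sum>x\<in>t. G (t - {x})) = real (Suc j) * G t" .
  qed
  also have "\<dots> = real (Suc j) * edge_avg (Suc j) (\<lambda>s x. g x)"
    by (simp add: edge_avg_faces G_def sum_distrib_left mult_ac sum_divide_distrib del: of_nat_Suc)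
  finally have "edge_avg j (\<lambda>s x. g x) = edge_avg (Suc j) (\<lambda>s x. g x)"
    by (simp del: of_nat_Suc)
  then show ?case using Suc by simp
qed

text \<open>Graph expansion in the link of \<open>s\<close>, where \<open>x\<close> has degree (j+2)
  \<open>w (Suc j) (insert x s)\<close>. After division by (j+1)(j+2) it says, with weight
  \<open>w j s\<close>, that revealing one more vertex raises the second moment of the conditional
  mean of \<open>g\<close> by at most \<gamma>^2 times the conditional mean of g^2.\<close>

lemma link_bound:
  assumes j: "Suc j < k" and s: "s \<in> level n j"
  shows "(\<Sum>x\<in>V - s. (nbr_sum (Suc j) g (insert x s))\<^sup>2 / (real (j + 2) * w (Suc j) (insert x s)))
    \<le> real (j + 2) * (nbr_sum j g s)\<^sup>2 / (real (Suc j) * w j s)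
      + \<gamma>\<^sup>2 * (real (j + 2) * nbr_sum j (\<lambda>x. (g x)\<^sup>2) s)"
proof (cases "s \<in> X")
  case False
  have "w (Suc j) (insert x s) = 0" for x
    using False j face_subset[of "insert x s" s] by (intro w_zero) auto
  then show ?thesis by (simp add: nbr_sum_def)
next
  case True
  define U where "U = link_vertices X s"
  define W where "W = link_weight X k P s"
  have cs: "card s = j" and fs: "finite s" using s level_finite[OF s] by (auto simp: level_def)
  have U: "U \<subseteq> V - s" using X by (auto simp: U_def link_vertices_def simplicial_complex_def)
  have finU: "finite U" using U by (rule finite_subset) simp
  have zero1: "w (Suc j) (insert x s) = 0" if "x \<in> V - s - U" for x
    using that j by (intro w_zero) (auto simp: U_def link_vertices_def)
  \<comment> \<open>A vertex outside the link completes no face containing \<open>s\<close>, so sums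
    over the link extend to all remaining vertices.\<close>
  have zero2: "w (Suc (Suc j)) (insert y (insert x s)) = 0" if "y \<in> V - s - U" for x y
  proof (rule w_zero)
    show "insert y (insert x s) \<notin> X"
    proof
      assume "insert y (insert x s) \<in> X"
      then have "insert y s \<in> X" by (rule face_subset) auto
      then show False using that by (auto simp: U_def link_vertices_def)
    qed
  qed (use j in simp)
  have W_eq: "W x y = w (j + 2) (insert y (insert x s))" if "x \<in> U" "y \<in> U" "x \<noteq> y" for x y
  proof -
    have eq: "s \<union> {x, y} = insert y (insert x s)" by auto
    show ?thesis
    proof (cases "s \<union> {x, y} \<in> X")
      case True
      then show ?thesis using that by (simp add: W_def link_weight_def U_def w_def cs eq insert_commute)
    next
      case False
      then have "w (j + 2) (insert y (insert x s)) = 0" using j by (intro w_zero) (simp_all add: eq insert_commute)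
      then show ?thesis using False by (simp add: W_def link_weight_def)
    qed
  qed
  have W_refl: "W x x = 0" for x by (simp add: W_def link_weight_def)
  have row: "(\<Sum>y\<in>U. W x y * f y) = nbr_sum (Suc j) f (insert x s)" if x: "x \<in> U" for x f
  proof -
    have "(\<Sum>y\<in>U. W x y * f y) = (\<Sum>y\<in>U - {x}. W x y * f y)"
      using finU x by (subst sum.remove[of U x]) (auto simp: W_refl)
    also have "\<dots> = (\<Sum>y\<in>U - {x}. w (j + 2) (insert y (insert x s)) * f y)"
      using x by (intro sum.cong refl) (auto simp: W_eq)
    also have "\<dots> = (\<Sum>y\<in>V - insert x s. w (j + 2) (insert y (insert x s)) * f y)"
    proof (intro sum.mono_neutral_left ballI)
      fix y assume "y \<in> V - insert x s - (U - {x})"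
      then have "y \<in> V - s - U" by auto
      then show "w (j + 2) (insert y (insert x s)) * f y = 0" by (simp add: zero2)
    qed (use U in auto)
    finally show ?thesis by (simp add: nbr_sum_def)
  qed
  have deg: "weighted_degree U W x = real (j + 2) * w (Suc j) (insert x s)" if x: "x \<in> U" for x
  proof -
    have "weighted_degree U W x = nbr_sum (Suc j) (\<lambda>_. 1) (insert x s)"
      using row[OF x, of "\<lambda>_. 1"] by (simp add: weighted_degree_def)
    also have "\<dots> = real (Suc (Suc j)) * w (Suc j) (insert x s)"
      unfolding nbr_sum_def using j s x U by (subst w_step) (auto intro!: insert_in_level)
    finally show ?thesis by simp
  qed
  have sumU: "(\<Sum>x\<in>U. w (Suc j) (insert x s) * f x) = nbr_sum j f s" for f
    unfolding nbr_sum_def using U by (intro sum.mono_neutral_left) (auto simp: zero1)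
  have total: "nbr_sum j (\<lambda>_. 1) s = real (Suc j) * w j s"
    using w_step[OF _ s] j by (simp add: nbr_sum_def)
  have degsum: "(\<Sum>x\<in>U. weighted_degree U W x * f x) = real (j + 2) * nbr_sum j f s" for f
    by (simp add: deg sumU[symmetric] sum_distrib_left mult.assoc)
  have "(\<Sum>x\<in>U. (\<Sum>y\<in>U. W x y * g y)\<^sup>2 / weighted_degree U W x)
      \<le> (\<Sum>x\<in>U. weighted_degree U W x * g x)\<^sup>2 / (\<Sum>x\<in>U. weighted_degree U W x)
        + \<gamma>\<^sup>2 * (\<Sum>x\<in>U. weighted_degree U W x * (g x)\<^sup>2)"
  proof (rule weighted_graph_expansion[OF finU])
    show "W x y = W y x" for x y
      by (auto simp: W_def link_weight_def insert_commute)
    show "0 \<le> W x y" for x y by (simp add: W_def link_weight_def)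
    have "s \<in> faces X j" using True cs by (simp add: faces_def)
    then show "second_singular_value (normalized_adjacency U W) \<le> \<gamma>"
      using hdx[unfolded hdx_def, rule_format, of j s] j by (simp add: U_def W_def)
  qed (rule \<gamma>)
  also note degsum
  also note degsum
  also have "(\<Sum>x\<in>U. weighted_degree U W x) = real (j + 2) * (real (Suc j) * w j s)"
    using degsum[of "\<lambda>_. 1"] total by simp
  also have "(\<Sum>x\<in>U. (\<Sum>y\<in>U. W x y * g y)\<^sup>2 / weighted_degree U W x)
      = (\<Sum>x\<in>U. (nbr_sum (Suc j) g (insert x s))\<^sup>2 / (real (j + 2) * w (Suc j) (insert x s)))"
    by (intro sum.cong refl) (simp add: row deg)
  also have "\<dots> = (\<Sum>x\<in>V - s. (nbr_sum (Suc j) g (insert x s))\<^sup>2 / (real (j + 2) * w (Suc j) (insert x s)))"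
    using U by (intro sum.mono_neutral_left) (auto simp: zero1)
  also have "(real (j + 2) * nbr_sum j g s)\<^sup>2 / (real (j + 2) * (real (Suc j) * w j s))
      = real (j + 2) * (nbr_sum j g s)\<^sup>2 / (real (Suc j) * w j s)"
    by (simp add: power2_eq_square mult.left_commute del: of_nat_Suc of_nat_add)
  finally show ?thesis .
qed

text \<open>The left side is the second moment of E[g(x) | s] for a random j-face \<open>s\<close>;
  the division by (j+1)^2 undoes the scaling of \<open>nbr_sum\<close>. Summing
  \<open>link_bound\<close> over a level adds \<gamma>^2 E[g^2], and at level 0 the conditional mean
  is the plain mean.\<close>

lemma nbr_sum_square_bound:
  assumes "j < k"
  shows "(\<Sum>s\<in>level n j. (nbr_sum j g s)\<^sup>2 / w j s) / (real (Suc j))\<^sup>2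
    \<le> (\<Sum>x\<in>V. w 1 {x} * g x)\<^sup>2 + real j * \<gamma>\<^sup>2 * (\<Sum>x\<in>V. w 1 {x} * (g x)\<^sup>2)"
  using assms
proof (induction j)
  case 0
  have "w 0 {} = 1" using w_sum[of 0] by simp
  then show ?case by (simp add: nbr_sum_def)
next
  case (Suc j)
  define H where "H i = (\<Sum>s\<in>level n i. (nbr_sum i g s)\<^sup>2 / w i s)" for i
  define G where "G = (\<Sum>x\<in>V. w 1 {x} * (g x)\<^sup>2)"
  have sq: "(\<Sum>s\<in>level n j. nbr_sum j (\<lambda>x. (g x)\<^sup>2) s) = real (Suc j) * G"
    using edge_avg_snd[of j "\<lambda>x. (g x)\<^sup>2"] Suc.prems
    by (simp add: edge_avg_def nbr_sum_def G_def field_simps)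
  \<comment> \<open>Each face of size j+1 occurs once for each of its vertices, whence the factor
    j+1.\<close>
  have "real (Suc j) * H (Suc j) / real (j + 2)
      = (\<Sum>t\<in>level n (Suc j). \<Sum>x\<in>t. (nbr_sum (Suc j) g (insert x (t - {x})))\<^sup>2 / (real (j + 2) * w (Suc j) (insert x (t - {x}))))"
    unfolding H_def sum_distrib_left sum_divide_distrib
  proof (intro sum.cong refl)
    fix t assume t: "t \<in> level n (Suc j)"
    then have "card t = Suc j" by (simp add: level_def)
    moreover have "(\<Sum>x\<in>t. (nbr_sum (Suc j) g (insert x (t - {x})))\<^sup>2 / (real (j + 2) * w (Suc j) (insert x (t - {x}))))
        = (\<Sum>x\<in>t. (nbr_sum (Suc j) g t)\<^sup>2 / (real (j + 2) * w (Suc j) t))"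
      by (intro sum.cong refl) (simp add: insert_absorb)
    ultimately show "real (Suc j) * ((nbr_sum (Suc j) g t)\<^sup>2 / w (Suc j) t) / real (j + 2)
      = (\<Sum>x\<in>t. (nbr_sum (Suc j) g (insert x (t - {x})))\<^sup>2 / (real (j + 2) * w (Suc j) (insert x (t - {x}))))"
      by simp
  qed
  also have "\<dots> = (\<Sum>s\<in>level n j. \<Sum>x\<in>V - s. (nbr_sum (Suc j) g (insert x s))\<^sup>2 / (real (j + 2) * w (Suc j) (insert x s)))"
    by (rule level_swap)
  also have "\<dots> \<le> (\<Sum>s\<in>level n j. real (j + 2) * (nbr_sum j g s)\<^sup>2 / (real (Suc j) * w j s)
      + \<gamma>\<^sup>2 * (real (j + 2) * nbr_sum j (\<lambda>x. (g x)\<^sup>2) s))"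
    using Suc.prems by (intro sum_mono link_bound)
  also have "\<dots> = real (j + 2) / real (Suc j) * H j + \<gamma>\<^sup>2 * (real (j + 2) * (real (Suc j) * G))"
    by (simp add: sum.distrib H_def sum_distrib_left sq[symmetric] del: of_nat_Suc of_nat_add)
  finally have "real (Suc j) * H (Suc j) / real (j + 2)
    \<le> real (j + 2) / real (Suc j) * H j + \<gamma>\<^sup>2 * (real (j + 2) * (real (Suc j) * G))" .
  then have "real (Suc j) * H (Suc j) / real (j + 2) / (real (j + 2) * real (Suc j))
    \<le> (real (j + 2) / real (Suc j) * H j + \<gamma>\<^sup>2 * (real (j + 2) * (real (Suc j) * G))) / (real (j + 2) * real (Suc j))"
    by (rule divide_right_mono) simp
  also have "real (Suc j) * H (Suc j) / real (j + 2) / (real (j + 2) * real (Suc j)) = H (Suc j) / (real (j + 2))\<^sup>2"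
    by (simp add: power2_eq_square del: of_nat_Suc of_nat_add)
  also have "(real (j + 2) / real (Suc j) * H j + \<gamma>\<^sup>2 * (real (j + 2) * (real (Suc j) * G))) / (real (j + 2) * real (Suc j))
      = H j / (real (Suc j))\<^sup>2 + \<gamma>\<^sup>2 * G"
    by (simp add: power2_eq_square add_divide_distrib del: of_nat_Suc of_nat_add)
  finally have "H (Suc j) / (real (Suc (Suc j)))\<^sup>2 \<le> H j / (real (Suc j))\<^sup>2 + \<gamma>\<^sup>2 * G" by simp
  then show ?case
    using Suc.IH Suc.prems unfolding H_def[symmetric] G_def[symmetric] by (simp add: algebra_simps)
qed

text \<open>Replacing \<open>g\<close> by its deviation from the mean removes the independent part;
  Cauchy-Schwarz and the second moment bound for the centered function do the rest. The geometric
  mean of the two norms is relaxed to the arithmetic one, which is linear in the squares and can be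
  summed over Gram coordinates.\<close>

lemma expander_mixing:
  assumes j: "j < k"
  shows "edge_avg j (\<lambda>s x. f s * g x) - indep_avg j (\<lambda>s x. f s * g x)
    \<le> sqrt (real j) * \<gamma> * ((\<Sum>s\<in>level n j. w j s * (f s)\<^sup>2) + (\<Sum>x\<in>V. w 1 {x} * (g x)\<^sup>2)) / 2"
proof -
  define E where "E = (\<Sum>x\<in>V. w 1 {x} * g x)"
  define h where "h x = g x - E" for x
  define F2 where "F2 = (\<Sum>s\<in>level n j. w j s * (f s)\<^sup>2)"
  define G2 where "G2 = (\<Sum>x\<in>V. w 1 {x} * (g x)\<^sup>2)"
  have one: "(\<Sum>x\<in>V. w 1 {x}) = 1"
    using w_sum[of 1] j by (simp add: level_1 sum.reindex)
  have "indep_avg j (\<lambda>s x. f s * g x) = (\<Sum>s\<in>level n j. w j s * (f s * E))"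
    unfolding indep_avg_def E_def sum_distrib_left by (simp add: mult_ac)
  also have "\<dots> = edge_avg j (\<lambda>s x. f s * E)"
    using edge_avg_fst[OF j, of "\<lambda>s. f s * E"] by simp
  finally have "edge_avg j (\<lambda>s x. f s * g x) - indep_avg j (\<lambda>s x. f s * g x) = edge_avg j (\<lambda>s x. f s * h x)"
    by (simp add: edge_avg_def h_def diff_divide_distrib[symmetric] sum_subtractf[symmetric] right_diff_distrib del: of_nat_Suc)
  also have "\<dots> = (\<Sum>s\<in>level n j. (sqrt (w j s) * f s) * (nbr_sum j h s / sqrt (w j s) / real (Suc j)))"
    unfolding edge_avg_def sum_divide_distrib
  proof (intro sum.cong refl)
    fix s assume s: "s \<in> level n j"
    have "(\<Sum>x\<in>V - s. w (Suc j) (insert x s) * (f s * h x) / real (Suc j)) = f s * nbr_sum j h s / real (Suc j)"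
      by (simp add: nbr_sum_def sum_distrib_left sum_divide_distrib mult_ac)
    also have "\<dots> = (sqrt (w j s) * f s) * (nbr_sum j h s / sqrt (w j s) / real (Suc j))"
    \<comment> \<open>The factor sqrt(w) cannot be split off a weightless face, but there the
      neighbour sum vanishes.\<close>
    proof (cases "w j s = 0")
      case True
      then have "nbr_sum j h s = 0"
        using w_insert_zero[OF j s True] by (simp add: nbr_sum_def)
      then show ?thesis by simp
    qed simp
    finally show "(\<Sum>x\<in>V - s. w (Suc j) (insert x s) * (f s * h x) / real (Suc j))
      = (sqrt (w j s) * f s) * (nbr_sum j h s / sqrt (w j s) / real (Suc j))" .
  qed
  also have "\<dots> \<le> sqrt ((\<Sum>s\<in>level n j. (sqrt (w j s) * f s)\<^sup>2) * (\<Sum>s\<in>level n j. (nbr_sum j h s / sqrt (w j s) / real (Suc j))\<^sup>2))"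
    by (intro real_le_rsqrt Cauchy_Schwarz_ineq_sum)
  also have "(\<Sum>s\<in>level n j. (sqrt (w j s) * f s)\<^sup>2) = F2"
    by (simp add: F2_def power_mult_distrib)
  also have "(\<Sum>s\<in>level n j. (nbr_sum j h s / sqrt (w j s) / real (Suc j))\<^sup>2) = (\<Sum>s\<in>level n j. (nbr_sum j h s)\<^sup>2 / w j s) / (real (Suc j))\<^sup>2"
    by (simp add: power_divide power_mult_distrib sum_divide_distrib del: of_nat_Suc)
  also have "sqrt (F2 * \<dots>) \<le> sqrt (F2 * (real j * \<gamma>\<^sup>2 * G2))"
  proof (intro real_sqrt_le_mono mult_left_mono)
    have "(\<Sum>x\<in>V. w 1 {x} * h x) = 0"
      by (simp add: h_def right_diff_distrib sum_subtractf E_def[symmetric] sum_distrib_right[symmetric] one del: One_nat_def)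
    then have "(\<Sum>s\<in>level n j. (nbr_sum j h s)\<^sup>2 / w j s) / (real (Suc j))\<^sup>2 \<le> real j * \<gamma>\<^sup>2 * (\<Sum>x\<in>V. w 1 {x} * (h x)\<^sup>2)"
      using nbr_sum_square_bound[OF j, of h] by simp
    also have "(\<Sum>x\<in>V. w 1 {x} * (h x)\<^sup>2) = (\<Sum>x\<in>V. w 1 {x} * (g x)\<^sup>2 - 2 * E * (w 1 {x} * g x) + E\<^sup>2 * w 1 {x})"
      by (intro sum.cong refl) (simp add: h_def power2_eq_square algebra_simps)
    also have "\<dots> = G2 - E\<^sup>2"
      by (simp add: sum.distrib sum_subtractf sum_distrib_left[symmetric] E_def[symmetric] G2_def[symmetric] one del: One_nat_def, simp add: power2_eq_square)
    also have "real j * \<gamma>\<^sup>2 * (G2 - E\<^sup>2) \<le> real j * \<gamma>\<^sup>2 * G2"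
      by (intro mult_left_mono) auto
    finally show "(\<Sum>s\<in>level n j. (nbr_sum j h s)\<^sup>2 / w j s) / (real (Suc j))\<^sup>2 \<le> real j * \<gamma>\<^sup>2 * G2" .
    show "0 \<le> F2" unfolding F2_def by (intro sum_nonneg) auto
  qed
  also have "\<dots> = sqrt (real j) * \<gamma> * sqrt (F2 * G2)"
    using \<gamma> by (simp add: real_sqrt_mult)
  also have "\<dots> \<le> sqrt (real j) * \<gamma> * ((F2 + G2) / 2)"
    using \<gamma> by (intro mult_left_mono arith_geo_mean_sqrt) (auto simp: F2_def G2_def sum_nonneg)
  finally show ?thesis by (simp add: F2_def G2_def)
qed

end

section \<open>Covariances of a local ensemble\<close>

lemma psd_on_subset: "psd_on I M \<Longrightarrow> J \<subseteq> I \<Longrightarrow> finite I \<Longrightarrow> psd_on J M"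
proof -
  assume I: "psd_on I M" "J \<subseteq> I" "finite I"
  have "0 \<le> (\<Sum>i\<in>J. \<Sum>j\<in>J. v i * M i j * v j)" for v
  proof -
    define v' where "v' i = (if i \<in> J then v i else 0)" for i
    have "(\<Sum>i\<in>I. \<Sum>j\<in>I. v' i * M i j * v' j) = (\<Sum>i\<in>J. \<Sum>j\<in>I. v' i * M i j * v' j)"
      using I by (intro sum.mono_neutral_right) (auto simp: v'_def)
    also have "\<dots> = (\<Sum>i\<in>J. \<Sum>j\<in>J. v' i * M i j * v' j)"
      using I by (intro sum.cong refl sum.mono_neutral_right) (auto simp: v'_def)
    also have "\<dots> = (\<Sum>i\<in>J. \<Sum>j\<in>J. v i * M i j * v j)"
      by (intro sum.cong refl) (auto simp: v'_def)
    finally have "(\<Sum>i\<in>I. \<Sum>j\<in>I. v' i * M i j * v' j) = (\<Sum>i\<in>J. \<Sum>j\<in>J. v i * M i j * v j)" .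
    moreover have "0 \<le> (\<Sum>i\<in>I. \<Sum>j\<in>I. v' i * M i j * v' j)"
      using I(1) unfolding psd_on_def by blast
    ultimately show ?thesis by simp
  qed
  then show ?thesis using I unfolding psd_on_def by blast
qed

lemma quadratic_form_insert:
  fixes M :: "'i \<Rightarrow> 'i \<Rightarrow> real"
  assumes "finite I" "a \<notin> I" "\<And>i. i \<in> I \<Longrightarrow> M i a = M a i"
  shows "(\<Sum>i\<in>insert a I. \<Sum>j\<in>insert a I. v i * M i j * v j)
    = (v a)\<^sup>2 * M a a + 2 * v a * (\<Sum>j\<in>I. M a j * v j) + (\<Sum>i\<in>I. \<Sum>j\<in>I. v i * M i j * v j)"
proof -
  have "(\<Sum>i\<in>I. v i * M i a * v a) = v a * (\<Sum>j\<in>I. M a j * v j)"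
    unfolding sum_distrib_left using assms by (intro sum.cong refl) simp
  moreover have "(\<Sum>j\<in>I. v a * M a j * v j) = v a * (\<Sum>j\<in>I. M a j * v j)"
    unfolding sum_distrib_left by (simp add: mult.assoc)
  ultimately show ?thesis using assms by (simp add: sum.distrib power2_eq_square)
qed

text \<open>Cholesky factorisation, one index at a time. A zero pivot forces its whole row to
  vanish; otherwise the Schur complement is again positive semidefinite, and one new coordinate,
  \<open>M a i / sqrt (M a a)\<close>, accounts for the difference.\<close>

lemma psd_gram:
  fixes M :: "'i \<Rightarrow> 'i \<Rightarrow> real"
  assumes "finite I" "psd_on I M"
  shows "\<exists>(u :: 'i \<Rightarrow> nat \<Rightarrow> real) N. \<forall>i\<in>I. \<forall>j\<in>I. M i j = (\<Sum>l<N. u i l * u j l)"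
  using assms
proof (induction I arbitrary: M rule: finite_induct)
  case empty
  then show ?case by simp
next
  case (insert a I)
  have sym: "M i j = M j i" if "i \<in> insert a I" "j \<in> insert a I" for i j
    using insert.prems that unfolding psd_on_def by blast
  have form: "0 \<le> (v a)\<^sup>2 * M a a + 2 * v a * (\<Sum>j\<in>I. M a j * v j) + (\<Sum>i\<in>I. \<Sum>j\<in>I. v i * M i j * v j)" for v
  proof -
    have "0 \<le> (\<Sum>i\<in>insert a I. \<Sum>j\<in>insert a I. v i * M i j * v j)"
      using insert.prems unfolding psd_on_def by blast
    also have "\<dots> = (v a)\<^sup>2 * M a a + 2 * v a * (\<Sum>j\<in>I. M a j * v j) + (\<Sum>i\<in>I. \<Sum>j\<in>I. v i * M i j * v j)"
      using insert.hyps sym by (intro quadratic_form_insert) auto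
    finally show ?thesis .
  qed
  have psd_I: "psd_on I M"
    using insert.prems by (rule psd_on_subset) (use insert.hyps in auto)
  show ?case
  proof (cases "M a a = 0")
    case True
    have zero: "M a j = 0" if j: "j \<in> I" for j
    proof (rule ccontr)
      assume ne: "M a j \<noteq> 0"
      have aj: "a \<noteq> j" using insert.hyps j by auto
      \<comment> \<open>Chosen so that the form takes the value -1 at the vector with entry t at
        \<open>a\<close> and 1 at \<open>j\<close>.\<close>
      define t where "t = - (M j j + 1) / (2 * M a j)"
      define v where "v i = (if i = a then t else of_bool (i = j))" for i
      have "(\<Sum>i\<in>I. M a i * v i) = (\<Sum>i\<in>I. if i = j then M a j else 0)"
        using insert.hyps by (intro sum.cong refl) (auto simp: v_def)
      moreover have "(\<Sum>i\<in>I. \<Sum>l\<in>I. v i * M i l * v l) = (\<Sum>i\<in>I. if i = j then \<Sum>l\<in>I. if l = j then M j j else 0 else 0)"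
      proof (intro sum.cong refl)
        fix i assume i: "i \<in> I"
        have "(\<Sum>l\<in>I. v i * M i l * v l) = (\<Sum>l\<in>I. if i = j then if l = j then M j j else 0 else 0)"
          using insert.hyps i by (intro sum.cong refl) (auto simp: v_def)
        then show "(\<Sum>l\<in>I. v i * M i l * v l) = (if i = j then \<Sum>l\<in>I. if l = j then M j j else 0 else 0)"
          by simp
      qed
      ultimately have "0 \<le> 2 * t * M a j + M j j"
        using form[of v] True j insert.hyps by (simp add: v_def)
      also have "2 * t * M a j = - (M j j + 1)" using ne by (simp add: t_def)
      finally show False by simp
    qed
    obtain u :: "'i \<Rightarrow> nat \<Rightarrow> real" and N where u: "\<forall>i\<in>I. \<forall>j\<in>I. M i j = (\<Sum>l<N. u i l * u j l)"
      using insert.IH[OF psd_I] by (elim exE)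
    define u' where "u' i = (if i = a then (\<lambda>_. 0) else u i)" for i
    have "M i j = (\<Sum>l<N. u' i l * u' j l)" if "i \<in> insert a I" "j \<in> insert a I" for i j
      using that True zero sym[of i j] u by (auto simp: u'_def)
    then show ?thesis by blast
  next
    case False
    define v0 where "v0 i = (of_bool (i = a) :: real)" for i
    have "0 \<le> M a a"
    proof -
      have "(\<Sum>j\<in>I. M a j * v0 j) = 0" "(\<Sum>i\<in>I. \<Sum>j\<in>I. v0 i * M i j * v0 j) = 0"
        using insert.hyps by (auto simp: v0_def intro!: sum.neutral)
      then show ?thesis using form[of v0] by (simp add: v0_def)
    qed
    with False have pos: "M a a > 0" by simp
    define M' where "M' i j = M i j - M a i * M a j / M a a" for i j
    have "psd_on I M'"
      unfolding psd_on_def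
    proof (intro conjI ballI allI)
      show "M' i j = M' j i" if "i \<in> I" "j \<in> I" for i j
        using that sym[of i j] by (simp add: M'_def mult.commute)
      fix v
      define B where "B = (\<Sum>j\<in>I. M a j * v j)"
      \<comment> \<open>The entry at \<open>a\<close> minimises the form; completing the square
        leaves the Schur complement.\<close>
      define v' where "v' i = (if i = a then - B / M a a else v i)" for i
      have v': "v' i = v i" if "i \<in> I" for i using that insert.hyps by (auto simp: v'_def)
      have "0 \<le> (v' a)\<^sup>2 * M a a + 2 * v' a * B + (\<Sum>i\<in>I. \<Sum>j\<in>I. v i * M i j * v j)"
        using form[of v'] by (simp add: v' B_def cong: sum.cong)
      also have "(v' a)\<^sup>2 * M a a + 2 * v' a * B = - B * B / M a a"
        using pos by (simp add: v'_def field_simps power2_eq_square)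
      also have "- B * B / M a a = - (\<Sum>i\<in>I. \<Sum>j\<in>I. v i * (M a i * M a j / M a a) * v j)"
        by (simp add: B_def sum_product sum_divide_distrib mult_ac)
      also have "\<dots> + (\<Sum>i\<in>I. \<Sum>j\<in>I. v i * M i j * v j) = (\<Sum>i\<in>I. \<Sum>j\<in>I. v i * M' i j * v j)"
        by (simp add: M'_def left_diff_distrib right_diff_distrib sum_subtractf)
      finally show "0 \<le> (\<Sum>i\<in>I. \<Sum>j\<in>I. v i * M' i j * v j)" .
    qed
    then have "\<exists>(u :: 'i \<Rightarrow> nat \<Rightarrow> real) N. \<forall>i\<in>I. \<forall>j\<in>I. M' i j = (\<Sum>l<N. u i l * u j l)"
      by (rule insert.IH)
    then obtain u :: "'i \<Rightarrow> nat \<Rightarrow> real" and N where u: "\<forall>i\<in>I. \<forall>j\<in>I. M' i j = (\<Sum>l<N. u i l * u j l)"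
      by (elim exE)
    define u' where "u' i l = (if l = N then M a i / sqrt (M a a) else if i = a then 0 else u i l)" for i l
    have "M i j = (\<Sum>l<Suc N. u' i l * u' j l)" if ij: "i \<in> insert a I" "j \<in> insert a I" for i j
    proof (cases "i = a \<or> j = a")
      case True
      then have "(\<Sum>l<N. u' i l * u' j l) = 0" by (auto simp: u'_def intro!: sum.neutral)
      then show ?thesis using True pos sym[of i j] ij by (auto simp: u'_def)
    next
      case False
      then have ij': "i \<in> I" "j \<in> I" using ij by auto
      have "(\<Sum>l<N. u' i l * u' j l) = M' i j"
        using False ij' u by (simp add: u'_def)
      then show ?thesis using pos by (simp add: u'_def M'_def)
    qed
    then show ?thesis by blast
  qed
qed

lemma covariance_of_bool:
  fixes p :: "'a pmf"
  shows "covariance p (\<lambda>x. of_bool (A x)) (\<lambda>x. of_bool (B x))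
    = measure_pmf.prob p {x. A x \<and> B x} - measure_pmf.prob p {x. A x} * measure_pmf.prob p {x. B x}"
proof -
  have E: "measure_pmf.expectation p (\<lambda>x. of_bool (A x)) = measure_pmf.prob p {x. A x}" for A :: "'a \<Rightarrow> bool"
  proof -
    have "(\<lambda>x. of_bool (A x) :: real) = indicator {x. A x}" by (auto simp: indicator_def)
    then show ?thesis by simp
  qed
  have int: "integrable (measure_pmf p) (\<lambda>x. of_bool (A x) :: real)" for A :: "'a \<Rightarrow> bool"
    by (rule measure_pmf.integrable_const_bound[where B = 1]) auto
  define a b where "a = measure_pmf.prob p {x. A x}" and "b = measure_pmf.prob p {x. B x}"
  have "covariance p (\<lambda>x. of_bool (A x)) (\<lambda>x. of_bool (B x))
      = measure_pmf.expectation p (\<lambda>x. of_bool (A x \<and> B x) - b * of_bool (A x) - a * of_bool (B x) + a * b)"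
    unfolding covariance_def E a_def[symmetric] b_def[symmetric]
    by (intro Bochner_Integration.integral_cong refl) (simp add: algebra_simps of_bool_conj)
  also have "\<dots> = measure_pmf.prob p {x. A x \<and> B x} - b * a - a * b + a * b"
    using int[of "\<lambda>x. A x \<and> B x"] int[of A] int[of B]
    by (simp add: E a_def[symmetric] b_def[symmetric] del: of_bool_conj)
  finally show ?thesis by (simp add: a_def b_def)
qed

section \<open>Covariances, their squares, and the distance to a product law\<close>

text \<open>Termwise AM-GM, with weights such that the constant parts add up to at most \<theta> /
  2. Being affine in the squares, the bound survives averaging without an appeal to concavity of the
  square root.\<close>

lemma sum_abs_le_square:
  fixes c :: "'i \<Rightarrow> real"
  assumes "finite A" "real (card A) \<le> Q" "0 < Q" "0 < \<theta>"
  shows "(\<Sum>i\<in>A. \<bar>c i\<bar>) \<le> \<theta> / 2 + Q / (2 * \<theta>) * (\<Sum>i\<in>A. (c i)\<^sup>2)"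
proof -
  have "\<bar>c i\<bar> \<le> \<theta> / (2 * Q) + Q / (2 * \<theta>) * (c i)\<^sup>2" for i
  proof -
    have "0 \<le> (\<theta> - Q * \<bar>c i\<bar>)\<^sup>2 / (2 * \<theta> * Q)" using assms by simp
    also have "\<dots> = \<theta> / (2 * Q) + Q / (2 * \<theta>) * (c i)\<^sup>2 - \<bar>c i\<bar>"
      using assms by (simp add: field_simps power2_eq_square)
    finally show ?thesis by simp
  qed
  then have "(\<Sum>i\<in>A. \<bar>c i\<bar>) \<le> (\<Sum>i\<in>A. \<theta> / (2 * Q) + Q / (2 * \<theta>) * (c i)\<^sup>2)"
    by (intro sum_mono)
  also have "\<dots> = real (card A) * (\<theta> / (2 * Q)) + Q / (2 * \<theta>) * (\<Sum>i\<in>A. (c i)\<^sup>2)"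
    by (simp add: sum.distrib sum_distrib_left)
  also have "real (card A) * (\<theta> / (2 * Q)) \<le> Q * (\<theta> / (2 * Q))"
    using assms by (intro mult_right_mono) auto
  also have "\<dots> = \<theta> / 2" using assms by simp
  finally show ?thesis by simp
qed

text \<open>The squared Frobenius norm of the covariance block between the assignments on
  \<open>S\<close> and on \<open>T\<close>.\<close>

definition cov_energy :: "nat \<Rightarrow> ensemble \<Rightarrow> nat set \<Rightarrow> nat set \<Rightarrow> real" where
  "cov_energy r Y S T = (\<Sum>\<alpha>\<in>S \<rightarrow>\<^sub>E {1..r}. \<Sum>\<beta>\<in>T \<rightarrow>\<^sub>E {1..r}. (ensemble_cov Y (S, \<alpha>) (T, \<beta>))\<^sup>2)"

locale ensemble_structure =
  fixes n r t :: nat and Y :: ensemble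
  assumes local: "local_ensemble n r t Y"
begin

lemma supp: "S \<subseteq> {1..n} \<Longrightarrow> card S \<le> t \<Longrightarrow> set_pmf (Y S) \<subseteq> S \<rightarrow>\<^sub>E {1..r}"
  using local unfolding local_ensemble_def by blast

lemma consistent: "S \<subseteq> {1..n} \<Longrightarrow> card S \<le> t \<Longrightarrow> T \<subseteq> S \<Longrightarrow> map_pmf (\<lambda>f. restrict f T) (Y S) = Y T"
  using local unfolding local_ensemble_def by blast

lemma prob_restrict:
  assumes "S \<subseteq> {1..n}" "card S \<le> t" "T \<subseteq> S"
  shows "measure_pmf.prob (Y S) {f. restrict f T = \<alpha>} = pmf (Y T) \<alpha>"
  unfolding consistent[OF assms, symmetric] pmf_map by (simp add: vimage_def)

lemma pmf_marginal: "x \<in> {1..n} \<Longrightarrow> 1 \<le> t \<Longrightarrow> pmf (marginal Y x) b = pmf (Y {x}) (\<lambda>_\<in>{x}. b)"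
proof -
  assume x: "x \<in> {1..n}" "1 \<le> t"
  have "pmf (marginal Y x) b = measure_pmf.prob (Y {x}) {f. f x = b}"
    by (simp add: marginal_def pmf_map vimage_def)
  also have "\<dots> = measure_pmf.prob (Y {x}) {f. restrict f {x} = (\<lambda>_\<in>{x}. b)}"
    by (intro arg_cong[where f = "measure_pmf.prob _"] Collect_cong) (auto simp: fun_eq_iff restrict_def)
  also have "\<dots> = pmf (Y {x}) (\<lambda>_\<in>{x}. b)"
    using x by (intro prob_restrict) auto
  finally show ?thesis .
qed

lemma ensemble_cov_eq:
  assumes "S \<union> T \<subseteq> {1..n}" "card (S \<union> T) \<le> t"
  shows "ensemble_cov Y (S, \<alpha>) (T, \<beta>)
    = measure_pmf.prob (Y (S \<union> T)) {f. restrict f S = \<alpha> \<and> restrict f T = \<beta>} - pmf (Y S) \<alpha> * pmf (Y T) \<beta>"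
  unfolding ensemble_cov_def split covariance_of_bool
  using prob_restrict[OF assms, of S] prob_restrict[OF assms, of T] by simp

lemma sum_ensemble_variance_le:
  assumes "S \<subseteq> {1..n}" "card S \<le> t"
  shows "(\<Sum>\<alpha>\<in>S \<rightarrow>\<^sub>E {1..r}. ensemble_cov Y (S, \<alpha>) (S, \<alpha>)) \<le> 1"
proof -
  have "(\<Sum>\<alpha>\<in>S \<rightarrow>\<^sub>E {1..r}. ensemble_cov Y (S, \<alpha>) (S, \<alpha>)) \<le> (\<Sum>\<alpha>\<in>S \<rightarrow>\<^sub>E {1..r}. pmf (Y S) \<alpha>)"
    using assms prob_restrict[of S S] by (intro sum_mono) (simp add: ensemble_cov_eq)
  also have "\<dots> = 1"
    using supp[OF assms] assms by (intro sum_pmf_eq_1) (auto intro: finite_PiE finite_subset)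
  finally show ?thesis .
qed

text \<open>Each coordinate of a value in the joint support lies in the support of its marginal.
  This makes counting by \<open>q\<close> possible although values range over
  \<open>{1..r}\<close>.\<close>

lemma card_supp_le:
  assumes q: "\<And>j. j \<in> {1..n} \<Longrightarrow> card (set_pmf (marginal Y j)) \<le> q"
    and S: "S \<subseteq> {1..n}" "card S \<le> t" and t: "1 \<le> t"
  shows "card (set_pmf (Y S)) \<le> q ^ card S"
proof -
  have fin: "finite S" using S finite_subset by blast
  have finm: "finite (set_pmf (marginal Y j))" if "j \<in> S" for j
  proof -
    have "set_pmf (Y {j}) \<subseteq> {j} \<rightarrow>\<^sub>E {1..r}" using that S t by (intro supp) auto
    then have "finite (set_pmf (Y {j}))" by (rule finite_subset) (simp add: finite_PiE)
    then show ?thesis by (simp add: marginal_def)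
  qed
  have "set_pmf (Y S) \<subseteq> (\<Pi>\<^sub>E j\<in>S. set_pmf (marginal Y j))"
  proof
    fix f assume f: "f \<in> set_pmf (Y S)"
    have "f j \<in> set_pmf (marginal Y j)" if j: "j \<in> S" for j
    proof -
      have "restrict f {j} \<in> set_pmf (Y {j})"
        using f j consistent[OF S, of "{j}"] by (metis empty_subsetI image_eqI insert_subset set_map_pmf)
      then have "restrict f {j} j \<in> set_pmf (marginal Y j)"
        unfolding marginal_def set_map_pmf by (rule imageI)
      then show ?thesis by simp
    qed
    then show "f \<in> (\<Pi>\<^sub>E j\<in>S. set_pmf (marginal Y j))" using supp[OF S] f by auto
  qed
  then have "card (set_pmf (Y S)) \<le> card (\<Pi>\<^sub>E j\<in>S. set_pmf (marginal Y j))"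
    by (intro card_mono finite_PiE fin finm)
  also have "\<dots> = (\<Prod>j\<in>S. card (set_pmf (marginal Y j)))" by (rule card_PiE[OF fin])
  also have "\<dots> \<le> (\<Prod>j\<in>S. q)" using q S by (intro prod_mono) auto
  finally show ?thesis by simp
qed

text \<open>A covariance vanishes unless both assignments are in the support, which leaves at most
  \<open>q ^ card s * q\<close> \<le> \<open>q ^ k\<close> terms for the AM-GM bound.\<close>

lemma sum_abs_cov_le:
  assumes q: "\<And>j. j \<in> {1..n} \<Longrightarrow> card (set_pmf (marginal Y j)) \<le> q" and q1: "1 \<le> q"
    and s: "s \<subseteq> {1..n}" and x: "x \<in> {1..n}" and k: "card s < k" "k \<le> t" and \<theta>: "0 < \<theta>"
  shows "(\<Sum>\<alpha>\<in>s \<rightarrow>\<^sub>E {1..r}. \<Sum>\<beta>\<in>{x} \<rightarrow>\<^sub>E {1..r}. \<bar>ensemble_cov Y (s, \<alpha>) ({x}, \<beta>)\<bar>)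
    \<le> \<theta> / 2 + real q ^ k / (2 * \<theta>) * cov_energy r Y s {x}"
proof -
  have fin: "finite s" using s finite_subset by blast
  have sx: "s \<union> {x} \<subseteq> {1..n}" "card (s \<union> {x}) \<le> t"
    using s x k fin by (auto simp: card_insert_if)
  have sub: "set_pmf (Y s) \<subseteq> s \<rightarrow>\<^sub>E {1..r}" "set_pmf (Y {x}) \<subseteq> {x} \<rightarrow>\<^sub>E {1..r}"
    using s x k by (intro supp; simp)+
  have zero: "ensemble_cov Y (s, \<alpha>) ({x}, \<beta>) = 0" if "\<alpha> \<notin> set_pmf (Y s) \<or> \<beta> \<notin> set_pmf (Y {x})" for \<alpha> \<beta>
  proof -
    have e1: "measure_pmf.prob (Y (s \<union> {x})) {f. restrict f s = \<alpha>} = pmf (Y s) \<alpha>"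
      by (rule prob_restrict[OF sx]) auto
    have e2: "measure_pmf.prob (Y (s \<union> {x})) {f. restrict f {x} = \<beta>} = pmf (Y {x}) \<beta>"
      by (rule prob_restrict[OF sx]) auto
    have "measure_pmf.prob (Y (s \<union> {x})) {f. restrict f s = \<alpha> \<and> restrict f {x} = \<beta>} \<le> pmf (Y s) \<alpha>"
      unfolding e1[symmetric] by (intro measure_pmf.finite_measure_mono) auto
    moreover have "measure_pmf.prob (Y (s \<union> {x})) {f. restrict f s = \<alpha> \<and> restrict f {x} = \<beta>} \<le> pmf (Y {x}) \<beta>"
      unfolding e2[symmetric] by (intro measure_pmf.finite_measure_mono) auto
    ultimately have "measure_pmf.prob (Y (s \<union> {x})) {f. restrict f s = \<alpha> \<and> restrict f {x} = \<beta>} \<le> 0"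
      using that by (auto simp: set_pmf_iff)
    then show ?thesis using that unfolding ensemble_cov_eq[OF sx] by (auto simp: set_pmf_iff measure_le_0_iff)
  qed
  have nz: "\<alpha> \<in> set_pmf (Y s) \<and> \<beta> \<in> set_pmf (Y {x})" if "ensemble_cov Y (s, \<alpha>) ({x}, \<beta>) \<noteq> 0" for \<alpha> \<beta>
    using zero that by blast
  define A where "A = set_pmf (Y s) \<times> set_pmf (Y {x})"
  define c where "c = (\<lambda>(\<alpha>, \<beta>). ensemble_cov Y (s, \<alpha>) ({x}, \<beta>))"
  have finP: "finite ((s \<rightarrow>\<^sub>E {1..r}) \<times> ({x} \<rightarrow>\<^sub>E {1..r}))" using fin by (auto intro!: finite_PiE)
  have A: "A \<subseteq> (s \<rightarrow>\<^sub>E {1..r}) \<times> ({x} \<rightarrow>\<^sub>E {1..r})" using sub by (auto simp: A_def)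
  have "card A \<le> q ^ card s * q"
    unfolding A_def card_cartesian_product
    using card_supp_le[OF q s] card_supp_le[OF q, of "{x}"] x k by (intro mult_mono) auto
  also have "\<dots> \<le> q ^ k"
    using k q1 power_increasing[of "Suc (card s)" k q] by (simp add: mult.commute)
  finally have "real (card A) \<le> real q ^ k" by (metis of_nat_le_iff of_nat_power)
  then have "(\<Sum>i\<in>A. \<bar>c i\<bar>) \<le> \<theta> / 2 + real q ^ k / (2 * \<theta>) * (\<Sum>i\<in>A. (c i)\<^sup>2)"
    using q1 \<theta> finite_subset[OF A finP] by (intro sum_abs_le_square) auto
  also have "(\<Sum>i\<in>A. \<bar>c i\<bar>) = (\<Sum>i\<in>(s \<rightarrow>\<^sub>E {1..r}) \<times> ({x} \<rightarrow>\<^sub>E {1..r}). \<bar>c i\<bar>)"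
    using A finP by (intro sum.mono_neutral_left) (auto simp: c_def A_def dest: nz)
  also have "(\<Sum>i\<in>A. (c i)\<^sup>2) = (\<Sum>i\<in>(s \<rightarrow>\<^sub>E {1..r}) \<times> ({x} \<rightarrow>\<^sub>E {1..r}). (c i)\<^sup>2)"
    using A finP by (intro sum.mono_neutral_left) (auto simp: c_def A_def dest: nz)
  finally show ?thesis
    by (simp add: c_def cov_energy_def sum.cartesian_product split_def)
qed

text \<open>One telescoping step. The joint probability minus the product is (P(\<alpha>) -
  R(\<alpha>)) m(b) plus a covariance, where P is the law on \<open>s\<close>, R the product of
  marginals on \<open>s\<close> and m the law of \<open>x\<close>; since the m(b) sum to at most 1,
  the first part costs no more than the distance on \<open>s\<close>.\<close>

lemma l1_dist_insert:
  assumes s: "s \<subseteq> {1..n}" and x: "x \<in> {1..n} - s" and t: "card s < t"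
  shows "l1_dist r (insert x s) (Y (insert x s)) (product_of_marginals Y (insert x s))
    \<le> l1_dist r s (Y s) (product_of_marginals Y s)
      + (\<Sum>\<alpha>\<in>s \<rightarrow>\<^sub>E {1..r}. \<Sum>\<beta>\<in>{x} \<rightarrow>\<^sub>E {1..r}. \<bar>ensemble_cov Y (s, \<alpha>) ({x}, \<beta>)\<bar>)"
proof -
  have fin: "finite s" using s finite_subset by blast
  have sx: "s \<union> {x} \<subseteq> {1..n}" "card (s \<union> {x}) \<le> t"
    using s x t fin by (auto simp: card_insert_if)
  have sx': "insert x s \<subseteq> {1..n}" "card (insert x s) \<le> t" using sx by auto
  have xs: "x \<notin> s" using x by simp
  define m where "m b = pmf (marginal Y x) b" for b
  define R where "R \<alpha> = pmf (product_of_marginals Y s) \<alpha>" for \<alpha>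
  have sum_insert: "(\<Sum>f\<in>insert x s \<rightarrow>\<^sub>E {1..r}. F f) = (\<Sum>\<alpha>\<in>s \<rightarrow>\<^sub>E {1..r}. \<Sum>b\<in>{1..r}. F (\<alpha>(x := b)))" for F :: "(nat \<Rightarrow> nat) \<Rightarrow> real"
  proof -
    have inj: "inj_on (\<lambda>(y, g). g(x := y)) ({1..r} \<times> (s \<rightarrow>\<^sub>E {1..r}))"
      using xs by (rule inj_combinator)
    have "(\<Sum>f\<in>insert x s \<rightarrow>\<^sub>E {1..r}. F f) = (\<Sum>(b, \<alpha>)\<in>{1..r} \<times> (s \<rightarrow>\<^sub>E {1..r}). F (\<alpha>(x := b)))"
      unfolding PiE_insert_eq by (subst sum.reindex[OF inj]) (simp add: split_def)
    also have "\<dots> = (\<Sum>b\<in>{1..r}. \<Sum>\<alpha>\<in>s \<rightarrow>\<^sub>E {1..r}. F (\<alpha>(x := b)))"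
      by (rule sum.cartesian_product[symmetric])
    finally show ?thesis by (subst sum.swap)
  qed
  have prod: "pmf (product_of_marginals Y (insert x s)) (\<alpha>(x := b)) = R \<alpha> * m b" if \<alpha>: "\<alpha> \<in> s \<rightarrow>\<^sub>E {1..r}" for \<alpha> b
  proof -
    have ext: "\<alpha> y = undefined" if "y \<notin> s" for y using \<alpha> that by auto
    have "pmf (product_of_marginals Y (insert x s)) (\<alpha>(x := b)) = (\<Prod>y\<in>insert x s. pmf (marginal Y y) ((\<alpha>(x := b)) y))"
      unfolding product_of_marginals_def using fin by (subst pmf_Pi) (auto simp: ext)
    also have "\<dots> = m b * (\<Prod>y\<in>s. pmf (marginal Y y) (\<alpha> y))"
      using fin xs by (subst prod.insert) (auto simp: m_def intro!: prod.cong)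
    also have "(\<Prod>y\<in>s. pmf (marginal Y y) (\<alpha> y)) = R \<alpha>"
      unfolding R_def product_of_marginals_def using fin by (subst pmf_Pi) (auto simp: ext)
    finally show ?thesis by (simp only: mult.commute)
  qed
  have cov: "ensemble_cov Y (s, \<alpha>) ({x}, (\<lambda>_\<in>{x}. b)) = pmf (Y (insert x s)) (\<alpha>(x := b)) - pmf (Y s) \<alpha> * m b"
    if \<alpha>: "\<alpha> \<in> s \<rightarrow>\<^sub>E {1..r}" for \<alpha> b
  proof -
    have "measure_pmf.prob (Y (s \<union> {x})) {f. restrict f s = \<alpha> \<and> restrict f {x} = (\<lambda>_\<in>{x}. b)}
        = measure_pmf.prob (Y (insert x s)) {\<alpha>(x := b)}"
    proof (unfold insert_is_Un[of x s] Un_commute[of s], rule measure_pmf.finite_measure_eq_AE, goal_cases)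
      case 1
      have "(restrict f s = \<alpha> \<and> restrict f {x} = (\<lambda>_\<in>{x}. b)) = (f = \<alpha>(x := b))"
        if "f \<in> set_pmf (Y (insert x s))" for f
      proof -
        have "f \<in> insert x s \<rightarrow>\<^sub>E {1..r}" using supp[OF sx'] that by auto
        then show ?thesis using \<alpha> xs by (auto simp: fun_eq_iff restrict_def PiE_iff extensional_def) metis
      qed
      then show ?case by (auto simp: AE_measure_pmf_iff)
    qed auto
    then show ?thesis
      unfolding ensemble_cov_eq[OF sx] using x t by (simp add: m_def pmf_marginal measure_pmf_single)
  qed
  have sum_x: "(\<Sum>\<beta>\<in>{x} \<rightarrow>\<^sub>E {1..r}. F \<beta>) = (\<Sum>b\<in>{1..r}. F (\<lambda>_\<in>{x}. b))" for F :: "(nat \<Rightarrow> nat) \<Rightarrow> real"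
    by (rule sum.reindex_bij_witness[where i = "\<lambda>b. \<lambda>_\<in>{x}. b" and j = "\<lambda>\<beta>. \<beta> x"])
      (auto simp: fun_eq_iff PiE_iff extensional_def intro!: arg_cong[where f = F])
  have m: "(\<Sum>b\<in>{1..r}. m b) \<le> 1"
    unfolding m_def using measure_pmf.prob_le_1[of "marginal Y x" "{1..r}"] by (subst (asm) measure_measure_pmf_finite) auto
  have "l1_dist r (insert x s) (Y (insert x s)) (product_of_marginals Y (insert x s))
      = (\<Sum>\<alpha>\<in>s \<rightarrow>\<^sub>E {1..r}. \<Sum>b\<in>{1..r}. \<bar>pmf (Y (insert x s)) (\<alpha>(x := b)) - R \<alpha> * m b\<bar>)"
    unfolding l1_dist_def sum_insert by (intro sum.cong refl) (simp add: prod)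
  also have "\<dots> \<le> (\<Sum>\<alpha>\<in>s \<rightarrow>\<^sub>E {1..r}. \<Sum>b\<in>{1..r}. \<bar>pmf (Y s) \<alpha> - R \<alpha>\<bar> * m b + \<bar>ensemble_cov Y (s, \<alpha>) ({x}, (\<lambda>_\<in>{x}. b))\<bar>)"
  proof (intro sum_mono)
    fix \<alpha> b assume \<alpha>: "\<alpha> \<in> s \<rightarrow>\<^sub>E {1..r}"
    have "pmf (Y (insert x s)) (\<alpha>(x := b)) - R \<alpha> * m b
        = (pmf (Y s) \<alpha> - R \<alpha>) * m b + ensemble_cov Y (s, \<alpha>) ({x}, (\<lambda>_\<in>{x}. b))"
      using cov[OF \<alpha>] by (simp add: algebra_simps)
    then show "\<bar>pmf (Y (insert x s)) (\<alpha>(x := b)) - R \<alpha> * m b\<bar>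
        \<le> \<bar>pmf (Y s) \<alpha> - R \<alpha>\<bar> * m b + \<bar>ensemble_cov Y (s, \<alpha>) ({x}, (\<lambda>_\<in>{x}. b))\<bar>"
      using abs_triangle_ineq[of "(pmf (Y s) \<alpha> - R \<alpha>) * m b"] by (simp add: abs_mult m_def)
  qed
  also have "\<dots> = (\<Sum>\<alpha>\<in>s \<rightarrow>\<^sub>E {1..r}. \<bar>pmf (Y s) \<alpha> - R \<alpha>\<bar> * (\<Sum>b\<in>{1..r}. m b))
      + (\<Sum>\<alpha>\<in>s \<rightarrow>\<^sub>E {1..r}. \<Sum>\<beta>\<in>{x} \<rightarrow>\<^sub>E {1..r}. \<bar>ensemble_cov Y (s, \<alpha>) ({x}, \<beta>)\<bar>)"
    by (simp only: sum.distrib sum_distrib_left sum_x)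
  also have "(\<Sum>\<alpha>\<in>s \<rightarrow>\<^sub>E {1..r}. \<bar>pmf (Y s) \<alpha> - R \<alpha>\<bar> * (\<Sum>b\<in>{1..r}. m b)) \<le> (\<Sum>\<alpha>\<in>s \<rightarrow>\<^sub>E {1..r}. \<bar>pmf (Y s) \<alpha> - R \<alpha>\<bar> * 1)"
    using m by (intro sum_mono mult_left_mono) auto
  finally show ?thesis by (simp add: l1_dist_def R_def)
qed

end

section \<open>Correlation along faces of an expanding complex\<close>

context expanding_complex
begin

lemma edge_avg_sum: "edge_avg j (\<lambda>s x. \<Sum>p\<in>A. f p s x) = (\<Sum>p\<in>A. edge_avg j (f p))"
proof -
  have "(\<Sum>s\<in>level n j. \<Sum>x\<in>V - s. w (Suc j) (insert x s) * (\<Sum>p\<in>A. f p s x))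
      = (\<Sum>s\<in>level n j. \<Sum>p\<in>A. \<Sum>x\<in>V - s. w (Suc j) (insert x s) * f p s x)"
    unfolding sum_distrib_left by (intro sum.cong refl sum.swap)
  also have "\<dots> = (\<Sum>p\<in>A. \<Sum>s\<in>level n j. \<Sum>x\<in>V - s. w (Suc j) (insert x s) * f p s x)"
    by (rule sum.swap)
  finally show ?thesis by (simp only: edge_avg_def sum_divide_distrib)
qed

lemma indep_avg_sum: "indep_avg j (\<lambda>s x. \<Sum>p\<in>A. f p s x) = (\<Sum>p\<in>A. indep_avg j (f p))"
proof -
  have "indep_avg j (\<lambda>s x. \<Sum>p\<in>A. f p s x)
      = (\<Sum>s\<in>level n j. \<Sum>p\<in>A. \<Sum>x\<in>V. w j s * w 1 {x} * f p s x)"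
    unfolding indep_avg_def sum_distrib_left by (intro sum.cong refl sum.swap)
  also have "\<dots> = (\<Sum>p\<in>A. \<Sum>s\<in>level n j. \<Sum>x\<in>V. w j s * w 1 {x} * f p s x)"
    by (rule sum.swap)
  finally show ?thesis by (simp only: indep_avg_def)
qed

lemma edge_avg_cong:
  assumes "\<And>s x. s \<in> level n j \<Longrightarrow> x \<in> V - s \<Longrightarrow> \<phi> s x = \<psi> s x"
  shows "edge_avg j \<phi> = edge_avg j \<psi>"
  using assms by (intro antisym edge_avg_mono) auto

lemma indep_avg_cong:
  assumes "\<And>s x. s \<in> level n j \<Longrightarrow> x \<in> V \<Longrightarrow> \<phi> s x = \<psi> s x"
  shows "indep_avg j \<phi> = indep_avg j \<psi>"
  unfolding indep_avg_def using assms by (intro sum.cong refl) simp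

lemma edge_avg_add: "edge_avg j (\<lambda>s x. \<phi> s x + \<psi> s x) = edge_avg j \<phi> + edge_avg j \<psi>"
  by (simp add: edge_avg_def distrib_left sum.distrib add_divide_distrib)

lemma edge_avg_cmult: "edge_avg j (\<lambda>s x. c * \<phi> s x) = c * edge_avg j \<phi>"
  by (simp add: edge_avg_def sum_distrib_left mult.left_commute)

lemma edge_avg_union:
  "edge_avg j (\<lambda>s x. F (insert x s)) = (\<Sum>t\<in>level n (Suc j). w (Suc j) t * F t)"
proof -
  have "(\<Sum>x\<in>t. F (insert x (t - {x}))) = real (Suc j) * F t" if "t \<in> level n (Suc j)" for t
  proof -
    have "(\<Sum>x\<in>t. F (insert x (t - {x}))) = (\<Sum>x\<in>t. F t)"
      by (intro sum.cong refl) (simp add: insert_absorb)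
    then show ?thesis using that by (simp add: level_def)
  qed
  then have "edge_avg j (\<lambda>s x. F (insert x s))
      = (\<Sum>t\<in>level n (Suc j). real (Suc j) * (w (Suc j) t * F t)) / real (Suc j)"
    unfolding edge_avg_faces by (intro arg_cong2[where f = divide] sum.cong refl) simp
  then show ?thesis by (simp add: sum_distrib_left[symmetric] del: of_nat_Suc)
qed

end

section \<open>Mixing applied to the Gram coordinates of squared covariances\<close>

definition psd_index :: "nat \<Rightarrow> nat \<Rightarrow> nat \<Rightarrow> (nat set \<times> (nat \<Rightarrow> nat)) set" where
  "psd_index n r t = {(S, \<alpha>). S \<subseteq> {1..n} \<and> 2 * card S \<le> t \<and> \<alpha> \<in> S \<rightarrow>\<^sub>E {1..r}}"

lemma finite_psd_index: "finite (psd_index n r t)"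
proof -
  have "psd_index n r t \<subseteq> Sigma (Pow {1..n}) (\<lambda>S. S \<rightarrow>\<^sub>E {1..r})"
    by (auto simp: psd_index_def)
  then show ?thesis
    by (rule finite_subset) (auto intro!: finite_SigmaI finite_PiE intro: finite_subset)
qed

text \<open>Squared covariances form the Schur square of a positive semidefinite matrix, hence a Gram
  matrix of the vectors \<open>\<Sum>\<alpha>. u (S, \<alpha>) \<otimes> u (S, \<alpha>)\<close>.\<close>
lemma cov_energy_gram:
  assumes psd: "psd_on (psd_index n r t) (ensemble_cov Y)"
    and local: "local_ensemble n r t Y"
  obtains U :: "nat set \<Rightarrow> nat \<times> nat \<Rightarrow> real" and A :: "(nat \<times> nat) set" where "finite A"
    "\<And>S T. S \<subseteq> {1..n} \<Longrightarrow> T \<subseteq> {1..n} \<Longrightarrow> 2 * card S \<le> t \<Longrightarrow> 2 * card T \<le> t \<Longrightarrow>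
      cov_energy r Y S T = (\<Sum>p\<in>A. U S p * U T p)"
    "\<And>S. S \<subseteq> {1..n} \<Longrightarrow> 2 * card S \<le> t \<Longrightarrow> (\<Sum>p\<in>A. (U S p)\<^sup>2) \<le> 1"
proof -
  interpret ensemble_structure n r t Y by unfold_locales (rule local)
  obtain u :: "nat set \<times> (nat \<Rightarrow> nat) \<Rightarrow> nat \<Rightarrow> real" and N
    where u: "\<forall>i\<in>psd_index n r t. \<forall>j\<in>psd_index n r t. ensemble_cov Y i j = (\<Sum>l<N. u i l * u j l)"
    using psd_gram[OF finite_psd_index psd] by (elim exE)
  define A where "A = {..<N} \<times> {..<N}"
  define U where "U S p = (\<Sum>\<alpha>\<in>S \<rightarrow>\<^sub>E {1..r}. u (S, \<alpha>) (fst p) * u (S, \<alpha>) (snd p))" for S p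
  have index: "(S, \<alpha>) \<in> psd_index n r t" if "S \<subseteq> {1..n}" "2 * card S \<le> t" "\<alpha> \<in> S \<rightarrow>\<^sub>E {1..r}" for S \<alpha>
    using that by (simp add: psd_index_def)
  have gram: "cov_energy r Y S T = (\<Sum>p\<in>A. U S p * U T p)"
    if S: "S \<subseteq> {1..n}" "2 * card S \<le> t" and T: "T \<subseteq> {1..n}" "2 * card T \<le> t" for S T
  proof -
    have "cov_energy r Y S T = (\<Sum>\<alpha>\<in>S \<rightarrow>\<^sub>E {1..r}. \<Sum>\<beta>\<in>T \<rightarrow>\<^sub>E {1..r}. \<Sum>p\<in>A.
        (u (S, \<alpha>) (fst p) * u (S, \<alpha>) (snd p)) * (u (T, \<beta>) (fst p) * u (T, \<beta>) (snd p)))"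
      unfolding cov_energy_def
    proof (intro sum.cong refl)
      fix \<alpha> \<beta> assume "\<alpha> \<in> S \<rightarrow>\<^sub>E {1..r}" "\<beta> \<in> T \<rightarrow>\<^sub>E {1..r}"
      then have "ensemble_cov Y (S, \<alpha>) (T, \<beta>) = (\<Sum>l<N. u (S, \<alpha>) l * u (T, \<beta>) l)"
        using u index S T by blast
      then show "(ensemble_cov Y (S, \<alpha>) (T, \<beta>))\<^sup>2 = (\<Sum>p\<in>A.
        (u (S, \<alpha>) (fst p) * u (S, \<alpha>) (snd p)) * (u (T, \<beta>) (fst p) * u (T, \<beta>) (snd p)))"
        by (simp add: power2_eq_square sum_product A_def sum.cartesian_product split_def mult_ac)
    qed
    also have "\<dots> = (\<Sum>\<alpha>\<in>S \<rightarrow>\<^sub>E {1..r}. \<Sum>p\<in>A. \<Sum>\<beta>\<in>T \<rightarrow>\<^sub>E {1..r}.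
        (u (S, \<alpha>) (fst p) * u (S, \<alpha>) (snd p)) * (u (T, \<beta>) (fst p) * u (T, \<beta>) (snd p)))"
      by (intro sum.cong refl sum.swap)
    also have "\<dots> = (\<Sum>p\<in>A. \<Sum>\<alpha>\<in>S \<rightarrow>\<^sub>E {1..r}. \<Sum>\<beta>\<in>T \<rightarrow>\<^sub>E {1..r}.
        (u (S, \<alpha>) (fst p) * u (S, \<alpha>) (snd p)) * (u (T, \<beta>) (fst p) * u (T, \<beta>) (snd p)))"
      by (rule sum.swap)
    finally show ?thesis by (simp only: U_def sum_product)
  qed
  have "(\<Sum>p\<in>A. (U S p)\<^sup>2) \<le> 1" if S: "S \<subseteq> {1..n}" "2 * card S \<le> t" for S
  proof -
    let ?v = "\<lambda>\<alpha>. ensemble_cov Y (S, \<alpha>) (S, \<alpha>)"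
    have v: "?v \<alpha> = (\<Sum>l<N. (u (S, \<alpha>) l)\<^sup>2)" if "\<alpha> \<in> S \<rightarrow>\<^sub>E {1..r}" for \<alpha>
      using u index[OF S that] by (simp add: power2_eq_square)
    have "(\<Sum>p\<in>A. (U S p)\<^sup>2) = cov_energy r Y S S"
      using gram[OF S S] by (simp add: power2_eq_square)
    \<comment> \<open>Cauchy-Schwarz for the Gram vectors: a squared covariance is at most the
      product of the variances, and the variances of all indicators on \<open>S\<close> sum to at
      most 1.\<close>
    also have "\<dots> \<le> (\<Sum>\<alpha>\<in>S \<rightarrow>\<^sub>E {1..r}. \<Sum>\<beta>\<in>S \<rightarrow>\<^sub>E {1..r}. ?v \<alpha> * ?v \<beta>)"
      unfolding cov_energy_def
    proof (intro sum_mono)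
      fix \<alpha> \<beta> assume ab: "\<alpha> \<in> S \<rightarrow>\<^sub>E {1..r}" "\<beta> \<in> S \<rightarrow>\<^sub>E {1..r}"
      then have "ensemble_cov Y (S, \<alpha>) (S, \<beta>) = (\<Sum>l<N. u (S, \<alpha>) l * u (S, \<beta>) l)"
        using u index S by blast
      then show "(ensemble_cov Y (S, \<alpha>) (S, \<beta>))\<^sup>2 \<le> ?v \<alpha> * ?v \<beta>"
        using Cauchy_Schwarz_ineq_sum[of "u (S, \<alpha>)" "u (S, \<beta>)" "{..<N}"] by (simp only: v[OF ab(1)] v[OF ab(2)])
    qed
    also have "\<dots> = (\<Sum>\<alpha>\<in>S \<rightarrow>\<^sub>E {1..r}. ?v \<alpha>)\<^sup>2"
      by (simp add: power2_eq_square sum_product)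
    also have "\<dots> \<le> 1"
    proof (rule power_le_one)
      show "0 \<le> (\<Sum>\<alpha>\<in>S \<rightarrow>\<^sub>E {1..r}. ?v \<alpha>)"
        using v by (intro sum_nonneg) (simp add: sum_nonneg)
      show "(\<Sum>\<alpha>\<in>S \<rightarrow>\<^sub>E {1..r}. ?v \<alpha>) \<le> 1"
        using S by (intro sum_ensemble_variance_le) auto
    qed
    finally show ?thesis .
  qed
  then show ?thesis using that[of A U] gram by (simp add: A_def)
qed

text \<open>In use, \<open>Y\<close> is an already conditioned ensemble and \<open>t\<close> its
  remaining locality; 2k \<le> t puts all sets of size at most k into the PSD index.\<close>

locale psd_expanding_complex =
  expanding_complex n k X P \<gamma> + ensemble_structure n r t Y
  for n k X P \<gamma> r t Y +
  assumes psd: "psd_on (psd_index n r t) (ensemble_cov Y)"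
    and t: "2 * k \<le> t"
begin

text \<open>\<open>expander_mixing\<close> is applied to each Gram coordinate. The Gram vectors have
  norm at most 1, so both averaged norms, summed over all coordinates, are at most 1, and their half
  sum is too.\<close>

lemma edge_cov_energy_le:
  assumes j: "j < k"
  shows "edge_avg j (\<lambda>s x. cov_energy r Y s {x})
    \<le> indep_avg j (\<lambda>s x. cov_energy r Y s {x}) + sqrt (real j) * \<gamma>"
proof -
  obtain U :: "nat set \<Rightarrow> nat \<times> nat \<Rightarrow> real" and A :: "(nat \<times> nat) set" where A: "finite A"
    and gram: "\<And>S T. S \<subseteq> {1..n} \<Longrightarrow> T \<subseteq> {1..n} \<Longrightarrow> 2 * card S \<le> t \<Longrightarrow> 2 * card T \<le> t \<Longrightarrow>
      cov_energy r Y S T = (\<Sum>p\<in>A. U S p * U T p)"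
    and norm: "\<And>S. S \<subseteq> {1..n} \<Longrightarrow> 2 * card S \<le> t \<Longrightarrow> (\<Sum>p\<in>A. (U S p)\<^sup>2) \<le> 1"
    by (rule cov_energy_gram[OF psd local]) (rule that)
  have s: "s \<subseteq> {1..n}" "2 * card s \<le> t" if "s \<in> level n j" for s
    using that j t by (auto simp: level_def)
  have x: "{x} \<subseteq> {1..n}" "2 * card {x} \<le> t" if "x \<in> V" for x
    using that j t by auto
  have total: "(\<Sum>p\<in>A. \<Sum>i\<in>I. m i * (U (S i) p)\<^sup>2) \<le> 1"
    if "\<And>i. i \<in> I \<Longrightarrow> S i \<subseteq> {1..n} \<and> 2 * card (S i) \<le> t" "\<And>i. i \<in> I \<Longrightarrow> 0 \<le> m i" "sum m I = 1"
    for I :: "'i set" and m S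
  proof -
    have "(\<Sum>p\<in>A. \<Sum>i\<in>I. m i * (U (S i) p)\<^sup>2) = (\<Sum>i\<in>I. m i * (\<Sum>p\<in>A. (U (S i) p)\<^sup>2))"
      unfolding sum_distrib_left by (rule sum.swap)
    also have "\<dots> \<le> (\<Sum>i\<in>I. m i * 1)"
      using that norm by (intro sum_mono mult_left_mono) auto
    finally show ?thesis using that by simp
  qed
  have one: "(\<Sum>x\<in>V. w 1 {x}) = 1"
    using w_sum[of 1] j by (simp add: level_1 sum.reindex)
  have "edge_avg j (\<lambda>s x. cov_energy r Y s {x}) - indep_avg j (\<lambda>s x. cov_energy r Y s {x})
      = (\<Sum>p\<in>A. edge_avg j (\<lambda>s x. U s p * U {x} p) - indep_avg j (\<lambda>s x. U s p * U {x} p))"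
  proof -
    have "edge_avg j (\<lambda>s x. cov_energy r Y s {x}) = edge_avg j (\<lambda>s x. \<Sum>p\<in>A. U s p * U {x} p)"
      using s x by (intro edge_avg_cong gram) auto
    moreover have "indep_avg j (\<lambda>s x. cov_energy r Y s {x}) = indep_avg j (\<lambda>s x. \<Sum>p\<in>A. U s p * U {x} p)"
      using s x by (intro indep_avg_cong gram) auto
    ultimately show ?thesis by (simp only: edge_avg_sum indep_avg_sum sum_subtractf)
  qed
  also have "\<dots> \<le> (\<Sum>p\<in>A. sqrt (real j) * \<gamma> *
      ((\<Sum>s\<in>level n j. w j s * (U s p)\<^sup>2) + (\<Sum>x\<in>V. w 1 {x} * (U {x} p)\<^sup>2)) / 2)"
    by (intro sum_mono expander_mixing j)
  also have "\<dots> = sqrt (real j) * \<gamma> *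
      ((\<Sum>p\<in>A. \<Sum>s\<in>level n j. w j s * (U s p)\<^sup>2) + (\<Sum>p\<in>A. \<Sum>x\<in>V. w 1 {x} * (U {x} p)\<^sup>2)) / 2"
    by (simp only: sum.distrib[symmetric] sum_distrib_left sum_divide_distrib)
  also have "\<dots> \<le> sqrt (real j) * \<gamma> * (1 + 1) / 2"
    using \<gamma> j s x one w_sum[of j]
    by (intro divide_right_mono mult_left_mono add_mono total[of _ "\<lambda>s. s"] total[of _ "\<lambda>x. {x}"]) auto
  finally show ?thesis by simp
qed

text \<open>A random face of size j+1 is a random face of size j plus the marked vertex, so each
  level pays for one telescoping step, averaged by \<open>edge_avg\<close> and moved to independent
  pairs by mixing.\<close>

lemma expected_l1_dist_le:
  assumes q: "\<And>j. j \<in> {1..n} \<Longrightarrow> card (set_pmf (marginal Y j)) \<le> q" and q1: "1 \<le> q"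
    and \<theta>: "0 < \<theta>" and i: "i \<le> k"
  shows "(\<Sum>s\<in>level n i. w i s * l1_dist r s (Y s) (product_of_marginals Y s))
    \<le> (\<Sum>j<i. \<theta> / 2 + real q ^ k / (2 * \<theta>) *
        (indep_avg j (\<lambda>s x. cov_energy r Y s {x}) + sqrt (real j) * \<gamma>))"
  using i
proof (induction i)
  case 0
  have "set_pmf (Y {}) \<subseteq> {} \<rightarrow>\<^sub>E {1..r}" by (rule supp) auto
  then have "Y {} = return_pmf (\<lambda>_. undefined)"
    by (simp add: set_pmf_subset_singleton)
  then show ?case by (simp add: l1_dist_def product_of_marginals_def)
next
  case (Suc j)
  define \<delta> where "\<delta> s = l1_dist r s (Y s) (product_of_marginals Y s)" for s
  define c where "c = real q ^ k / (2 * \<theta>)"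
  have c: "0 \<le> c" using \<theta> by (simp add: c_def)
  have j: "j < k" using Suc.prems by simp
  have "(\<Sum>t\<in>level n (Suc j). w (Suc j) t * \<delta> t) = edge_avg j (\<lambda>s x. \<delta> (insert x s))"
    by (rule edge_avg_union[symmetric])
  also have "\<dots> \<le> edge_avg j (\<lambda>s x. \<delta> s + (\<theta> / 2 + c * cov_energy r Y s {x}))"
  proof (rule edge_avg_mono)
    fix s x assume s: "s \<in> level n j" and x: "x \<in> V - s"
    have s': "s \<subseteq> {1..n}" "card s = j" using s by (auto simp: level_def)
    have "\<delta> (insert x s) \<le> \<delta> s + (\<Sum>\<alpha>\<in>s \<rightarrow>\<^sub>E {1..r}. \<Sum>\<beta>\<in>{x} \<rightarrow>\<^sub>E {1..r}. \<bar>ensemble_cov Y (s, \<alpha>) ({x}, \<beta>)\<bar>)"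
      unfolding \<delta>_def using s' x j t by (intro l1_dist_insert) auto
    also have "(\<Sum>\<alpha>\<in>s \<rightarrow>\<^sub>E {1..r}. \<Sum>\<beta>\<in>{x} \<rightarrow>\<^sub>E {1..r}. \<bar>ensemble_cov Y (s, \<alpha>) ({x}, \<beta>)\<bar>)
        \<le> \<theta> / 2 + c * cov_energy r Y s {x}"
      unfolding c_def using q q1 s' x j t \<theta> by (intro sum_abs_cov_le) auto
    finally show "\<delta> (insert x s) \<le> \<delta> s + (\<theta> / 2 + c * cov_energy r Y s {x})" by simp
  qed
  also have "\<dots> = (\<Sum>s\<in>level n j. w j s * \<delta> s) + (\<theta> / 2 + c * edge_avg j (\<lambda>s x. cov_energy r Y s {x}))"
    using edge_avg_fst[OF j, of "\<lambda>_. \<theta> / 2"] w_sum[of j] j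
    by (simp add: edge_avg_add edge_avg_cmult edge_avg_fst sum_distrib_right[symmetric] sum_divide_distrib[symmetric])
  also have "\<dots> \<le> (\<Sum>j<j. \<theta> / 2 + c * (indep_avg j (\<lambda>s x. cov_energy r Y s {x}) + sqrt (real j) * \<gamma>))
      + (\<theta> / 2 + c * (indep_avg j (\<lambda>s x. cov_energy r Y s {x}) + sqrt (real j) * \<gamma>))"
    using Suc.IH j c edge_cov_energy_le[OF j]
    unfolding \<delta>_def[symmetric] c_def[symmetric] by (intro add_mono mult_left_mono) auto
  finally show ?case
    unfolding \<delta>_def[symmetric] c_def[symmetric] by simp
qed

end

section \<open>Conditioning and the growth of energy\<close>

lemma prob_total:
  assumes "finite A" "\<And>f. f \<in> set_pmf p \<Longrightarrow> g f \<in> A"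
  shows "(\<Sum>a\<in>A. measure_pmf.prob p {f. Q f \<and> g f = a}) = measure_pmf.prob p {f. Q f}"
proof -
  have "(\<Sum>a\<in>A. measure_pmf.prob p {f. Q f \<and> g f = a}) = measure_pmf.prob p (\<Union>a\<in>A. {f. Q f \<and> g f = a})"
    using assms(1) by (intro measure_pmf.finite_measure_finite_Union[symmetric]) (auto simp: disjoint_family_on_def)
  also have "\<dots> = measure_pmf.prob p {f. Q f}"
    using assms(2) by (intro measure_pmf.finite_measure_eq_AE) (auto simp: AE_measure_pmf_iff)
  finally show ?thesis .
qed

lemma prob_cond_pmf:
  assumes "set_pmf p \<inter> s \<noteq> {}"
  shows "measure_pmf.prob (cond_pmf p s) A = measure_pmf.prob p (s \<inter> A) / measure_pmf.prob p s"
  unfolding cond_pmf.rep_eq[OF assms]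
  using emeasure_measure_pmf_not_zero[OF assms] by (intro measure_uniform_measure) auto

text \<open>Refining a partition raises the conditional second moment by the variance of the
  conditional mean, and a cell of the refinement weighs at most the cell containing it.\<close>
lemma second_moment_gain:
  fixes a c :: "'i \<Rightarrow> real"
  assumes fin: "finite I" and a: "\<And>i. i \<in> I \<Longrightarrow> 0 \<le> a i" and c: "\<And>i. i \<in> I \<Longrightarrow> a i = 0 \<Longrightarrow> c i = 0"
    and A: "sum a I = A" "0 < A" and C: "sum c I = C"
  shows "C\<^sup>2 / A + A * (\<Sum>i\<in>I. (c i / A - a i / A * (C / A))\<^sup>2) \<le> (\<Sum>i\<in>I. (c i)\<^sup>2 / a i)"
proof -
  have "2 * (C / A) * c i - (C / A)\<^sup>2 * a i + A * (c i / A - a i / A * (C / A))\<^sup>2 \<le> (c i)\<^sup>2 / a i" if i: "i \<in> I" for i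
  proof (cases "a i = 0")
    case True
    then show ?thesis using c[OF i] by simp
  next
    case False
    then have ai: "0 < a i" using a[OF i] by simp
    have le: "a i \<le> A" unfolding A(1)[symmetric] using i fin a by (intro member_le_sum) auto
    have "A * (c i / A - a i / A * (C / A))\<^sup>2 = (c i - a i * (C / A))\<^sup>2 / A"
      using A by (simp add: field_simps power2_eq_square)
    also have "\<dots> \<le> (c i - a i * (C / A))\<^sup>2 / a i"
      using le ai by (intro divide_left_mono) auto
    also have "\<dots> = (c i)\<^sup>2 / a i - 2 * (C / A) * c i + (C / A)\<^sup>2 * a i"
    proof -
      have "(c i - a i * d)\<^sup>2 / a i = (c i)\<^sup>2 / a i - 2 * d * c i + d\<^sup>2 * a i" for d
        using ai by (simp add: field_simps power2_eq_square)
      then show ?thesis .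
    qed
    finally show ?thesis by simp
  qed
  then have "(\<Sum>i\<in>I. 2 * (C / A) * c i - (C / A)\<^sup>2 * a i + A * (c i / A - a i / A * (C / A))\<^sup>2) \<le> (\<Sum>i\<in>I. (c i)\<^sup>2 / a i)"
    by (intro sum_mono)
  moreover have "(\<Sum>i\<in>I. 2 * (C / A) * c i - (C / A)\<^sup>2 * a i + A * (c i / A - a i / A * (C / A))\<^sup>2)
      = 2 * (C / A) * C - (C / A)\<^sup>2 * A + A * (\<Sum>i\<in>I. (c i / A - a i / A * (C / A))\<^sup>2)"
  proof -
    have "(\<Sum>i\<in>I. 2 * d * c i - d\<^sup>2 * a i + A * e i) = 2 * d * C - d\<^sup>2 * A + A * sum e I" for d e
      by (simp only: sum.distrib sum_subtractf sum_distrib_left[symmetric] A C)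
    then show ?thesis .
  qed
  moreover have "2 * (C / A) * C - (C / A)\<^sup>2 * A = C\<^sup>2 / A"
    using A by (simp add: field_simps power2_eq_square)
  ultimately show ?thesis by simp
qed

definition joint_prob :: "ensemble \<Rightarrow> nat set \<Rightarrow> (nat \<Rightarrow> nat) \<Rightarrow> nat set \<Rightarrow> (nat \<Rightarrow> nat) \<Rightarrow> real" where
  "joint_prob Y S \<alpha> T \<beta> = measure_pmf.prob (Y (S \<union> T)) {f. restrict f S = \<alpha> \<and> restrict f T = \<beta>}"

text \<open>The expected squared norm of the conditional law of \<open>x\<close> given the values on \<open>T\<close>.\<close>
definition cond_energy :: "nat \<Rightarrow> ensemble \<Rightarrow> nat set \<Rightarrow> nat \<Rightarrow> real" where
  "cond_energy r Y T x = (\<Sum>\<beta>\<in>T \<rightarrow>\<^sub>E {1..r}. \<Sum>b\<in>{x} \<rightarrow>\<^sub>E {1..r}. (joint_prob Y T \<beta> {x} b)\<^sup>2 / pmf (Y T) \<beta>)"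

lemma cov_energy_nonneg [simp]: "0 \<le> cov_energy r Y S T"
  unfolding cov_energy_def by (intro sum_nonneg) auto

lemma finite_assignments: "S \<subseteq> {1..n} \<Longrightarrow> finite (S \<rightarrow>\<^sub>E {1..r :: nat})" for S :: "nat set"
  by (auto intro!: finite_PiE intro: finite_subset)

context ensemble_structure
begin

lemma prob_superset:
  assumes R: "R \<subseteq> {1..n}" "card R \<le> t" "S \<subseteq> R"
  shows "measure_pmf.prob (Y S) {f. Q f} = measure_pmf.prob (Y R) {f. Q (restrict f S)}"
  unfolding consistent[OF R, symmetric] by (simp add: vimage_def)

lemma condition_event_nonempty:
  assumes R: "R \<subseteq> {1..n}" "card R \<le> t" "T \<subseteq> R" and \<beta>: "\<beta> \<in> set_pmf (Y T)"
  shows "set_pmf (Y R) \<inter> {f. restrict f T = \<beta>} \<noteq> {}"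
proof -
  have "\<beta> \<in> (\<lambda>f. restrict f T) ` set_pmf (Y R)"
    using \<beta> unfolding consistent[OF R, symmetric] by simp
  then show ?thesis by auto
qed

text \<open>All conditioned marginals inside a common set \<open>R\<close> can be read off the
  single law \<open>Y R\<close>, which makes the consistency of the conditioned ensemble
  visible.\<close>

lemma condition_ensemble_superset:
  assumes R: "R \<subseteq> {1..n}" "card R \<le> t" "S \<union> T \<subseteq> R" and \<beta>: "\<beta> \<in> set_pmf (Y T)"
  shows "condition_ensemble Y T \<beta> S = map_pmf (\<lambda>f. restrict f S) (cond_pmf (Y R) {f. restrict f T = \<beta>})"
proof -
  have ne: "set_pmf (Y R) \<inter> {f. restrict f T = \<beta>} \<noteq> {}"
    using R \<beta> by (intro condition_event_nonempty) auto
  have pre: "(\<lambda>f. restrict f (S \<union> T)) -` {f. restrict f T = \<beta>} = {f. restrict f T = \<beta>}"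
    by (simp add: vimage_def Int_absorb1)
  have "cond_pmf (Y (S \<union> T)) {f. restrict f T = \<beta>}
      = map_pmf (\<lambda>f. restrict f (S \<union> T)) (cond_pmf (Y R) {f. restrict f T = \<beta>})"
    unfolding consistent[OF R, symmetric] using ne pre by (subst cond_map_pmf) auto
  then show ?thesis
    by (simp add: condition_ensemble_def pmf.map_comp o_def Int_absorb1)
qed

lemma condition_prob:
  assumes R: "R \<subseteq> {1..n}" "card R \<le> t" "S \<union> T \<subseteq> R" and \<beta>: "\<beta> \<in> set_pmf (Y T)"
  shows "measure_pmf.prob (condition_ensemble Y T \<beta> S) {f. Q f}
    = measure_pmf.prob (Y R) {f. restrict f T = \<beta> \<and> Q (restrict f S)} / pmf (Y T) \<beta>"
proof -
  have ne: "set_pmf (Y R) \<inter> {f. restrict f T = \<beta>} \<noteq> {}"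
    using R \<beta> by (intro condition_event_nonempty) auto
  have "measure_pmf.prob (Y R) {f. restrict f T = \<beta>} = pmf (Y T) \<beta>"
    using R by (intro prob_restrict) auto
  then show ?thesis
    unfolding condition_ensemble_superset[OF R \<beta>] by (simp add: vimage_def prob_cond_pmf[OF ne] Int_def)
qed

lemma local_condition_ensemble:
  assumes T: "T \<subseteq> {1..n}" "card T \<le> t" and \<beta>: "\<beta> \<in> set_pmf (Y T)"
  shows "local_ensemble n r (t - card T) (condition_ensemble Y T \<beta>)"
  unfolding local_ensemble_def
proof (intro allI impI conjI)
  fix S assume S: "S \<subseteq> {1..n} \<and> card S \<le> t - card T"
  have R: "S \<union> T \<subseteq> {1..n}" "card (S \<union> T) \<le> t"
    using S T card_Un_le[of S T] by auto
  have eq: "condition_ensemble Y T \<beta> U = map_pmf (\<lambda>f. restrict f U) (cond_pmf (Y (S \<union> T)) {f. restrict f T = \<beta>})"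
    if "U \<subseteq> S" for U
    using that R \<beta> by (intro condition_ensemble_superset) auto
  have ne: "set_pmf (Y (S \<union> T)) \<inter> {f. restrict f T = \<beta>} \<noteq> {}"
    using R \<beta> by (intro condition_event_nonempty) auto
  have "set_pmf (condition_ensemble Y T \<beta> S) \<subseteq> (\<lambda>f. restrict f S) ` set_pmf (Y (S \<union> T))"
    unfolding eq[OF order_refl] using ne by auto
  also have "\<dots> \<subseteq> (\<lambda>f. restrict f S) ` (S \<union> T \<rightarrow>\<^sub>E {1..r})"
    by (intro image_mono supp R)
  also have "\<dots> \<subseteq> S \<rightarrow>\<^sub>E {1..r}" by (auto simp: PiE_iff)
  finally show "set_pmf (condition_ensemble Y T \<beta> S) \<subseteq> S \<rightarrow>\<^sub>E {1..r}" .
  fix U assume "U \<subseteq> S"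
  then show "map_pmf (\<lambda>f. restrict f U) (condition_ensemble Y T \<beta> S) = condition_ensemble Y T \<beta> U"
    by (simp add: eq pmf.map_comp o_def Int_absorb1)
qed

text \<open>Conditioning only removes values, so the support bound \<open>q\<close> passes to the
  conditioned ensemble.\<close>

lemma set_pmf_marginal_condition:
  assumes T: "insert x T \<subseteq> {1..n}" "card (insert x T) \<le> t" and \<beta>: "\<beta> \<in> set_pmf (Y T)"
  shows "set_pmf (marginal (condition_ensemble Y T \<beta>) x) \<subseteq> set_pmf (marginal Y x)"
proof -
  have ne: "set_pmf (Y (insert x T)) \<inter> {f. restrict f T = \<beta>} \<noteq> {}"
    using T \<beta> by (intro condition_event_nonempty) auto
  have "set_pmf (condition_ensemble Y T \<beta> {x}) \<subseteq> (\<lambda>f. restrict f {x}) ` set_pmf (Y (insert x T))"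
    using ne by (subst condition_ensemble_superset[OF T _ \<beta>]) auto
  also have "\<dots> = set_pmf (Y {x})"
    using consistent[OF T, of "{x}"] by (metis insert_subset empty_subsetI insertI1 set_map_pmf)
  finally show ?thesis by (auto simp: marginal_def)
qed

lemma joint_prob_superset:
  assumes "R \<subseteq> {1..n}" "card R \<le> t" "S \<union> T \<subseteq> R"
  shows "joint_prob Y S \<alpha> T \<beta> = measure_pmf.prob (Y R) {f. restrict f S = \<alpha> \<and> restrict f T = \<beta>}"
  unfolding joint_prob_def by (subst prob_superset[OF assms]) (simp add: Int_absorb1)

text \<open>The ceiling for the energy: a joint probability p is at most the probability P of its
  conditioning event, hence p^2 / P \<le> p.\<close>

lemma cond_energy_le_1:
  assumes "insert x T \<subseteq> {1..n}" "card (insert x T) \<le> t"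
  shows "cond_energy r Y T x \<le> 1"
proof -
  have R: "T \<union> {x} \<subseteq> {1..n}" "card (T \<union> {x}) \<le> t" using assms by auto
  have "cond_energy r Y T x \<le> (\<Sum>\<beta>\<in>T \<rightarrow>\<^sub>E {1..r}. \<Sum>b\<in>{x} \<rightarrow>\<^sub>E {1..r}. joint_prob Y T \<beta> {x} b)"
    unfolding cond_energy_def
  proof (intro sum_mono)
    fix \<beta> b
    have e: "measure_pmf.prob (Y (T \<union> {x})) {f. restrict f T = \<beta>} = pmf (Y T) \<beta>"
      by (rule prob_restrict[OF R]) auto
    have le: "joint_prob Y T \<beta> {x} b \<le> pmf (Y T) \<beta>"
      unfolding joint_prob_def e[symmetric] by (intro measure_pmf.finite_measure_mono) auto
    have nn: "0 \<le> joint_prob Y T \<beta> {x} b" by (simp add: joint_prob_def)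
    show "(joint_prob Y T \<beta> {x} b)\<^sup>2 / pmf (Y T) \<beta> \<le> joint_prob Y T \<beta> {x} b"
    proof (cases "pmf (Y T) \<beta> = 0")
      case False
      then have "0 < pmf (Y T) \<beta>" by (simp add: less_le)
      then show ?thesis using le nn by (simp add: divide_le_eq power2_eq_square mult_left_mono)
    qed (use nn in simp)
  qed
  also have "\<dots> = (\<Sum>\<beta>\<in>T \<rightarrow>\<^sub>E {1..r}. pmf (Y T) \<beta>)"
  proof (intro sum.cong refl)
    fix \<beta>
    have "(\<Sum>b\<in>{x} \<rightarrow>\<^sub>E {1..r}. joint_prob Y T \<beta> {x} b) = measure_pmf.prob (Y (T \<union> {x})) {f. restrict f T = \<beta>}"
      unfolding joint_prob_def using supp[OF R] R
      by (intro prob_total finite_assignments[of _ n]) (auto simp: PiE_iff)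
    also have "\<dots> = pmf (Y T) \<beta>" by (rule prob_restrict[OF R]) auto
    finally show "(\<Sum>b\<in>{x} \<rightarrow>\<^sub>E {1..r}. joint_prob Y T \<beta> {x} b) = pmf (Y T) \<beta>" .
  qed
  also have "\<dots> = 1"
  proof (rule sum_pmf_eq_1)
    have "card T \<le> card (insert x T)" using assms by (intro card_mono) (auto intro: finite_subset)
    then show "set_pmf (Y T) \<subseteq> T \<rightarrow>\<^sub>E {1..r}" using assms by (intro supp) auto
    show "finite (T \<rightarrow>\<^sub>E {1..r})" using assms by (intro finite_assignments[of _ n]) simp
  qed
  finally show ?thesis .
qed

text \<open>All quantities are probabilities under the one law on T \<union> s \<union> {x}. For
  fixed values on \<open>T\<close> and at \<open>x\<close>, splitting by the value on
  \<open>s\<close> is an instance of \<open>second_moment_gain\<close>, whose squared deviations are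
  exactly the conditional covariances.\<close>

lemma cond_energy_gain:
  assumes R: "T \<union> s \<union> {x} \<subseteq> {1..n}" "card (T \<union> s \<union> {x}) \<le> t"
  shows "cond_energy r Y T x + (\<Sum>\<beta>\<in>T \<rightarrow>\<^sub>E {1..r}. pmf (Y T) \<beta> * cov_energy r (condition_ensemble Y T \<beta>) s {x})
    \<le> cond_energy r Y (T \<union> s) x"
proof -
  define p where "p = Y (T \<union> s \<union> {x})"
  define A where "A \<beta> = pmf (Y T) \<beta>" for \<beta>
  define C where "C \<beta> b = measure_pmf.prob p {f. restrict f T = \<beta> \<and> restrict f {x} = b}" for \<beta> b
  define a where "a \<beta> \<alpha> = measure_pmf.prob p {f. restrict f T = \<beta> \<and> restrict f s = \<alpha>}" for \<beta> \<alpha>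
  define c where "c \<beta> \<alpha> b = measure_pmf.prob p {f. (restrict f T = \<beta> \<and> restrict f {x} = b) \<and> restrict f s = \<alpha>}" for \<beta> \<alpha> b
  have fin: "finite (T \<rightarrow>\<^sub>E {1..r})" "finite (s \<rightarrow>\<^sub>E {1..r})"
    using R by (intro finite_assignments[of _ n]; simp)+
  have supp_p: "set_pmf p \<subseteq> T \<union> s \<union> {x} \<rightarrow>\<^sub>E {1..r}" unfolding p_def by (rule supp[OF R])
  have in_s: "restrict f s \<in> s \<rightarrow>\<^sub>E {1..r}" if "f \<in> set_pmf p" for f
    using that supp_p by (auto simp: PiE_iff)
  have A_eq: "A \<beta> = measure_pmf.prob p {f. restrict f T = \<beta>}" for \<beta>
    unfolding A_def p_def by (rule prob_restrict[OF R, symmetric]) auto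
  have sum_a: "(\<Sum>\<alpha>\<in>s \<rightarrow>\<^sub>E {1..r}. a \<beta> \<alpha>) = A \<beta>" for \<beta>
    unfolding a_def A_eq by (rule prob_total[OF fin(2) in_s])
  have sum_c: "(\<Sum>\<alpha>\<in>s \<rightarrow>\<^sub>E {1..r}. c \<beta> \<alpha> b) = C \<beta> b" for \<beta> b
    unfolding c_def C_def by (rule prob_total[OF fin(2) in_s])
  have c_le: "c \<beta> \<alpha> b \<le> a \<beta> \<alpha>" for \<beta> \<alpha> b
    unfolding c_def a_def by (intro measure_pmf.finite_measure_mono) auto
  have c_nonneg: "0 \<le> c \<beta> \<alpha> b" for \<beta> \<alpha> b by (simp add: c_def)
  have c_zero: "c \<beta> \<alpha> b = 0" if "a \<beta> \<alpha> = 0" for \<beta> \<alpha> b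
    using c_le[of \<beta> \<alpha> b] c_nonneg[of \<beta> \<alpha> b] that by simp
  have energy_T: "cond_energy r Y T x = (\<Sum>\<beta>\<in>T \<rightarrow>\<^sub>E {1..r}. \<Sum>b\<in>{x} \<rightarrow>\<^sub>E {1..r}. (C \<beta> b)\<^sup>2 / A \<beta>)"
    unfolding cond_energy_def A_def C_def p_def
    by (subst joint_prob_superset[OF R]) auto
  have cov: "ensemble_cov (condition_ensemble Y T \<beta>) (s, \<alpha>) ({x}, b) = c \<beta> \<alpha> b / A \<beta> - a \<beta> \<alpha> / A \<beta> * (C \<beta> b / A \<beta>)"
    if \<beta>: "\<beta> \<in> set_pmf (Y T)" for \<beta> \<alpha> b
  proof -
    have *: "measure_pmf.prob (condition_ensemble Y T \<beta> (s \<union> {x})) {f. Q f}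
      = measure_pmf.prob p {f. restrict f T = \<beta> \<and> Q (restrict f (s \<union> {x}))} / A \<beta>" for Q
      unfolding p_def A_def using R \<beta> by (intro condition_prob) auto
    have int: "insert x s \<inter> s = s" by auto
    show ?thesis
      unfolding ensemble_cov_def split covariance_of_bool *
      by (simp add: a_def c_def C_def int conj_ac)
  qed
  have energy_Ts: "cond_energy r Y (T \<union> s) x
      = (\<Sum>\<beta>\<in>T \<rightarrow>\<^sub>E {1..r}. \<Sum>\<alpha>\<in>s \<rightarrow>\<^sub>E {1..r}. \<Sum>b\<in>{x} \<rightarrow>\<^sub>E {1..r}. (c \<beta> \<alpha> b)\<^sup>2 / a \<beta> \<alpha>)"
  proof -
    \<comment> \<open>The sets \<open>T\<close> and \<open>s\<close> may overlap, so not every pair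
      of assignments comes from one on the union; the pairs outside the image have probability
      zero.\<close>
    define \<phi> where "\<phi> \<eta> = (restrict \<eta> T, restrict \<eta> s)" for \<eta> :: "nat \<Rightarrow> nat"
    define G where "G = (\<lambda>(\<beta>, \<alpha>). \<Sum>b\<in>{x} \<rightarrow>\<^sub>E {1..r}. (c \<beta> \<alpha> b)\<^sup>2 / a \<beta> \<alpha>)"
    have split: "(restrict f (T \<union> s) = \<eta>) = (restrict f T = restrict \<eta> T \<and> restrict f s = restrict \<eta> s)"
      if "\<eta> \<in> T \<union> s \<rightarrow>\<^sub>E {1..r}" for f \<eta> :: "nat \<Rightarrow> nat"
      using that by (auto simp: fun_eq_iff restrict_def PiE_iff extensional_def)
    have inj: "inj_on \<phi> (T \<union> s \<rightarrow>\<^sub>E {1..r})"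
    proof (rule inj_onI)
      fix f g assume f: "f \<in> T \<union> s \<rightarrow>\<^sub>E {1..r}" and g: "g \<in> T \<union> s \<rightarrow>\<^sub>E {1..r}" and "\<phi> f = \<phi> g"
      then have "restrict f (T \<union> s) = g" using split[OF g, of f] by (simp add: \<phi>_def)
      moreover have "restrict f (T \<union> s) = f" using f by (auto simp: PiE_iff extensional_restrict)
      ultimately show "f = g" by simp
    qed
    have "cond_energy r Y (T \<union> s) x = (\<Sum>\<eta>\<in>T \<union> s \<rightarrow>\<^sub>E {1..r}. G (\<phi> \<eta>))"
      unfolding cond_energy_def
    proof (intro sum.cong refl)
      fix \<eta> assume \<eta>: "\<eta> \<in> T \<union> s \<rightarrow>\<^sub>E {1..r}"
      have j: "joint_prob Y (T \<union> s) \<eta> {x} b = c (restrict \<eta> T) (restrict \<eta> s) b" for b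
        unfolding joint_prob_def c_def p_def split[OF \<eta>] by (simp add: conj_ac)
      have "pmf (Y (T \<union> s)) \<eta> = measure_pmf.prob p {f. restrict f (T \<union> s) = \<eta>}"
        unfolding p_def by (rule prob_restrict[OF R, symmetric]) auto
      then have "pmf (Y (T \<union> s)) \<eta> = a (restrict \<eta> T) (restrict \<eta> s)"
        unfolding split[OF \<eta>] by (simp add: a_def)
      then show "(\<Sum>b\<in>{x} \<rightarrow>\<^sub>E {1..r}. (joint_prob Y (T \<union> s) \<eta> {x} b)\<^sup>2 / pmf (Y (T \<union> s)) \<eta>) = G (\<phi> \<eta>)"
        by (simp add: j G_def \<phi>_def)
    qed
    also have "\<dots> = (\<Sum>z\<in>\<phi> ` (T \<union> s \<rightarrow>\<^sub>E {1..r}). G z)"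
      by (rule sum.reindex[OF inj, symmetric, unfolded o_def])
    also have "\<dots> = (\<Sum>z\<in>(T \<rightarrow>\<^sub>E {1..r}) \<times> (s \<rightarrow>\<^sub>E {1..r}). G z)"
    proof (rule sum.mono_neutral_left)
      show "\<phi> ` (T \<union> s \<rightarrow>\<^sub>E {1..r}) \<subseteq> (T \<rightarrow>\<^sub>E {1..r}) \<times> (s \<rightarrow>\<^sub>E {1..r})"
        by (auto simp: \<phi>_def PiE_iff)
      show "\<forall>z\<in>(T \<rightarrow>\<^sub>E {1..r}) \<times> (s \<rightarrow>\<^sub>E {1..r}) - \<phi> ` (T \<union> s \<rightarrow>\<^sub>E {1..r}). G z = 0"
      proof
        fix z assume z: "z \<in> (T \<rightarrow>\<^sub>E {1..r}) \<times> (s \<rightarrow>\<^sub>E {1..r}) - \<phi> ` (T \<union> s \<rightarrow>\<^sub>E {1..r})"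
        obtain \<beta> \<alpha> where z_eq: "z = (\<beta>, \<alpha>)" by (cases z)
        have "a \<beta> \<alpha> = 0"
        proof (rule ccontr)
          assume "a \<beta> \<alpha> \<noteq> 0"
          then have "\<not> (\<forall>f\<in>set_pmf p. \<not> (restrict f T = \<beta> \<and> restrict f s = \<alpha>))"
            unfolding a_def by (auto simp: measure_pmf_zero_iff)
          then obtain f where f: "f \<in> set_pmf p" "restrict f T = \<beta>" "restrict f s = \<alpha>" by auto
          have "restrict f (T \<union> s) \<in> T \<union> s \<rightarrow>\<^sub>E {1..r}" using f(1) supp_p by (auto simp: PiE_iff)
          moreover have "\<phi> (restrict f (T \<union> s)) = z"
            using f by (simp add: \<phi>_def z_eq Int_absorb1)
          ultimately show False using z by blast
        qed
        then show "G z = 0" by (simp add: G_def z_eq)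
      qed
    qed (use fin in simp)
    also have "\<dots> = (\<Sum>\<beta>\<in>T \<rightarrow>\<^sub>E {1..r}. \<Sum>\<alpha>\<in>s \<rightarrow>\<^sub>E {1..r}. \<Sum>b\<in>{x} \<rightarrow>\<^sub>E {1..r}. (c \<beta> \<alpha> b)\<^sup>2 / a \<beta> \<alpha>)"
      unfolding G_def by (rule sum.cartesian_product[symmetric])
    finally show ?thesis .
  qed
  have "cond_energy r Y T x + (\<Sum>\<beta>\<in>T \<rightarrow>\<^sub>E {1..r}. A \<beta> * cov_energy r (condition_ensemble Y T \<beta>) s {x})
      = (\<Sum>\<beta>\<in>T \<rightarrow>\<^sub>E {1..r}. \<Sum>b\<in>{x} \<rightarrow>\<^sub>E {1..r}. (C \<beta> b)\<^sup>2 / A \<beta>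
        + A \<beta> * (\<Sum>\<alpha>\<in>s \<rightarrow>\<^sub>E {1..r}. (ensemble_cov (condition_ensemble Y T \<beta>) (s, \<alpha>) ({x}, b))\<^sup>2))"
    unfolding energy_T cov_energy_def sum.distrib sum_distrib_left
    by (intro arg_cong2[where f = "(+)"] sum.cong refl sum.swap)
  also have "\<dots> \<le> (\<Sum>\<beta>\<in>T \<rightarrow>\<^sub>E {1..r}. \<Sum>b\<in>{x} \<rightarrow>\<^sub>E {1..r}. \<Sum>\<alpha>\<in>s \<rightarrow>\<^sub>E {1..r}. (c \<beta> \<alpha> b)\<^sup>2 / a \<beta> \<alpha>)"
  proof (intro sum_mono)
    fix \<beta> b
    show "(C \<beta> b)\<^sup>2 / A \<beta> + A \<beta> * (\<Sum>\<alpha>\<in>s \<rightarrow>\<^sub>E {1..r}. (ensemble_cov (condition_ensemble Y T \<beta>) (s, \<alpha>) ({x}, b))\<^sup>2)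
        \<le> (\<Sum>\<alpha>\<in>s \<rightarrow>\<^sub>E {1..r}. (c \<beta> \<alpha> b)\<^sup>2 / a \<beta> \<alpha>)"
    proof (cases "A \<beta> = 0")
      case True
      then show ?thesis by (simp add: sum_nonneg a_def)
    next
      case False
      then have A0: "0 < A \<beta>" by (simp add: A_def less_le)
      have \<beta>: "\<beta> \<in> set_pmf (Y T)" using False by (simp add: A_def set_pmf_iff)
      show ?thesis
        unfolding cov[OF \<beta>] using fin sum_a sum_c A0 c_zero
        by (intro second_moment_gain) (auto simp: a_def)
    qed
  qed
  also have "\<dots> = cond_energy r Y (T \<union> s) x"
    unfolding energy_Ts by (intro sum.cong refl sum.swap)
  finally show ?thesis by (simp only: A_def)
qed

lemma cond_energy_mono:
  assumes "S \<subseteq> T" "insert x T \<subseteq> {1..n}" "card (insert x T) \<le> t"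
  shows "cond_energy r Y S x \<le> cond_energy r Y T x"
proof -
  have eq: "S \<union> T = T" using assms by auto
  have "0 \<le> (\<Sum>\<beta>\<in>S \<rightarrow>\<^sub>E {1..r}. pmf (Y S) \<beta> * cov_energy r (condition_ensemble Y S \<beta>) T {x})"
    by (intro sum_nonneg) auto
  then show ?thesis using cond_energy_gain[of S T x] assms by (simp add: eq)
qed

end

section \<open>Propagation Rounding\<close>

lemma expectation_bind_finite:
  fixes h :: "'b \<Rightarrow> real"
  assumes "finite (set_pmf p)" "\<And>x. x \<in> set_pmf p \<Longrightarrow> finite (set_pmf (f x))"
  shows "measure_pmf.expectation (bind_pmf p f) h = measure_pmf.expectation p (\<lambda>x. measure_pmf.expectation (f x) h)"
  using assms by (subst pmf_expectation_bind[of "set_pmf p"]) (auto simp: integral_measure_pmf[of "set_pmf p"])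

lemma expectation_sum_finite:
  assumes "finite (set_pmf p)"
  shows "measure_pmf.expectation p (\<lambda>x. \<Sum>i\<in>A. c i * f i x :: real) = (\<Sum>i\<in>A. c i * measure_pmf.expectation p (f i))"
  using assms by (subst Bochner_Integration.integral_sum) (auto intro!: integrable_measure_pmf_finite)

lemma expectation_mono_finite:
  fixes f g :: "'a \<Rightarrow> real"
  assumes "finite (set_pmf p)" "\<And>x. x \<in> set_pmf p \<Longrightarrow> f x \<le> g x"
  shows "measure_pmf.expectation p f \<le> measure_pmf.expectation p g"
  using assms by (intro integral_mono_AE) (auto intro!: integrable_measure_pmf_finite simp: AE_measure_pmf_iff)

lemma l1_dist_nonneg: "0 \<le> l1_dist r A P Q"
  by (auto simp: l1_dist_def intro!: sum_nonneg)

lemma l1_dist_le_2: "l1_dist r A P Q \<le> 2"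
proof (cases "finite (A \<rightarrow>\<^sub>E {1..r})")
  case True
  have le: "sum (pmf P) B \<le> 1" if "finite B" for P :: "(nat \<Rightarrow> nat) pmf" and B
    using that measure_pmf.prob_le_1[of P B] by (simp add: measure_measure_pmf_finite)
  have "l1_dist r A P Q \<le> (\<Sum>f\<in>A \<rightarrow>\<^sub>E {1..r}. pmf P f + pmf Q f)"
    unfolding l1_dist_def
  proof (rule sum_mono)
    fix f
    show "\<bar>pmf P f - pmf Q f\<bar> \<le> pmf P f + pmf Q f"
      using pmf_nonneg[of P f] pmf_nonneg[of Q f] by linarith
  qed
  also have "\<dots> \<le> 1 + 1" unfolding sum.distrib using True by (intro add_mono le)
  finally show ?thesis by simp
qed (simp add: l1_dist_def)

text \<open>The rounded assignment integrates out, since the bound concerns the conditioned ensemble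
  alone.\<close>

lemma map_fst_propagation_rounding:
  "map_pmf fst (propagation_rounding n Y L l P) = do {
     m \<leftarrow> pmf_of_set {1..L div l};
     ss \<leftarrow> replicate_pmf m P;
     \<beta> \<leftarrow> Y (\<Union>(set ss));
     return_pmf (condition_ensemble Y (\<Union>(set ss)) \<beta>)
   }"
  by (simp add: propagation_rounding_def Let_def map_bind_pmf)

locale rounding_setup =
  expanding_complex n k X P \<gamma> + ensemble_structure n r L Y
  for n k X P \<gamma> r L Y +
  fixes q :: nat
  assumes psd: "local_psd_ensemble n r L Y"
    and q: "\<And>j. j \<in> {1..n} \<Longrightarrow> card (set_pmf (marginal Y j)) \<le> q" "1 \<le> q"
    and k: "1 \<le> k"
begin

section \<open>One conditioning step and its energy gain\<close>

text \<open>The potential of the argument: within the locality it is monotone in \<open>T\<close>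
  and stays between 0 and 1.\<close>

definition avg_energy :: "nat set \<Rightarrow> real" where
  "avg_energy T = (\<Sum>x\<in>V. w 1 {x} * cond_energy r Y T x)"

definition avg_l1 :: "ensemble \<Rightarrow> real" where
  "avg_l1 Z = (\<Sum>s\<in>level n k. w k s * l1_dist r s (Z s) (product_of_marginals Z s))"

text \<open>One transition of the process that joins a fresh random face to \<open>T\<close>;
  overlaps are allowed.\<close>

definition facet_avg :: "(nat set \<Rightarrow> real) \<Rightarrow> nat set \<Rightarrow> real" where
  "facet_avg G T = (\<Sum>s\<in>level n k. w k s * G (T \<union> s))"

lemma w_sum_1: "(\<Sum>x\<in>V. w 1 {x}) = 1"
  using w_sum[of 1] k by (simp add: level_1 sum.reindex)

lemma avg_energy_nonneg: "0 \<le> avg_energy T"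
  unfolding avg_energy_def cond_energy_def by (intro sum_nonneg mult_nonneg_nonneg) auto

lemma avg_energy_le_1:
  assumes "T \<subseteq> V" "card T < L"
  shows "avg_energy T \<le> 1"
proof -
  have fin: "finite T" using assms finite_subset by blast
  have "avg_energy T \<le> (\<Sum>x\<in>V. w 1 {x} * 1)"
    unfolding avg_energy_def using assms fin
    by (intro sum_mono mult_left_mono cond_energy_le_1) (auto simp: card_insert_if)
  then show ?thesis using w_sum_1 by simp
qed

lemma avg_l1_le_2: "avg_l1 Z \<le> 2"
proof -
  have "avg_l1 Z \<le> (\<Sum>s\<in>level n k. w k s * 2)"
    unfolding avg_l1_def by (intro sum_mono mult_left_mono l1_dist_le_2) auto
  then show ?thesis using w_sum[of k] by (simp add: sum_distrib_right[symmetric])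
qed

lemma avg_l1_nonneg: "0 \<le> avg_l1 Z"
  unfolding avg_l1_def by (intro sum_nonneg mult_nonneg_nonneg l1_dist_nonneg) auto

text \<open>A random j-face lies inside a random face one size larger, so averages of a monotone set
  function grow with the level. This lets one k-face dominate the gains from all smaller
  faces.\<close>

lemma level_avg_mono:
  assumes mono: "\<And>s t. s \<subseteq> t \<Longrightarrow> t \<subseteq> V \<Longrightarrow> card t \<le> k \<Longrightarrow> G s \<le> G t" and j: "j \<le> k"
  shows "(\<Sum>s\<in>level n j. w j s * G s) \<le> (\<Sum>s\<in>level n k. w k s * G s)"
  using j
proof (induction j rule: inc_induct)
  case (step j)
  have "(\<Sum>s\<in>level n j. w j s * G s) = edge_avg j (\<lambda>s x. G s)"
    using step by (intro edge_avg_fst[symmetric]) auto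
  also have "\<dots> \<le> edge_avg j (\<lambda>s x. G (insert x s))"
  proof (intro edge_avg_mono mono)
    fix s x assume s: "s \<in> level n j" and x: "x \<in> V - s"
    have "insert x s \<in> level n (Suc j)" by (rule insert_in_level[OF s x])
    then show "insert x s \<subseteq> V" "card (insert x s) \<le> k" using step by (auto simp: level_def)
  qed auto
  also have "\<dots> = (\<Sum>s\<in>level n (Suc j). w (Suc j) s * G s)"
    by (rule edge_avg_union)
  finally show ?case using step by simp
qed simp

text \<open>Adding a j-face gains its covariance energy with an independent vertex, and enlarging it
  to a k-face can only help; the right side is thus the same for every j. The strict inequality on
  \<open>card T + k\<close> leaves room for the vertex \<open>x\<close>.\<close>

lemma energy_step:
  assumes T: "T \<subseteq> V" "card T + k < L" and j: "j \<le> k"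
  shows "avg_energy T + (\<Sum>\<beta>\<in>T \<rightarrow>\<^sub>E {1..r}. pmf (Y T) \<beta> *
      indep_avg j (\<lambda>s x. cov_energy r (condition_ensemble Y T \<beta>) s {x})) \<le> facet_avg avg_energy T"
proof -
  have fin: "finite T" using T finite_subset by blast
  have small: "insert x (T \<union> s) \<subseteq> V \<and> card (insert x (T \<union> s)) \<le> L"
    if "x \<in> V" "s \<subseteq> V" "card s \<le> k" for x s
  proof -
    have "finite s" using that finite_subset by blast
    then have "card (insert x (T \<union> s)) \<le> Suc (card (T \<union> s))"
      using fin by (simp add: card_insert_if)
    also have "\<dots> \<le> L" using card_Un_le[of T s] that T by linarith
    finally show ?thesis using T that by auto
  qed
  have gain: "cond_energy r Y T x + (\<Sum>\<beta>\<in>T \<rightarrow>\<^sub>E {1..r}. pmf (Y T) \<beta> * cov_energy r (condition_ensemble Y T \<beta>) s {x})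
      \<le> cond_energy r Y (T \<union> s) x" if "x \<in> V" "s \<in> level n j" for x s
    using small[of x s] that j by (intro cond_energy_gain) (auto simp: level_def)
  have "indep_avg j (\<lambda>s x. cond_energy r Y T x + (\<Sum>\<beta>\<in>T \<rightarrow>\<^sub>E {1..r}. pmf (Y T) \<beta> * cov_energy r (condition_ensemble Y T \<beta>) s {x}))
      \<le> indep_avg j (\<lambda>s x. cond_energy r Y (T \<union> s) x)"
    unfolding indep_avg_def using gain by (intro sum_mono mult_left_mono) auto
  also have "\<dots> = (\<Sum>s\<in>level n j. w j s * avg_energy (T \<union> s))"
    by (simp add: indep_avg_def avg_energy_def sum_distrib_left mult_ac)
  also have "\<dots> \<le> facet_avg avg_energy T"
    unfolding facet_avg_def
  proof (rule level_avg_mono[OF _ j])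
    fix s t assume st: "s \<subseteq> t" "t \<subseteq> V" "card t \<le> k"
    show "avg_energy (T \<union> s) \<le> avg_energy (T \<union> t)"
      unfolding avg_energy_def using st small
      by (intro sum_mono mult_left_mono cond_energy_mono) auto
  qed
  finally have "indep_avg j (\<lambda>s x. cond_energy r Y T x + (\<Sum>\<beta>\<in>T \<rightarrow>\<^sub>E {1..r}. pmf (Y T) \<beta> * cov_energy r (condition_ensemble Y T \<beta>) s {x}))
      \<le> facet_avg avg_energy T" .
  moreover have "indep_avg j (\<lambda>s x. cond_energy r Y T x + (\<Sum>\<beta>\<in>T \<rightarrow>\<^sub>E {1..r}. pmf (Y T) \<beta> * cov_energy r (condition_ensemble Y T \<beta>) s {x}))
      = indep_avg j (\<lambda>s x. cond_energy r Y T x)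
        + indep_avg j (\<lambda>s x. \<Sum>\<beta>\<in>T \<rightarrow>\<^sub>E {1..r}. pmf (Y T) \<beta> * cov_energy r (condition_ensemble Y T \<beta>) s {x})"
    by (simp only: indep_avg_def distrib_left sum.distrib)
  moreover have "indep_avg j (\<lambda>s x. cond_energy r Y T x) = avg_energy T"
  proof -
    have "indep_avg j (\<lambda>s x. cond_energy r Y T x) = (\<Sum>s\<in>level n j. w j s) * avg_energy T"
      by (simp add: indep_avg_def avg_energy_def sum_product mult_ac)
    then show ?thesis using w_sum[OF j] by simp
  qed
  moreover have "indep_avg j (\<lambda>s x. \<Sum>\<beta>\<in>T \<rightarrow>\<^sub>E {1..r}. pmf (Y T) \<beta> * cov_energy r (condition_ensemble Y T \<beta>) s {x})
      = (\<Sum>\<beta>\<in>T \<rightarrow>\<^sub>E {1..r}. pmf (Y T) \<beta> * indep_avg j (\<lambda>s x. cov_energy r (condition_ensemble Y T \<beta>) s {x}))"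
    unfolding indep_avg_sum by (simp add: indep_avg_def sum_distrib_left mult.left_commute)
  ultimately show ?thesis by simp
qed

text \<open>The conditioned ensemble keeps locality \<open>L - card T\<close> \<ge> 2k and the
  support bound \<open>q\<close>, so the level-by-level estimate applies to it.\<close>

lemma conditioned_l1_le:
  assumes T: "T \<subseteq> V" "card T + 2 * k \<le> L" and \<beta>: "\<beta> \<in> set_pmf (Y T)" and \<theta>: "0 < \<theta>"
  shows "avg_l1 (condition_ensemble Y T \<beta>)
    \<le> (\<Sum>j<k. \<theta> / 2 + real q ^ k / (2 * \<theta>) *
        (indep_avg j (\<lambda>s x. cov_energy r (condition_ensemble Y T \<beta>) s {x}) + real k * \<gamma>))"
proof -
  define Z where "Z = condition_ensemble Y T \<beta>"
  have fin: "finite T" using T finite_subset by blast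
  have localZ: "local_ensemble n r (L - card T) Z"
    unfolding Z_def using T \<beta> by (intro local_condition_ensemble) auto
  have psdZ: "psd_on (psd_index n r (L - card T)) (ensemble_cov Z)"
    using psd T \<beta> k unfolding local_psd_ensemble_def psd_index_def Z_def by auto
  interpret Z: psd_expanding_complex n k X P \<gamma> r "L - card T" Z
    by unfold_locales (use localZ psdZ T in auto)
  have qZ: "card (set_pmf (marginal Z j)) \<le> q" if j: "j \<in> {1..n}" for j
  proof -
    have sub: "set_pmf (marginal Z j) \<subseteq> set_pmf (marginal Y j)"
      unfolding Z_def using j T fin k \<beta> by (intro set_pmf_marginal_condition) (auto simp: card_insert_if)
    have "set_pmf (Y {j}) \<subseteq> {j} \<rightarrow>\<^sub>E {1..r}" using j T k by (intro supp) auto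
    then have "finite (set_pmf (Y {j}))" by (rule finite_subset) (simp add: finite_PiE)
    then have "finite (set_pmf (marginal Y j))" by (simp add: marginal_def)
    then show ?thesis using card_mono[OF _ sub] q(1)[OF j] by linarith
  qed
  have "avg_l1 Z \<le> (\<Sum>j<k. \<theta> / 2 + real q ^ k / (2 * \<theta>) *
        (indep_avg j (\<lambda>s x. cov_energy r Z s {x}) + sqrt (real j) * \<gamma>))"
    unfolding avg_l1_def using qZ q(2) \<theta> by (intro Z.expected_l1_dist_le) auto
  also have "\<dots> \<le> (\<Sum>j<k. \<theta> / 2 + real q ^ k / (2 * \<theta>) *
        (indep_avg j (\<lambda>s x. cov_energy r Z s {x}) + real k * \<gamma>))"
  \<comment> \<open>The cruder factor k in place of sqrt(j) makes the error uniform in j.\<close>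
  proof (intro sum_mono add_left_mono mult_left_mono mult_right_mono)
    fix j assume j: "j \<in> {..<k}"
    have "real j \<le> (real j)\<^sup>2"
      by (metis of_nat_le_iff of_nat_power power2_nat_le_imp_le le_square power2_eq_square)
    then have "sqrt (real j) \<le> real j" by (simp add: real_le_lsqrt)
    then show "sqrt (real j) \<le> real k" using j by simp
  qed (use \<gamma> \<theta> in auto)
  finally show ?thesis by (simp only: Z_def)
qed

text \<open>Averaging over the conditioned values turns every one of the k independent energies into
  at most the same increment of \<open>avg_energy\<close>, whence the factor k in front of
  it.\<close>

lemma expected_conditioned_l1_le:
  assumes T: "T \<subseteq> V" "card T + 2 * k \<le> L" and \<theta>: "0 < \<theta>"
  shows "measure_pmf.expectation (Y T) (\<lambda>\<beta>. avg_l1 (condition_ensemble Y T \<beta>))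
    \<le> real k * \<theta> / 2 + real q ^ k / (2 * \<theta>) *
        (real k * (facet_avg avg_energy T - avg_energy T) + (real k)\<^sup>2 * \<gamma>)"
proof -
  define c where "c = real q ^ k / (2 * \<theta>)"
  define K where "K j \<beta> = indep_avg j (\<lambda>s x. cov_energy r (condition_ensemble Y T \<beta>) s {x})" for j \<beta>
  define \<Delta> where "\<Delta> = facet_avg avg_energy T - avg_energy T"
  have c: "0 \<le> c" using \<theta> by (simp add: c_def)
  have finA: "finite (T \<rightarrow>\<^sub>E {1..r})" using T by (intro finite_assignments[of _ n])
  have sub: "set_pmf (Y T) \<subseteq> T \<rightarrow>\<^sub>E {1..r}" using T by (intro supp) auto
  have total: "(\<Sum>\<beta>\<in>T \<rightarrow>\<^sub>E {1..r}. pmf (Y T) \<beta>) = 1" by (rule sum_pmf_eq_1[OF finA sub])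
  have K: "(\<Sum>\<beta>\<in>T \<rightarrow>\<^sub>E {1..r}. pmf (Y T) \<beta> * K j \<beta>) \<le> \<Delta>" if "j < k" for j
    using energy_step[of T j] T that k unfolding K_def \<Delta>_def by simp
  have "measure_pmf.expectation (Y T) (\<lambda>\<beta>. avg_l1 (condition_ensemble Y T \<beta>))
      = (\<Sum>\<beta>\<in>T \<rightarrow>\<^sub>E {1..r}. pmf (Y T) \<beta> * avg_l1 (condition_ensemble Y T \<beta>))"
    using finA sub by (subst integral_measure_pmf[of "T \<rightarrow>\<^sub>E {1..r}"]) auto
  also have "\<dots> \<le> (\<Sum>\<beta>\<in>T \<rightarrow>\<^sub>E {1..r}. pmf (Y T) \<beta> * (\<Sum>j<k. \<theta> / 2 + c * (K j \<beta> + real k * \<gamma>)))"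
  proof (rule sum_mono)
    fix \<beta>
    show "pmf (Y T) \<beta> * avg_l1 (condition_ensemble Y T \<beta>) \<le> pmf (Y T) \<beta> * (\<Sum>j<k. \<theta> / 2 + c * (K j \<beta> + real k * \<gamma>))"
    proof (cases "\<beta> \<in> set_pmf (Y T)")
      case True
      then show ?thesis
        using conditioned_l1_le[OF T True \<theta>] unfolding c_def K_def by (intro mult_left_mono) auto
    qed (simp add: set_pmf_iff)
  qed
  also have "\<dots> = (\<Sum>j<k. \<Sum>\<beta>\<in>T \<rightarrow>\<^sub>E {1..r}. pmf (Y T) \<beta> * (\<theta> / 2 + c * (K j \<beta> + real k * \<gamma>)))"
    unfolding sum_distrib_left by (rule sum.swap)
  also have "\<dots> = (\<Sum>j<k. \<theta> / 2 + c * ((\<Sum>\<beta>\<in>T \<rightarrow>\<^sub>E {1..r}. pmf (Y T) \<beta> * K j \<beta>) + real k * \<gamma>))"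
  proof (rule sum.cong[OF refl])
    fix j
    have "(\<Sum>\<beta>\<in>T \<rightarrow>\<^sub>E {1..r}. pmf (Y T) \<beta> * (\<theta> / 2 + c * (K j \<beta> + real k * \<gamma>)))
        = (\<Sum>\<beta>\<in>T \<rightarrow>\<^sub>E {1..r}. (\<theta> / 2 + c * (real k * \<gamma>)) * pmf (Y T) \<beta> + c * (pmf (Y T) \<beta> * K j \<beta>))"
      by (intro sum.cong refl) (simp add: algebra_simps)
    also have "\<dots> = (\<theta> / 2 + c * (real k * \<gamma>)) * 1 + c * (\<Sum>\<beta>\<in>T \<rightarrow>\<^sub>E {1..r}. pmf (Y T) \<beta> * K j \<beta>)"
      by (simp only: sum.distrib sum_distrib_left[symmetric] total)
    finally show "(\<Sum>\<beta>\<in>T \<rightarrow>\<^sub>E {1..r}. pmf (Y T) \<beta> * (\<theta> / 2 + c * (K j \<beta> + real k * \<gamma>)))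
        = \<theta> / 2 + c * ((\<Sum>\<beta>\<in>T \<rightarrow>\<^sub>E {1..r}. pmf (Y T) \<beta> * K j \<beta>) + real k * \<gamma>)"
      by (simp add: algebra_simps)
  qed
  also have "\<dots> \<le> (\<Sum>j<k. \<theta> / 2 + c * (\<Delta> + real k * \<gamma>))"
    using K c by (intro sum_mono add_left_mono mult_left_mono add_right_mono) auto
  also have "\<dots> = real k * \<theta> / 2 + c * (real k * \<Delta> + (real k)\<^sup>2 * \<gamma>)"
    by (simp add: algebra_simps power2_eq_square)
  finally show ?thesis by (simp only: c_def \<Delta>_def)
qed

section \<open>Telescoping over the number of conditioned faces\<close>

definition union_avg :: "nat \<Rightarrow> (nat set \<Rightarrow> real) \<Rightarrow> real" where
  "union_avg m G = measure_pmf.expectation (replicate_pmf m P) (\<lambda>ss. G (\<Union>(set ss)))"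

lemma P_support: "set_pmf P \<subseteq> level n k"
  using set_pmf_induced_measure[OF X P, of k] by simp

lemma finite_P: "finite (set_pmf P)"
  by (rule finite_subset[OF P_support]) simp

lemma finite_replicate: "finite (set_pmf (replicate_pmf m P))"
proof -
  have "{xs \<in> lists (set_pmf P). length xs = m} = {xs. set xs \<subseteq> set_pmf P \<and> length xs = m}"
    by auto
  then show ?thesis
    using finite_lists_length_eq[OF finite_P, of m] by (simp only: set_replicate_pmf)
qed

lemma union_support:
  assumes "ss \<in> set_pmf (replicate_pmf m P)"
  shows "\<Union>(set ss) \<subseteq> V" "card (\<Union>(set ss)) \<le> m * k"
proof -
  have ss: "set ss \<subseteq> level n k" "length ss = m"
    using assms P_support by (auto simp: set_replicate_pmf lists_eq_set)
  then show "\<Union>(set ss) \<subseteq> V" by (auto simp: level_def)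
  have "card (\<Union>(set ss)) \<le> (\<Sum>s\<in>set ss. card s)" by (rule card_Union_le_sum_card)
  also have "\<dots> = card (set ss) * k" using ss by (simp add: level_def subset_iff)
  also have "\<dots> \<le> m * k" using card_length[of ss] ss by simp
  finally show "card (\<Union>(set ss)) \<le> m * k" .
qed

lemma union_avg_mono:
  assumes "\<And>T. T \<subseteq> V \<Longrightarrow> card T \<le> m * k \<Longrightarrow> F T \<le> G T"
  shows "union_avg m F \<le> union_avg m G"
  unfolding union_avg_def using assms union_support by (intro expectation_mono_finite finite_replicate) auto

lemma union_avg_const [simp]: "union_avg m (\<lambda>_. c) = c"
  by (simp add: union_avg_def)

lemma union_avg_affine:
  "union_avg m (\<lambda>T. a + b * (c * (F T - G T) + d)) = a + b * (c * (union_avg m F - union_avg m G) + d)"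
proof -
  have int: "integrable (measure_pmf (replicate_pmf m P)) f" for f :: "nat set list \<Rightarrow> real"
    by (intro integrable_measure_pmf_finite finite_replicate)
  show ?thesis unfolding union_avg_def by (simp add: int)
qed

text \<open>Separating one of the m+1 independent faces shows that the increments of the energy are
  differences of consecutive averages, so that they telescope over m.\<close>

lemma union_avg_Suc: "union_avg (Suc m) G = union_avg m (facet_avg G)"
proof -
  have "union_avg (Suc m) G = measure_pmf.expectation P (\<lambda>s. measure_pmf.expectation (replicate_pmf m P) (\<lambda>ss. G (s \<union> \<Union>(set ss))))"
    unfolding union_avg_def replicate_pmf.simps
    using finite_P finite_replicate by (simp add: expectation_bind_finite)
  also have "\<dots> = (\<Sum>s\<in>level n k. w k s * measure_pmf.expectation (replicate_pmf m P) (\<lambda>ss. G (s \<union> \<Union>(set ss))))"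
    using P_support by (subst integral_measure_pmf[of "level n k"]) (auto simp: w_def)
  also have "\<dots> = measure_pmf.expectation (replicate_pmf m P) (\<lambda>ss. \<Sum>s\<in>level n k. w k s * G (s \<union> \<Union>(set ss)))"
    by (rule expectation_sum_finite[OF finite_replicate, symmetric])
  finally show ?thesis by (simp only: union_avg_def facet_avg_def Un_commute)
qed

text \<open>The test face is independent of the procedure and can be averaged out, which produces
  \<open>avg_l1\<close>; the uniform choice of m becomes the mean over 1, ..., M.\<close>

lemma expected_l1_rounding:
  assumes M: "M = L div k" "1 \<le> M"
  shows "measure_pmf.expectation
      (pair_pmf P (map_pmf fst (propagation_rounding n Y L k P)))
      (\<lambda>(a, Z). l1_dist r a (Z a) (product_of_marginals Z a))
    = (\<Sum>m=1..M. union_avg m (\<lambda>T. measure_pmf.expectation (Y T) (\<lambda>\<beta>. avg_l1 (condition_ensemble Y T \<beta>)))) / real M"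
proof -
  define \<delta> where "\<delta> a Z = l1_dist r a (Z a) (product_of_marginals Z a)" for a and Z :: ensemble
  define inner where "inner ss = bind_pmf (Y (\<Union>(set ss))) (\<lambda>\<beta>. return_pmf (condition_ensemble Y (\<Union>(set ss)) \<beta>))" for ss
  define R where "R m = bind_pmf (replicate_pmf m P) inner" for m
  define Q where "Q = bind_pmf (pmf_of_set {1..M}) R"
  have Q: "map_pmf fst (propagation_rounding n Y L k P) = Q"
    by (simp add: map_fst_propagation_rounding Q_def R_def[abs_def] inner_def[abs_def] M)
  \<comment> \<open>At most M k \<le> L indices are conditioned on, so the law has finite support;
    on sets larger than L the laws are arbitrary.\<close>
  have finY: "finite (set_pmf (Y (\<Union>(set ss))))" if "ss \<in> set_pmf (replicate_pmf m P)" "m \<le> M" for ss m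
  proof -
    have "m * k \<le> M * k" using that by simp
    also have "\<dots> \<le> L" by (simp add: M)
    finally have "card (\<Union>(set ss)) \<le> L" using union_support(2)[OF that(1)] by simp
    then have "set_pmf (Y (\<Union>(set ss))) \<subseteq> \<Union>(set ss) \<rightarrow>\<^sub>E {1..r}"
      using union_support(1)[OF that(1)] by (intro supp)
    then show ?thesis
      using finite_assignments[OF union_support(1)[OF that(1)]] finite_subset by blast
  qed
  have fin_inner: "finite (set_pmf (inner ss))" if "ss \<in> set_pmf (replicate_pmf m P)" "m \<le> M" for ss m
    using finY[OF that] by (simp add: inner_def)
  have fin_R: "finite (set_pmf (R m))" if "m \<in> {1..M}" for m
    unfolding R_def set_bind_pmf using that fin_inner by (intro finite_UN_I finite_replicate) auto
  have set_M: "set_pmf (pmf_of_set {1..M}) = {1..M}" using M by (intro set_pmf_of_set) auto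
  have fin_Q: "finite (set_pmf Q)"
    unfolding Q_def set_bind_pmf set_M using fin_R by auto
  have "measure_pmf.expectation (pair_pmf P Q) (\<lambda>(a, Z). \<delta> a Z)
      = measure_pmf.expectation P (\<lambda>a. measure_pmf.expectation Q (\<delta> a))"
    unfolding pair_pmf_def using finite_P fin_Q by (simp add: expectation_bind_finite)
  also have "\<dots> = (\<Sum>a\<in>level n k. w k a * measure_pmf.expectation Q (\<delta> a))"
    using P_support by (subst integral_measure_pmf[of "level n k"]) (auto simp: w_def)
  also have "\<dots> = measure_pmf.expectation Q avg_l1"
    unfolding avg_l1_def[abs_def] \<delta>_def[symmetric] by (rule expectation_sum_finite[OF fin_Q, symmetric])
  also have "\<dots> = measure_pmf.expectation (pmf_of_set {1..M}) (\<lambda>m. measure_pmf.expectation (R m) avg_l1)"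
    unfolding Q_def by (intro expectation_bind_finite) (simp_all only: set_M fin_R finite_atLeastAtMost)
  also have "\<dots> = (\<Sum>m=1..M. measure_pmf.expectation (R m) avg_l1) / real M"
    using M by (subst integral_pmf_of_set) auto
  also have "(\<Sum>m=1..M. measure_pmf.expectation (R m) avg_l1)
      = (\<Sum>m=1..M. union_avg m (\<lambda>T. measure_pmf.expectation (Y T) (\<lambda>\<beta>. avg_l1 (condition_ensemble Y T \<beta>))))"
  proof (rule sum.cong[OF refl])
    fix m assume m: "m \<in> {1..M}"
    have "measure_pmf.expectation (R m) avg_l1
        = measure_pmf.expectation (replicate_pmf m P) (\<lambda>ss. measure_pmf.expectation (inner ss) avg_l1)"
      unfolding R_def using m fin_inner by (intro expectation_bind_finite finite_replicate) auto
    also have "\<dots> = measure_pmf.expectation (replicate_pmf m P) (\<lambda>ss.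
        measure_pmf.expectation (Y (\<Union>(set ss))) (\<lambda>\<beta>. avg_l1 (condition_ensemble Y (\<Union>(set ss)) \<beta>)))"
      unfolding inner_def using m finY
      by (intro integral_cong_AE) (auto simp: AE_measure_pmf_iff expectation_bind_finite)
    finally show "measure_pmf.expectation (R m) avg_l1
        = union_avg m (\<lambda>T. measure_pmf.expectation (Y T) (\<lambda>\<beta>. avg_l1 (condition_ensemble Y T \<beta>)))"
      by (simp only: union_avg_def)
  qed
  finally show ?thesis unfolding Q \<delta>_def .
qed

lemma expected_l1_rounding_le:
  assumes M: "M = L div k" "2 \<le> M" and \<theta>: "0 < \<theta>"
  shows "measure_pmf.expectation
      (pair_pmf P (map_pmf fst (propagation_rounding n Y L k P)))
      (\<lambda>(a, Z). l1_dist r a (Z a) (product_of_marginals Z a))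
    \<le> 4 / real M + real k * \<theta> / 2 + real q ^ k / (2 * \<theta>) * (real k / real M + (real k)\<^sup>2 * \<gamma>)"
proof -
  define H where "H m = union_avg m (\<lambda>T. measure_pmf.expectation (Y T) (\<lambda>\<beta>. avg_l1 (condition_ensemble Y T \<beta>)))" for m
  define E where "E m = union_avg m avg_energy" for m
  define c where "c = real q ^ k / (2 * \<theta>)"
  define b where "b = real k * \<theta> / 2 + c * ((real k)\<^sup>2 * \<gamma>)"
  have c: "0 \<le> c" using \<theta> by (simp add: c_def)
  have b: "0 \<le> b" using \<theta> c \<gamma> by (simp add: b_def)
  have Mk: "M * k \<le> L" by (simp add: M)
  \<comment> \<open>The estimate after conditioning on m faces needs 2k of locality left, guaranteed
    by (m+2) k \<le> M k. The remaining two values of m cost 2 each, hence the term 4 / M.\<close>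
  obtain N where N: "M = N + 2" using M(2) by (metis add.commute le_Suc_ex)
  have H2: "H m \<le> 2" for m
  proof -
    have "H m \<le> union_avg m (\<lambda>_. 2)"
      unfolding H_def union_avg_def
      by (intro expectation_mono_finite finite_replicate measure_pmf.integral_le_const
          measure_pmf.integrable_const_bound[where B = 2])
        (auto simp: avg_l1_le_2 avg_l1_nonneg)
    then show ?thesis by simp
  qed
  have HE: "H m \<le> b + c * real k * (E (Suc m) - E m)" if m: "m \<in> {1..N}" for m
  proof -
    have "H m \<le> union_avg m (\<lambda>T. real k * \<theta> / 2 + c * (real k * (facet_avg avg_energy T - avg_energy T) + (real k)\<^sup>2 * \<gamma>))"
      unfolding H_def c_def
    proof (intro union_avg_mono expected_conditioned_l1_le \<theta>)
      fix T assume "card T \<le> m * k"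
      then have "card T + 2 * k \<le> (m + 2) * k" by simp
      also have "\<dots> \<le> M * k" using m N by (intro mult_right_mono) auto
      finally show "card T + 2 * k \<le> L" using Mk by simp
    qed
    also have "\<dots> = real k * \<theta> / 2 + c * (real k * (E (Suc m) - E m) + (real k)\<^sup>2 * \<gamma>)"
      unfolding union_avg_affine E_def union_avg_Suc ..
    finally show ?thesis by (simp add: b_def algebra_simps)
  qed
  \<comment> \<open>The energy bound needs room for one extra vertex; (N+1) k < M k provides
    it.\<close>
  have E1: "E (Suc N) \<le> 1"
  proof -
    have "E (Suc N) \<le> union_avg (Suc N) (\<lambda>_. 1)"
      unfolding E_def
    proof (intro union_avg_mono avg_energy_le_1)
      fix T assume "card T \<le> Suc N * k"
      also have "\<dots> < M * k" using N k by simp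
      finally show "card T < L" using Mk by simp
    qed
    then show ?thesis by simp
  qed
  have E0: "0 \<le> E 1"
    unfolding E_def union_avg_def by (intro integral_nonneg_AE) (auto simp: avg_energy_nonneg)
  have "(\<Sum>m=1..M. H m) = (\<Sum>m=1..N. H m) + H (N + 1) + H (N + 2)"
    by (simp add: N)
  also have "\<dots> \<le> (\<Sum>m=1..N. b + c * real k * (E (Suc m) - E m)) + 2 + 2"
    using HE H2 by (intro add_mono sum_mono) auto
  also have "(\<Sum>m=1..N. b + c * real k * (E (Suc m) - E m)) = real N * b + c * real k * (\<Sum>m=1..N. E (Suc m) - E m)"
    by (simp add: sum.distrib sum_distrib_left)
  also have "(\<Sum>m=1..N. E (Suc m) - E m) = E (Suc N) - E 1"
    by (subst sum_Suc_diff) auto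
  also have "real N * b + c * real k * (E (Suc N) - E 1) + 2 + 2 \<le> real M * b + c * real k * 1 + 2 + 2"
    using E0 E1 b c N by (intro add_mono mult_right_mono[where c = b] mult_left_mono[where c = "c * real k"]) auto
  finally have "(\<Sum>m=1..M. H m) / real M \<le> (real M * b + c * real k * 1 + 2 + 2) / real M"
    by (intro divide_right_mono) auto
  also have "\<dots> = 4 / real M + real k * \<theta> / 2 + c * (real k / real M + (real k)\<^sup>2 * \<gamma>)"
    using M by (simp add: b_def field_simps)
  finally show ?thesis
    using M by (subst expected_l1_rounding[of M]) (simp_all add: H_def c_def)
qed

end

section \<open>Choice of parameters and conclusion\<close>

text \<open>The trivial bound settles \<epsilon> \<ge> 2, so the parameter estimates may assume
  \<epsilon> < 2.\<close>

lemma expected_l1_le_2: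
  "measure_pmf.expectation p (\<lambda>(a, Z). l1_dist r a (f a Z) (g a Z)) \<le> 2"
  by (intro measure_pmf.integral_le_const measure_pmf.integrable_const_bound[where B = 2])
    (auto simp: l1_dist_nonneg l1_dist_le_2)


lemma hdx_mono: "hdx X k P \<gamma> \<Longrightarrow> \<gamma> \<le> \<gamma>' \<Longrightarrow> hdx X k P \<gamma>'"
  unfolding hdx_def by (meson order_trans)

text \<open>With \<theta> = \<epsilon> / (2k) the \<theta> term is \<epsilon>/4 and the coefficient
  of the energy becomes q^k k / \<epsilon>. The other three errors are at most \<epsilon>/4
  (discarded m), \<epsilon>/32 (energy gain) and \<epsilon>/8 (expansion).\<close>

lemma rounding_parameters:
  fixes k q L M :: nat and \<epsilon> \<gamma> :: real
  assumes k: "1 \<le> k" and q: "1 \<le> q" and \<epsilon>: "0 < \<epsilon>" "\<epsilon> < 2"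
    and L: "256 * real q ^ k * real k ^ 5 / \<epsilon> ^ 4 \<le> real L"
    and \<gamma>: "\<gamma> \<le> 1 / 32 * \<epsilon> ^ 4 / (real k ^ (8 + k) * 2 ^ (6 * k) * real q ^ (2 * k))"
    and M: "M = L div k"
  shows "2 \<le> M" "\<gamma> < 1"
    "4 / real M + real k * (\<epsilon> / (2 * real k)) / 2
      + real q ^ k / (2 * (\<epsilon> / (2 * real k))) * (real k / real M + (real k)\<^sup>2 * \<gamma>) \<le> \<epsilon>"
proof -
  define a where "a = real q ^ k"
  define K where "K = real k"
  have a: "1 \<le> a" using q by (simp add: a_def)
  have K: "1 \<le> K" using k by (simp add: K_def)
  have e2: "\<epsilon>\<^sup>2 \<le> 4" using power_mono[of \<epsilon> 2 2] \<epsilon> by simp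
  have e3: "\<epsilon> ^ 3 \<le> 8" using power_mono[of \<epsilon> 2 3] \<epsilon> by simp
  have e4: "\<epsilon> ^ 4 \<le> 16" using power_mono[of \<epsilon> 2 4] \<epsilon> by simp
  \<comment> \<open>The lower bound for L / k. It is at least 256/16 = 16 because \<epsilon> < 2, so
    the loss of at most one in the floor is absorbed by halving it.\<close>
  define B where "B = 256 * a * K ^ 4 / \<epsilon> ^ 4"
  have "16 * 1 \<le> 16 * (a * K ^ 4)" using a K by (intro mult_left_mono) (auto simp: mult_ge1_I one_le_power)
  also have "\<dots> \<le> 256 * (a * K ^ 4) / \<epsilon> ^ 4"
    using \<epsilon> e4 a K by (simp add: le_divide_eq mult_le_cancel_left)
  finally have B16: "16 \<le> B" by (simp add: B_def mult.assoc)
  have "B * K \<le> real L"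
    using L \<epsilon> by (simp add: B_def a_def K_def power_Suc[symmetric] eval_nat_numeral mult_ac)
  also have "real L \<le> (real M + 1) * K"
  proof -
    have "L \<le> (M + 1) * k"
      using k by (simp add: M) (metis add.commute div_mult_mod_eq le_add2 mod_less_divisor nat_add_left_cancel_le less_imp_le_nat less_eq_Suc_le One_nat_def mult.commute)
    then have "real L \<le> real ((M + 1) * k)" by (rule of_nat_mono)
    then show ?thesis by (simp add: K_def algebra_simps)
  qed
  finally have "B \<le> real M + 1" using K by simp
  then have MB: "B / 2 \<le> real M" using B16 by linarith
  then show "2 \<le> M" using B16 by linarith
  have M0: "0 < real M" using MB B16 by linarith
  have MB': "128 * a * K ^ 4 \<le> real M * \<epsilon> ^ 4"
    using MB \<epsilon> by (simp add: B_def field_simps)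
  have t1: "4 / real M \<le> \<epsilon> / 4"
  proof -
    have "128 * 1 \<le> 128 * (a * K ^ 4)" using a K by (intro mult_left_mono) (auto simp: mult_ge1_I one_le_power)
    also have "\<dots> \<le> real M * \<epsilon> ^ 4" using MB' by (simp add: mult.assoc)
    also have "\<dots> = real M * (\<epsilon> * \<epsilon> ^ 3)" by (simp add: eval_nat_numeral)
    also have "\<dots> \<le> real M * (\<epsilon> * 8)" using e3 \<epsilon> M0 by (intro mult_left_mono) auto
    finally show ?thesis using M0 by (simp add: field_simps)
  qed
  have t2: "a * K / \<epsilon> * (K / real M) \<le> \<epsilon> / 32"
  proof -
    have "128 * (a * K\<^sup>2) \<le> 128 * (a * K ^ 4)"
      using a K by (intro mult_left_mono power_increasing) auto
    also have "\<dots> \<le> real M * (\<epsilon>\<^sup>2 * \<epsilon>\<^sup>2)" using MB' by (simp add: mult.assoc eval_nat_numeral)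
    also have "\<dots> \<le> real M * (\<epsilon>\<^sup>2 * 4)" using e2 M0 by (intro mult_left_mono) auto
    finally show ?thesis using M0 \<epsilon> by (simp add: field_simps power2_eq_square)
  qed
  \<comment> \<open>The form that cancels against the coefficient k^3 q^k / \<epsilon> of
    \<gamma>.\<close>
  have \<gamma>': "\<gamma> \<le> \<epsilon> ^ 4 / (32 * (K ^ 3 * a))"
  proof -
    have "K ^ 3 * 1 * a \<le> K ^ (8 + k) * 2 ^ (6 * k) * real q ^ (2 * k)"
    proof (intro mult_mono)
      show "K ^ 3 \<le> K ^ (8 + k)" using K by (intro power_increasing) auto
      show "(1::real) \<le> 2 ^ (6 * k)" by simp
      show "a \<le> real q ^ (2 * k)" unfolding a_def using q by (intro power_increasing) auto
    qed (use a K in auto)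
    then have "\<epsilon> ^ 4 / 32 / (K ^ (8 + k) * 2 ^ (6 * k) * real q ^ (2 * k)) \<le> \<epsilon> ^ 4 / 32 / (K ^ 3 * a)"
      using a K \<epsilon> q by (intro divide_left_mono) (auto intro!: mult_pos_pos)
    then show ?thesis using \<gamma> by (simp add: K_def)
  qed
  have Ka: "1 \<le> K ^ 3 * a" using a K by (auto simp: mult_ge1_I one_le_power)
  have "\<epsilon> ^ 4 / (32 * (K ^ 3 * a)) \<le> \<epsilon> ^ 4 / (32 * 1)"
    using Ka \<epsilon> by (intro divide_left_mono mult_left_mono) auto
  then show "\<gamma> < 1" using \<gamma>' e4 by linarith
  have t3: "a * K / \<epsilon> * (K\<^sup>2 * \<gamma>) \<le> \<epsilon> / 8"
  proof -
    have "a * K / \<epsilon> * (K\<^sup>2 * \<gamma>) \<le> a * K / \<epsilon> * (K\<^sup>2 * (\<epsilon> ^ 4 / (32 * (K ^ 3 * a))))"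
      using \<gamma>' a K \<epsilon> by (intro mult_left_mono) auto
    also have "\<dots> = \<epsilon> * \<epsilon>\<^sup>2 / 32"
      using a K \<epsilon> by (simp add: field_simps eval_nat_numeral)
    also have "\<dots> \<le> \<epsilon> * 4 / 32" using e2 \<epsilon> by (intro divide_right_mono mult_left_mono) auto
    finally show ?thesis by simp
  qed
  have e1: "real q ^ k / (2 * (\<epsilon> / (2 * real k))) * (real k / real M + (real k)\<^sup>2 * \<gamma>)
      = a * K / \<epsilon> * (K / real M) + a * K / \<epsilon> * (K\<^sup>2 * \<gamma>)"
    by (simp add: a_def K_def distrib_left)
  have e2: "real k * (\<epsilon> / (2 * real k)) / 2 = \<epsilon> / 4" using k by simp
  have "4 / real M + \<epsilon> / 4 + (a * K / \<epsilon> * (K / real M) + a * K / \<epsilon> * (K\<^sup>2 * \<gamma>))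
      \<le> \<epsilon> / 4 + \<epsilon> / 4 + (\<epsilon> / 32 + \<epsilon> / 8)"
    by (intro add_mono t1 t2 t3 order_refl)
  also have "\<dots> \<le> \<epsilon>" using \<epsilon> by simp
  finally show "4 / real M + real k * (\<epsilon> / (2 * real k)) / 2
      + real q ^ k / (2 * (\<epsilon> / (2 * real k))) * (real k / real M + (real k)\<^sup>2 * \<gamma>) \<le> \<epsilon>"
    unfolding e1 e2 .
qed

text \<open>Values lie in \<open>{1..r}\<close>, while \<open>q\<close> bounds the support sizes;
  the constants depend on neither. Strict positivity of \<open>C'\<close> admits positive values of
  \<gamma>.\<close>

theorem theorem6p2:
  shows "\<exists>c' C' :: real. c' \<ge> 0 \<and> C' > 0 \<and>
    (\<forall>(k :: nat) (q :: nat) (\<epsilon> :: real) (n :: nat) (X :: nat set set) (\<Pi>k :: nat set pmf)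
       (r :: nat) (L :: nat) (Y :: ensemble) (\<gamma> :: real).
       k \<ge> 1 \<longrightarrow> q \<ge> 1 \<longrightarrow> \<epsilon> > 0 \<longrightarrow>
       simplicial_complex n X \<longrightarrow> pure_upto X k \<longrightarrow> faces X 1 = (\<lambda>j. {j}) ` {1..n} \<longrightarrow>
       set_pmf \<Pi>k \<subseteq> faces X k \<longrightarrow>
       local_psd_ensemble n r L Y \<longrightarrow>
       (\<forall>j\<in>{1..n}. card (set_pmf (marginal Y j)) \<le> q) \<longrightarrow>
       real L \<ge> c' * real q ^ k * real k ^ 5 / \<epsilon> ^ 4 \<longrightarrow>
       hdx X k \<Pi>k \<gamma> \<longrightarrow>
       \<gamma> \<le> C' * \<epsilon> ^ 4 / (real k ^ (8 + k) * 2 ^ (6 * k) * real q ^ (2 * k)) \<longrightarrow>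
       measure_pmf.expectation
         (pair_pmf \<Pi>k (map_pmf fst (propagation_rounding n Y L k \<Pi>k)))
         (\<lambda>(\<aa>, Y'). l1_dist r \<aa> (Y' \<aa>) (product_of_marginals Y' \<aa>)) \<le> \<epsilon>)"
proof (rule exI[of _ 256], rule exI[of _ "1 / 32"], intro conjI allI impI)
  fix k q n r L :: nat and \<epsilon> \<gamma> :: real and X :: "nat set set" and \<Pi>k :: "nat set pmf" and Y :: ensemble
  assume k: "k \<ge> 1" and q: "q \<ge> 1" and \<epsilon>: "\<epsilon> > 0"
    and X: "simplicial_complex n X" and P: "set_pmf \<Pi>k \<subseteq> faces X k"
    and Y: "local_psd_ensemble n r L Y"
    and supp: "\<forall>j\<in>{1..n}. card (set_pmf (marginal Y j)) \<le> q"
    and L: "real L \<ge> 256 * real q ^ k * real k ^ 5 / \<epsilon> ^ 4"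
    and hdx: "hdx X k \<Pi>k \<gamma>"
    and \<gamma>: "\<gamma> \<le> 1 / 32 * \<epsilon> ^ 4 / (real k ^ (8 + k) * 2 ^ (6 * k) * real q ^ (2 * k))"
  let ?E = "measure_pmf.expectation
    (pair_pmf \<Pi>k (map_pmf fst (propagation_rounding n Y L k \<Pi>k)))
    (\<lambda>(\<aa>, Y'). l1_dist r \<aa> (Y' \<aa>) (product_of_marginals Y' \<aa>))"
  show "?E \<le> \<epsilon>"
  proof (cases "\<epsilon> < 2")
    case False
    have "?E \<le> 2"
      by (rule expected_l1_le_2[where f = "\<lambda>a Z. Z a" and g = "\<lambda>a Z. product_of_marginals Z a"])
    then show ?thesis using False by simp
  next
    case True
    \<comment> \<open>The mixing estimates multiply inequalities by \<gamma>, so a nonnegative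
      parameter is substituted; both hypotheses on \<gamma> survive.\<close>
    define \<gamma>' where "\<gamma>' = max 0 \<gamma>"
    have "\<gamma>' \<le> 1 / 32 * \<epsilon> ^ 4 / (real k ^ (8 + k) * 2 ^ (6 * k) * real q ^ (2 * k))"
      using \<gamma> \<epsilon> by (simp add: \<gamma>'_def)
    note params = rounding_parameters[OF k q \<epsilon> True L this refl]
    interpret rounding_setup n k X \<Pi>k \<gamma>' r L Y q
    proof unfold_locales
      show "hdx X k \<Pi>k \<gamma>'" using hdx by (rule hdx_mono) (simp add: \<gamma>'_def)
      show "local_ensemble n r L Y" using Y by (simp add: local_psd_ensemble_def)
    qed (use X P Y supp q k params(2) in \<open>auto simp: \<gamma>'_def\<close>)
    show ?thesis
      using expected_l1_rounding_le[OF refl params(1), of "\<epsilon> / (2 * real k)"] params(3) \<epsilon> k by simp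
  qed
qed auto

end
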